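(* Let $p\in \mathbb{R}[x_0,x_1,x_2,x_3]$ be a homogeneous polynomial of degree $d$ that is hyperbolic with respect to every vector in the cone $\{(0,v_1,v_2,v_3): v_1,v_2,v_3 >0\}$. Assume $p$ is affine in $x_2$ and affine in $x_3$, and of degree $n$ in $x_1$. Then there exist $k\leq 2n+4$ and $k \times k$ self-adjoint (complex Hermitian) matrices $A_0,A_1,A_2,A_3$ such that $p$ divides the polynomial \[ \det\Big(\sum_{j=0}^{3} x_j A_j\Big), \] the matrices $A_1,A_2,A_3$ are positive semi-definite, and $A_1+A_2+A_3= I$.
   Context: A homogeneous polynomial $P \in \mathbb{R}[x_0,x_1,\dots, x_{m}]$ is hyperbolic with respect to $e \in \mathbb{R}^{m+1}$ if $P(e) \ne 0$ and for all $x\in \mathbb{R}^{m+1}$ the one variable polynomial $t \mapsto P(x-te)$ has only real zeros. A polynomial is affine with respect to a variable $x_j$ if it has degree one in that variable. Here $I$ is the $k\times k$ identity matrix. *)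

theory Defs
  imports
    "HOL-Library.Poly_Mapping"
    "HOL-Library.Numeral_Type"
    "Jordan_Normal_Form.Schur_Decomposition"
begin

text \<open>
  Polynomials over \<open>'a\<close> in variables indexed by \<open>'v\<close>: finitely supported coefficient functions
  on monomials, a monomial being its exponent vector. The convolution product, and hence \<open>dvd\<close>
  and \<open>det\<close>, come from \<^theory>\<open>HOL-Library.Poly_Mapping\<close>. For the four variables
  $x_0,\dots,x_3$ the index type is \<open>4\<close>, whose elements are \<open>0\<close>, \<open>1\<close>, \<open>2\<close>, \<open>3\<close>.
\<close>

type_synonym ('v, 'a) mpoly = "('v \<Rightarrow>\<^sub>0 nat) \<Rightarrow>\<^sub>0 'a"

definition Const :: "'a::zero \<Rightarrow> ('v, 'a) mpoly" where
  "Const c = Poly_Mapping.single 0 c"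

definition Var :: "'v \<Rightarrow> ('v, 'a::zero_neq_one) mpoly" where
  "Var j = Poly_Mapping.single (Poly_Mapping.single j 1) 1"

text \<open>The coefficients are mapped along \<open>h\<close> before evaluating at the point \<open>a\<close>.\<close>

definition mpoly_eval :: "('a::zero \<Rightarrow> 'b::comm_semiring_1) \<Rightarrow> ('v::finite \<Rightarrow> 'b) \<Rightarrow> ('v, 'a) mpoly \<Rightarrow> 'b"
  where
  "mpoly_eval h a p =
     (\<Sum>m\<in>Poly_Mapping.keys p.
        h (Poly_Mapping.lookup p m) * (\<Prod>j\<in>UNIV. a j ^ Poly_Mapping.lookup m j))"

definition homogeneous :: "nat \<Rightarrow> ('v::finite, 'a::zero) mpoly \<Rightarrow> bool" where
  "homogeneous d p \<longleftrightarrow>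
     (\<forall>m\<in>Poly_Mapping.keys p. (\<Sum>j\<in>UNIV. Poly_Mapping.lookup m j) = d)"

text \<open>The degree in a single variable, with value \<open>0\<close> for the zero polynomial.\<close>

definition degree_in :: "'v \<Rightarrow> ('v, 'a::zero) mpoly \<Rightarrow> nat" where
  "degree_in j p = Max (insert 0 ((\<lambda>m. Poly_Mapping.lookup m j) ` Poly_Mapping.keys p))"

definition affine_in :: "'v \<Rightarrow> ('v, 'a::zero) mpoly \<Rightarrow> bool" where
  "affine_in j p \<longleftrightarrow> degree_in j p = 1"

text \<open>
  The zeros of the univariate polynomial $t \mapsto p(x - te)$ are its complex zeros, so the
  condition says that each of them is real. Homogeneity of \<open>p\<close> is a separate hypothesis.
\<close>

definition hyperbolic :: "('v::finite, real) mpoly \<Rightarrow> ('v \<Rightarrow> real) \<Rightarrow> bool" where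
  "hyperbolic p e \<longleftrightarrow>
     mpoly_eval (\<lambda>c. c) e p \<noteq> 0 \<and>
     (\<forall>x :: 'v \<Rightarrow> real. \<forall>t :: complex.
        mpoly_eval complex_of_real (\<lambda>j. complex_of_real (x j) - t * complex_of_real (e j)) p = 0
          \<longrightarrow> t \<in> \<real>)"

definition self_adjoint :: "complex mat \<Rightarrow> bool" where
  "self_adjoint A \<longleftrightarrow> square_mat A \<and> mat_adjoint A = A"

text \<open>The order on \<^typ>\<open>complex\<close> makes \<open>0 \<le> z\<close> mean that \<open>z\<close> is real and nonnegative.\<close>

definition pos_semidef :: "complex mat \<Rightarrow> bool" where
  "pos_semidef A \<longleftrightarrow>
     self_adjoint A \<and> (\<forall>v\<in>carrier_vec (dim_row A). 0 \<le> (A *\<^sub>v v) \<bullet>c v)"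

end

theory Submission
  imports Defs
begin

text \<open>
  Setting $x_0 = 1$ turns \<open>p\<close> into $P = a + b x_2 + c x_3 + e x_2 x_3$ with real polynomials
  $a, b, c, e$ in $x_1$, and hyperbolicity says that $P$ has no zero with $x_1, x_2, x_3$ all in the
  open upper half plane (\<open>hyperbolic_stable_bilinear\<close>).

  Suppose that $e \neq 0$. As $P$ is stable, $b c - a e$ is nonnegative on the real line and can be written as $F F^*$
  (\<open>stable_bilinear_discriminant\<close>, \<open>nonneg_real_poly_hermitian_square\<close>). Then $P / e$ is the determinant
  of $\mathrm{diag}(x_2, x_3) + G(x_1)$, where the Hermitian matrix \<open>G\<close> has diagonal $c/e$, $b/e$ and off-diagonal
  entry $F/e$. Stability of $P$ passes to the pairs $(c, e)$, $(b, e)$ and, once $b \neq 0$, to $(a, b)$: their quotients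
  map the upper half plane into its closure, so that they have only simple real poles with nonpositive residues and
  grow at most linearly with a nonnegative coefficient. Because $\det G = a/e = (a/b)(b/e)$, the same is true of \<open>G\<close> in the sense of
  semidefinite matrices (\<open>herglotz_data_matrix\<close>), and
  $G(x) = \alpha + \beta x - \sum_r R_r / (x - r)$ with $\beta$ and all $R_r$ positive semidefinite.

  Such a function is a Schur complement. Factoring $R_r$ into two rank one matrices, one bordered matrix
  with the entries $x_1 - r$, each taken twice, on the remaining diagonal has $\mathrm{diag}(x_2, x_3) + G(x_1)$ as its
  Schur complement (\<open>hermitian_pencil_exists\<close>). Its coefficient matrices at $x_1, x_2, x_3$ are positive
  semidefinite with positive definite sum, and a congruence makes the sum the identity.
  If \<open>e\<close> has multiple roots, the surplus roots are added as decoupled diagonal entries. Then the determinant is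
  a constant times $P$ times the product of $x_1 - r$ over the distinct roots \<open>r\<close> of \<open>e\<close>, and the size is at most
  $2 + 2 \deg e$. Since $p(0,1,1,1) \neq 0$ bounds the degree of \<open>p\<close> by
  $\deg e + 2$, homogenizing preserves divisibility (\<open>mpoly_dvd_det_pencil\<close>).

  If $e = 0$, stability forces $b = l c$ with a constant $l > 0$ (\<open>stable_linear_proportional\<close>), and
  $P = c\,(l x_2 + x_3) + a$ is handled by the scalar function $a/c$ in the same way.
\<close>

section \<open>Stable pairs of univariate polynomials\<close>

text \<open>In the upper half plane $f + w g \neq 0$ says that wherever \<open>g\<close> does not vanish, $-f/g$ avoids the
upper half plane. Stating this without a quotient keeps the common zeros of \<open>f\<close> and \<open>g\<close> under
control and is preserved by cancelling common factors.\<close>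

definition stable_pair :: "complex poly \<Rightarrow> complex poly \<Rightarrow> bool" where
  "stable_pair f g \<longleftrightarrow> (\<forall>z w. Im z > 0 \<longrightarrow> Im w > 0 \<longrightarrow> poly f z + w * poly g z \<noteq> 0)"

abbreviation complexify :: "real poly \<Rightarrow> complex poly" where
  "complexify \<equiv> map_poly complex_of_real"

lemma stable_pair_cancel:
  assumes "stable_pair (k * f) (k * g)"
  shows "stable_pair f g"
  unfolding stable_pair_def
proof (intro allI impI notI)
  fix z w assume z: "Im z > 0" and w: "Im w > 0" and 0: "poly f z + w * poly g z = 0"
  have "poly (k * f) z + w * poly (k * g) z = poly k z * (poly f z + w * poly g z)"
    by (simp add: algebra_simps)
  with assms z w 0 show False unfolding stable_pair_def by simp
qed

lemma stable_pair_quotient: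
  assumes "stable_pair f g" "Im z > 0" "poly g z \<noteq> 0"
  shows "Im (- (poly f z / poly g z)) \<le> 0"
proof (rule ccontr)
  assume "\<not> ?thesis"
  hence "Im (- (poly f z / poly g z)) > 0" by simp
  from assms(1)[unfolded stable_pair_def, rule_format, OF assms(2) this] assms(3)
  show False by simp
qed

text \<open>The common core of the local arguments at a pole and at infinity. Along a path \<open>z\<close> in the upper half
plane the function $-f/g$ equals a positive real factor $1/e^N$ times a function \<open>h\<close> that tends to a
point of the open upper half plane, so that $-f/g$ itself ends up there.\<close>

lemma not_stable_pair_scaling:
  fixes h :: "real \<Rightarrow> complex"
  assumes "stable_pair f g"
    and "(h \<longlongrightarrow> l) (at_right 0)" "Im l > 0"
    and "\<forall>\<^sub>F e in at_right 0. Im (z e) > 0 \<and> poly g (z e) \<noteq> 0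
           \<and> - (poly f (z e) / poly g (z e)) = h e / of_real (e ^ N)"
  shows False
proof -
  have "((\<lambda>e. Im (h e)) \<longlongrightarrow> Im l) (at_right 0)" using assms(2) by (rule tendsto_Im)
  hence "\<forall>\<^sub>F e in at_right 0. Im (h e) > 0" using assms(3) by (rule order_tendstoD)
  moreover have "\<forall>\<^sub>F e::real in at_right 0. e > 0" by (rule eventually_at_right_less)
  ultimately have "\<forall>\<^sub>F e in at_right 0. Im (h e) > 0 \<and> e > 0 \<and> (Im (z e) > 0 \<and> poly g (z e) \<noteq> 0
           \<and> - (poly f (z e) / poly g (z e)) = h e / of_real (e ^ N))"
    using assms(4) by eventually_elim simp
  then obtain e where e: "Im (h e) > 0" "e > 0" "Im (z e) > 0" "poly g (z e) \<noteq> 0"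
      "- (poly f (z e) / poly g (z e)) = h e / of_real (e ^ N)"
    using eventually_happens[of _ "at_right (0::real)"] by (auto simp: trivial_limit_at_right_real)
  have "Im (h e / of_real (e ^ N)) = Im (h e) / e ^ N" by (rule Im_divide_of_real)
  moreover have "Im (h e) / e ^ N > 0" using e(1,2) by simp
  ultimately show False using stable_pair_quotient[OF assms(1) e(3,4)] unfolding e(5) by linarith
qed

text \<open>Near a pole \<open>r\<close> of order \<open>N\<close> the quotient behaves like $(f(r)/g(r))\,(z-r)^{-N}$. Approaching \<open>r\<close> on
the ray of direction \<open>w\<close> fixes the argument of its values, and stability forbids every direction into the
upper half plane for which this argument is that of a point of the upper half plane.\<close>

lemma no_pole_in_direction:
  fixes r w :: complex
  assumes "stable_pair f ([:-r, 1:] ^ N * g)" "poly g r \<noteq> 0" "w \<noteq> 0"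
    and "Im (- (poly f r / poly g r) / w ^ N) > 0"
    and "Im r > 0 \<or> Im r = 0 \<and> Im w > 0"
  shows False
proof -
  let ?z = "\<lambda>e::real. r + of_real e * w"
  let ?h = "\<lambda>e. - (poly f (?z e) / poly g (?z e)) / w ^ N"
  have z: "(?z \<longlongrightarrow> r) (at_right 0)" 
    by (auto intro!: tendsto_eq_intros)
  have "(?h \<longlongrightarrow> - (poly f r / poly g r) / w ^ N) (at_right 0)"
    using assms(2,3) by (intro tendsto_intros tendsto_poly z) auto
  moreover have "\<forall>\<^sub>F e in at_right 0. poly g (?z e) \<noteq> 0"
    using tendsto_imp_eventually_ne[OF tendsto_poly[OF z] assms(2)] .
  moreover have "\<forall>\<^sub>F e in at_right 0. Im (?z e) > 0"
  proof (cases "Im r > 0")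
    case True
    show ?thesis by (rule order_tendstoD(1)[OF tendsto_Im[OF z] True])
  next
    case False
    thus ?thesis using assms(5) eventually_at_right_less[of 0] by (auto elim: eventually_mono)
  qed
  moreover have "\<forall>\<^sub>F e::real in at_right 0. e > 0" by (rule eventually_at_right_less)
  ultimately show False
  proof (intro not_stable_pair_scaling[OF assms(1) _ assms(4), where z = ?z and N = N])
    assume "\<forall>\<^sub>F e in at_right 0. poly g (?z e) \<noteq> 0" "\<forall>\<^sub>F e in at_right 0. Im (?z e) > 0"
      "\<forall>\<^sub>F e::real in at_right 0. e > 0"
    thus "\<forall>\<^sub>F e in at_right 0. Im (?z e) > 0 \<and> poly ([:- r, 1:] ^ N * g) (?z e) \<noteq> 0 \<and>
      - (poly f (?z e) / poly ([:- r, 1:] ^ N * g) (?z e)) = ?h e / of_real (e ^ N)"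
    proof eventually_elim
      case (elim e)
      have "poly ([:- r, 1:] ^ N * g) (?z e) = of_real (e ^ N) * w ^ N * poly g (?z e)"
        by (simp add: poly_power power_mult_distrib)
      with elim assms(3) show ?case by (simp add: divide_simps)
    qed
  qed
qed

lemma complex_root_exists:
  assumes "N > 0" shows "\<exists>w::complex. w ^ N = z"
proof -
  obtain a where z: "z = rcis (cmod z) a" by (metis rcis_cmod_Arg)
  have "rcis (root N (cmod z)) (a / N) ^ N = rcis (cmod z) a"
    using assms by (simp add: DeMoivre2)
  also have "\<dots> = z" by (rule z[symmetric])
  finally have "rcis (root N (cmod z)) (a / N) ^ N = z" .
  thus ?thesis ..
qed

text \<open>At a zero \<open>z\<close> of \<open>g\<close> in the open upper half plane all directions are available, so one of them sends
$-f/g$ into the upper half plane. This is the instance of Hurwitz' theorem that passes from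
$f + w g$ to its leading coefficient in \<open>w\<close>.\<close>

lemma stable_pair_denom_nonzero:
  assumes st: "stable_pair f g" and "g \<noteq> 0" "Im z > 0"
  shows "poly g z \<noteq> 0"
proof
  assume 0: "poly g z = 0"
  have f: "poly f z \<noteq> 0" 
    using st[unfolded stable_pair_def, rule_format, OF assms(3), of \<i>] 0 by auto
  obtain m h where h: "g = [:-z, 1:] ^ m * h" "\<not> [:-z, 1:] dvd h" and m: "m = Polynomial.order z g"
    using order_decomp[OF assms(2)] by blast
  have N: "m > 0" using 0 assms(2) unfolding m by (simp add: order_gt_0_iff)
  have hz: "poly h z \<noteq> 0" using h(2) by (simp add: poly_eq_0_iff_dvd)
  obtain w where w: "w ^ m = \<i> * (poly f z / poly h z)"
    using complex_root_exists[OF N] by blast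
  have w0: "w \<noteq> 0" using w f hz N by (auto simp: zero_power)
  have "- (poly f z / poly h z) / w ^ m = \<i>"
    unfolding w using f hz by (simp add: field_simps)
  hence "Im (- (poly f z / poly h z) / w ^ m) > 0" by (simp only: imaginary_unit.simps)
  moreover have "stable_pair f ([:-z, 1:] ^ m * h)" using st h(1) by (simp only:)
  ultimately show False using no_pole_in_direction hz w0 assms(3) by blast
qed

text \<open>The upper half plane is invariant under $w \mapsto -1/w$.\<close>

lemma stable_pair_swap: "stable_pair f g \<Longrightarrow> stable_pair (- g) f"
  unfolding stable_pair_def
proof (intro allI impI notI)
  fix z w :: complex
  assume *: "\<forall>z w. 0 < Im z \<longrightarrow> 0 < Im w \<longrightarrow> poly f z + w * poly g z \<noteq> 0"
    and z: "Im z > 0" and w: "Im w > 0" and 0: "poly (- g) z + w * poly f z = 0"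
  have w0: "w \<noteq> 0" using w by auto
  have "Im (- inverse w) > 0" using w w0 by (simp add: complex_inverse sum_power2_gt_zero_iff complex_eq_iff)
  hence "poly f z + (- inverse w) * poly g z \<noteq> 0" using * z by blast
  moreover have "poly g z = w * poly f z" using 0 by simp
  ultimately show False using w0 by simp
qed

lemma stable_pair_numer_nonzero:
  "stable_pair f g \<Longrightarrow> f \<noteq> 0 \<Longrightarrow> Im z > 0 \<Longrightarrow> poly f z \<noteq> 0"
  using stable_pair_denom_nonzero stable_pair_swap by blast

lemma sin_three_halves_pi: "sin (3 * pi / 2) = -1"
proof -
  have "3 * pi / 2 = pi / 2 + pi" by simp
  thus ?thesis by (metis sin_periodic_pi sin_pi_half)
qed

text \<open>Directions at a real point are restricted to arguments \<open>t\<close> in $(0,\pi)$. For $N \ge 2$ the angle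
\<open>N t\<close> still runs through a full turn, whereas for $N = 1$ the sine keeps its sign: this is why poles on
the real line must be simple and why their residues have a sign.\<close>

lemma direction_exists:
  fixes k :: real
  assumes "N > 0" "k \<noteq> 0" "k > 0 \<or> N \<ge> 2"
  shows "\<exists>t. sin t > 0 \<and> k * sin (real N * t) > 0"
proof (cases "k > 0")
  case True
  have "pi / (2 * N) < pi" using assms by (simp add: field_simps)
  hence "sin (pi / (2 * N)) > 0" using assms by (intro sin_gt_zero) auto
  moreover have "real N * (pi / (2 * N)) = pi / 2" using assms(1) by (simp add: field_simps)
  hence "sin (real N * (pi / (2 * N))) = 1" by (simp only: sin_pi_half)
  ultimately show ?thesis using True by (intro exI[of _ "pi / (2 * N)"]) (simp del: times_divide_eq_right)
next
  case False
  hence N: "N \<ge> 2" "k < 0" using assms by auto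
  have "3 * pi / (2 * N) < pi" using N by (simp add: field_simps)
  hence "sin (3 * pi / (2 * N)) > 0" using assms by (intro sin_gt_zero) auto
  moreover have "real N * (3 * pi / (2 * N)) = 3 * pi / 2" using assms(1) by (simp add: field_simps)
  hence "sin (real N * (3 * pi / (2 * N))) = -1" by (simp only: sin_three_halves_pi)
  ultimately show ?thesis using N by (intro exI[of _ "3 * pi / (2 * N)"]) (simp del: times_divide_eq_right)
qed

lemma complexify_mult: "complexify (f * g) = complexify f * complexify g"
  by (intro poly_eqI) (simp add: coeff_mult coeff_map_poly)

lemma complexify_pCons: "complexify (pCons a p) = pCons (of_real a) (complexify p)"
  by (rule Polynomial.map_poly_pCons) simp

lemma complexify_pow_linear: "complexify ([:-r, 1:] ^ N * g) = [:-of_real r, 1:] ^ N * complexify g"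
proof (induction N)
  case (Suc N)
  have "complexify ([:-r, 1:] ^ Suc N * g) = complexify [:-r, 1:] * complexify ([:-r, 1:] ^ N * g)"
    unfolding complexify_mult[symmetric] power_Suc mult.assoc ..
  also have "complexify [:-r, 1:] = [:-of_real r, 1:]" by (simp add: complexify_pCons)
  finally show ?case unfolding Suc.IH by (simp only: power_Suc mult.assoc)
qed simp

lemma stable_pair_pole_order:
  fixes f g :: "real poly"
  assumes st: "stable_pair (complexify f) (complexify ([:-r, 1:] ^ N * g))"
    and f: "poly f r \<noteq> 0" and g: "poly g r \<noteq> 0" and N: "N > 0"
  shows "N = 1 \<and> poly f r / poly g r < 0"
proof (rule ccontr)
  assume A: "\<not> ?thesis"
  let ?k = "poly f r / poly g r"
  have k0: "?k \<noteq> 0" using f g by simp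
  moreover have "?k > 0 \<or> N \<ge> 2"
  proof (cases "N = 1")
    case True
    with A k0 show ?thesis by linarith
  qed (use N in auto)
  ultimately obtain t where t: "sin t > 0" "?k * sin (real N * t) > 0" using direction_exists N by blast
  have "- (poly (complexify f) (of_real r) / poly (complexify g) (of_real r)) / cis t ^ N
      = - of_real ?k * inverse (cis (real N * t))"
    by (simp add: DeMoivre divide_inverse)
  hence "Im (- (poly (complexify f) (of_real r) / poly (complexify g) (of_real r)) / cis t ^ N) 
      = ?k * sin (real N * t)"
    by (simp only: cis_inverse) simp
  hence "Im (- (poly (complexify f) (of_real r) / poly (complexify g) (of_real r)) / cis t ^ N) > 0"
    using t(2) by (simp only:)
  moreover have "stable_pair (complexify f) ([:-of_real r, 1:] ^ N * complexify g)"
    using st unfolding complexify_pow_linear .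
  ultimately show False using t(1) g by (intro no_pole_in_direction[of _ _ _ _ "cis t"]) auto
qed

lemma stable_pair_simple_pole:
  fixes f g :: "real poly"
  assumes st: "stable_pair (complexify f) (complexify g)" and "g \<noteq> 0"
    and "poly g r = 0" "poly f r \<noteq> 0"
  shows "poly f r / poly (pderiv g) r < 0"
proof -
  obtain m h where h: "g = [:-r, 1:] ^ m * h" "\<not> [:-r, 1:] dvd h" and m: "m = Polynomial.order r g"
    using order_decomp[OF assms(2)] by blast
  have N: "m > 0" using assms unfolding m by (simp add: order_gt_0_iff)
  have hz: "poly h r \<noteq> 0" using h(2) by (simp add: poly_eq_0_iff_dvd)
  have *: "m = 1 \<and> poly f r / poly h r < 0" 
    by (rule stable_pair_pole_order[OF _ assms(4) hz N]) (unfold h(1)[symmetric], rule st)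
  with h(1) have "g = [:-r, 1:] ^ 1 * h" by (simp only:)
  hence "g = [:-r, 1:] * h" by (simp only: power_one_right)
  hence "pderiv g = [:-r, 1:] * pderiv h + h * pderiv [:-r, 1:]" by (simp only: pderiv_mult)
  hence "poly (pderiv g) r = poly h r" by (simp add: pderiv_pCons del: mult_pCons_left mult_pCons_right)
  thus ?thesis using * by simp
qed

text \<open>After cancelling the common power of $z - r$, what is left of \<open>g\<close> at \<open>r\<close> is a pole of the quotient,
hence simple.\<close>

lemma stable_pair_order:
  fixes f g :: "real poly"
  assumes st: "stable_pair (complexify f) (complexify g)" and "g \<noteq> 0" "f \<noteq> 0"
  shows "Polynomial.order r g \<le> Polynomial.order r f + 1"
proof (rule ccontr)
  assume A: "\<not> ?thesis"
  define i where "i = Polynomial.order r f"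
  define j where "j = Polynomial.order r g"
  have ij: "j > i + 1" using A unfolding i_def j_def by simp
  obtain h where h: "g = [:-r, 1:] ^ j * h" "\<not> [:-r, 1:] dvd h"
    using order_decomp[OF assms(2)] unfolding j_def by blast
  obtain k where k: "f = [:-r, 1:] ^ i * k" "\<not> [:-r, 1:] dvd k"
    using order_decomp[OF assms(3)] unfolding i_def by blast
  have g: "g = [:-r, 1:] ^ i * ([:-r, 1:] ^ (j - i) * h)" 
  proof -
    have "[:-r, 1:] ^ j = [:-r, 1:] ^ i * [:-r, 1:] ^ (j - i)" 
      unfolding power_add[symmetric] using ij by simp
    thus ?thesis unfolding h(1) by (simp only: mult.assoc)
  qed
  have "stable_pair (complexify k) (complexify ([:-r, 1:] ^ (j - i) * h))"
  proof (rule stable_pair_cancel)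
    show "stable_pair ([:-of_real r, 1:] ^ i * complexify k) 
        ([:-of_real r, 1:] ^ i * complexify ([:-r, 1:] ^ (j - i) * h))"
      unfolding complexify_pow_linear[of r i, symmetric] k(1)[symmetric] g[symmetric] by (rule st)
  qed
  moreover have "poly k r \<noteq> 0" "poly h r \<noteq> 0" using h(2) k(2) by (simp_all add: poly_eq_0_iff_dvd)
  ultimately have "j - i = 1" using stable_pair_pole_order[of k r "j - i" h] ij by simp
  thus False using ij by simp
qed

text \<open>Infinity is treated as a pole of order $\deg f - \deg g$: along $z = w/e$ with $e \to 0$ the reversed
polynomials give the limit of the rescaled quotient, and the same restriction on directions as at a
finite real point leaves only linear growth with a positive coefficient.\<close>

lemma stable_pair_infinity:
  fixes f g :: "real poly"
  assumes st: "stable_pair (complexify f) (complexify g)" and g: "g \<noteq> 0" and f: "f \<noteq> 0"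
    and d: "degree f > degree g"
  shows "degree f = degree g + 1 \<and> lead_coeff f / lead_coeff g > 0"
proof (rule ccontr)
  assume A: "\<not> ?thesis"
  define N where "N = degree f - degree g"
  have N: "N > 0" "degree f = degree g + N" using d unfolding N_def by linarith+
  let ?k = "- (lead_coeff f / lead_coeff g)"
  have k0: "?k \<noteq> 0" using f g by simp
  moreover have "?k > 0 \<or> N \<ge> 2"
  proof (cases "N = 1")
    case True
    hence "\<not> lead_coeff f / lead_coeff g > 0" using A N(2) by simp
    with k0 have "?k > 0" by linarith
    thus ?thesis ..
  qed (use N in auto)
  ultimately obtain t where t: "sin t > 0" "?k * sin (real N * t) > 0" using direction_exists N by blast
  define w where "w = cis t"
  have w0: "w \<noteq> 0" unfolding w_def by simp
  let ?F = "complexify f" and ?G = "complexify g"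
  have dF: "degree ?F = degree f" "degree ?G = degree g" by (simp_all add: degree_map_poly)
  have lF: "lead_coeff ?F = of_real (lead_coeff f)" "lead_coeff ?G = of_real (lead_coeff g)" 
    by (simp_all add: coeff_map_poly)
  let ?z = "\<lambda>e::real. w / of_real e"
  let ?y = "\<lambda>e::real. of_real e / w"
  let ?h = "\<lambda>e. - (w ^ N * (poly (reflect_poly ?F) (?y e) / poly (reflect_poly ?G) (?y e)))"
  have y: "(?y \<longlongrightarrow> 0) (at_right 0)" 
    by (rule tendsto_eq_intros | use w0 in simp)+
  have G0: "poly (reflect_poly ?G) 0 \<noteq> 0" using g by simp
  have "(?h \<longlongrightarrow> - (w ^ N * (poly (reflect_poly ?F) 0 / poly (reflect_poly ?G) 0))) (at_right 0)"
    using G0 by (intro tendsto_intros tendsto_poly y) auto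
  moreover have "- (w ^ N * (poly (reflect_poly ?F) 0 / poly (reflect_poly ?G) 0)) = of_real ?k * cis (real N * t)"
    unfolding poly_reflect_poly_0 lF w_def DeMoivre by simp
  ultimately have lim: "(?h \<longlongrightarrow> of_real ?k * cis (real N * t)) (at_right 0)" by (simp only:)
  have "\<forall>\<^sub>F e in at_right 0. poly (reflect_poly ?G) (?y e) \<noteq> 0"
    using tendsto_imp_eventually_ne[OF tendsto_poly[OF y] G0] .
  moreover have "\<forall>\<^sub>F e::real in at_right 0. e > 0" by (rule eventually_at_right_less)
  ultimately have "\<forall>\<^sub>F e in at_right 0. Im (?z e) > 0 \<and> poly ?G (?z e) \<noteq> 0 \<and>
      - (poly ?F (?z e) / poly ?G (?z e)) = ?h e / of_real (e ^ N)"
  proof eventually_elim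
    case (elim e)
    have y0: "?y e \<noteq> 0" and inv: "inverse (?y e) = ?z e" using elim w0 by auto
    have F: "poly (reflect_poly ?F) (?y e) = ?y e ^ (degree g + N) * poly ?F (?z e)"
      using poly_reflect_poly_nz[OF y0, of ?F] unfolding dF inv N(2) .
    have G: "poly (reflect_poly ?G) (?y e) = ?y e ^ degree g * poly ?G (?z e)"
      using poly_reflect_poly_nz[OF y0, of ?G] unfolding dF inv .
    have "poly (reflect_poly ?F) (?y e) / poly (reflect_poly ?G) (?y e) = ?y e ^ N * (poly ?F (?z e) / poly ?G (?z e))"
      unfolding F G using y0 by (simp add: power_add)
    moreover have "w ^ N * ?y e ^ N = of_real (e ^ N)" using w0 by (simp add: power_divide)
    ultimately have "?h e = of_real (e ^ N) * - (poly ?F (?z e) / poly ?G (?z e))"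
      by (simp only: mult.assoc[symmetric] mult_minus_right)
    moreover have "Im (?z e) > 0" using elim t(1) by (simp add: w_def Im_divide_of_real)
    moreover have "poly ?G (?z e) \<noteq> 0" using elim(1) unfolding G by simp
    moreover have "complex_of_real (e ^ N) \<noteq> 0" using elim(2) by simp
    ultimately show ?case by (metis nonzero_mult_div_cancel_left)
  qed
  from not_stable_pair_scaling[OF st lim _ this] t(2) show False by simp
qed

lemma stable_pair_degree:
  fixes f g :: "real poly"
  assumes "stable_pair (complexify f) (complexify g)" "g \<noteq> 0"
  shows "degree f \<le> degree g + 1"
proof (cases "f = 0 \<or> degree f \<le> degree g")
  case False
  with stable_pair_infinity[OF assms] show ?thesis by auto
qed auto

lemma stable_pair_coeff:
  fixes f g :: "real poly"
  assumes "stable_pair (complexify f) (complexify g)" "g \<noteq> 0"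
  shows "coeff f (degree g + 1) / lead_coeff g \<ge> 0"
proof (cases "f = 0 \<or> degree f \<le> degree g")
  case True
  thus ?thesis by (auto simp: coeff_eq_0)
next
  case False
  with stable_pair_infinity[OF assms] show ?thesis by auto
qed

section \<open>Real-rooted polynomials and nonnegative polynomials\<close>

definition real_rooted :: "real poly \<Rightarrow> bool" where
  "real_rooted g \<longleftrightarrow> g \<noteq> 0 \<and> (\<forall>z. Im z > 0 \<longrightarrow> poly (complexify g) z \<noteq> 0)"

text \<open>Multisets record root multiplicities; the roots that remain after splitting off one copy of each
root reappear as diagonal entries of the pencil.\<close>

abbreviation monic_with_roots :: "'a::field multiset \<Rightarrow> 'a poly" where
  "monic_with_roots M \<equiv> (\<Prod>r\<in>#M. [:-r, 1:])"

lemma monic_with_roots_dvd: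
  fixes b :: "'a::field poly"
  assumes "\<And>r. count M r \<le> Polynomial.order r b"
  shows "monic_with_roots M dvd b"
proof (cases "b = 0")
  case False
  thus ?thesis using assms
  proof (induction M arbitrary: b)
    case (add r M)
    have "1 \<le> Polynomial.order r b" using add.prems(2)[of r] by simp
    hence "[:-r, 1:] ^ 1 dvd b" using order_divides by blast
    then obtain c where c: "b = [:-r, 1:] * c" by (auto elim: dvdE)
    have "c \<noteq> 0" using c add.prems by auto
    moreover have "count M x \<le> Polynomial.order x c" for x
    proof -
      have "Polynomial.order x b = Polynomial.order x [:-r, 1:] + Polynomial.order x c" 
        using c add.prems(1) order_mult by blast
      moreover have "Polynomial.order x [:-r, 1:] = (if x = r then 1 else 0)"
        using order_power_n_n[of r 1] by (auto intro: order_0I)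
      ultimately show ?thesis using add.prems(2)[of x] by (auto split: if_splits)
    qed
    ultimately have "monic_with_roots M dvd c" using add.IH by blast
    thus ?case unfolding c by (simp only: image_mset_add_mset prod_mset.add_mset mult_dvd_mono dvd_refl)
  qed simp
qed simp

lemma real_rooted_factorization:
  assumes "real_rooted g"
  shows "\<exists>K M. K \<noteq> 0 \<and> g = smult K (monic_with_roots M) \<and> size M = degree g"
  using assms
proof (induction "degree g" arbitrary: g)
  case 0
  then obtain K where "g = [:K:]" "K \<noteq> 0" unfolding real_rooted_def by (metis degree_eq_zeroE pCons_0_0)
  thus ?case by (intro exI[of _ K] exI[of _ "{#}"]) auto
next
  case (Suc n)
  have "degree (complexify g) = Suc n" using Suc by (simp add: degree_map_poly)
  hence "\<not> constant (poly (complexify g))" by (simp add: constant_degree)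
  then obtain z where z: "poly (complexify g) z = 0" using fundamental_theorem_of_algebra by blast
  have "poly (complexify g) (cnj z) = 0" 
    using real_poly_cnj_root_iff[of "complexify g" z] z by (simp add: coeff_map_poly)
  hence "\<not> Im z > 0" "\<not> Im (cnj z) > 0" using z Suc(3) unfolding real_rooted_def by auto
  hence "z = of_real (Re z)" by (simp add: complex_eq_iff)
  hence "poly g (Re z) = 0" using z by (metis of_real_hom.poly_map_poly of_real_eq_0_iff)
  then obtain h where h: "g = [:-Re z, 1:] * h" by (metis dvdE poly_eq_0_iff_dvd)
  have g0: "g \<noteq> 0" using Suc(3) real_rooted_def by blast
  hence h0: "h \<noteq> 0" using h by auto
  have dh: "degree g = Suc (degree h)" unfolding h using h0 by (subst degree_mult_eq) auto
  have "complexify g = complexify [:-Re z, 1:] * complexify h" unfolding h by (rule complexify_mult)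
  hence "real_rooted h" using Suc(3) h0 unfolding real_rooted_def by auto
  from Suc(1)[OF _ this] dh Suc(2) obtain K M where KM: "K \<noteq> 0" "h = smult K (monic_with_roots M)" "size M = degree h"
    by auto
  show ?case
    by (rule exI[of _ K], rule exI[of _ "add_mset (Re z) M"]) 
       (use KM dh h in \<open>simp add: mult_smult_right\<close>)
qed

lemma coeff_mult_top:
  fixes p q :: "'a::comm_semiring_0 poly"
  assumes "degree p \<le> m" "degree q \<le> n"
  shows "coeff (p * q) (m + n) = coeff p m * coeff q n"
proof -
  have "coeff (p * q) (m + n) = (\<Sum>i\<le>m + n. if i = m then coeff p m * coeff q n else 0)"
    unfolding coeff_mult
  proof (intro sum.cong refl)
    fix i assume "i \<in> {..m + n}"
    thus "coeff p i * coeff q (m + n - i) = (if i = m then coeff p m * coeff q n else 0)"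
      using assms by (cases i m rule: linorder_cases) (auto simp: coeff_eq_0)
  qed
  thus ?thesis by simp
qed

lemma map_poly_cnj_pCons: "map_poly cnj (pCons a p) = pCons (cnj a) (map_poly cnj p)"
  by (rule Polynomial.map_poly_pCons) simp

lemma map_poly_cnj_mult: "map_poly cnj (f * g) = map_poly cnj f * map_poly cnj g"
  by (intro poly_eqI) (simp add: coeff_mult coeff_map_poly)

text \<open>Nonnegativity is only visible at points where a denominator does not vanish; continuity extends it.\<close>

lemma poly_nonneg_off_finite:
  fixes P :: "real poly"
  assumes "finite S" "\<And>x. x \<notin> S \<Longrightarrow> poly P x \<ge> 0"
  shows "poly P x \<ge> 0"
proof -
  have "open (- (S - {x}))" using assms(1) by (intro open_Compl finite_imp_closed) simp
  hence "\<forall>\<^sub>F y in at x. y \<notin> S" unfolding eventually_at_topological by (intro exI[of _ "- (S - {x})"]) auto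
  hence "\<forall>\<^sub>F y in at x. poly P y \<ge> 0" by eventually_elim (rule assms(2))
  moreover have "(poly P \<longlongrightarrow> poly P x) (at x)" by (intro tendsto_poly tendsto_ident_at)
  ultimately show ?thesis by (intro tendsto_lowerbound) auto
qed

lemma nonneg_poly_double_root:
  fixes P :: "real poly"
  assumes nn: "\<And>x. poly P x \<ge> 0" and r: "poly P r = 0"
  shows "\<exists>Q. P = [:-r, 1:] * ([:-r, 1:] * Q)"
proof -
  obtain Q where Q: "P = [:-r, 1:] * Q" using r by (metis dvdE poly_eq_0_iff_dvd)
  have "poly (pderiv P) r = 0"
    by (rule DERIV_local_min[OF poly_DERIV, of 1]) (use nn r in auto)
  moreover have "pderiv P = [:-r, 1:] * pderiv Q + Q * pderiv [:-r, 1:]" unfolding Q by (rule pderiv_mult)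
  ultimately have "poly Q r = 0" by (simp add: pderiv_pCons del: mult_pCons_left mult_pCons_right)
  then obtain Q2 where "Q = [:-r, 1:] * Q2" by (metis dvdE poly_eq_0_iff_dvd)
  thus ?thesis using Q by blast
qed

lemma real_poly_nonreal_root_factor:
  fixes P :: "real poly"
  assumes z: "poly (complexify P) z = 0" and "Im z \<noteq> 0"
  shows "[:(cmod z)\<^sup>2, - 2 * Re z, 1:] dvd P"
proof -
  let ?q = "[:(cmod z)\<^sup>2, - 2 * Re z, 1:]"
  define R where "R = P mod ?q"
  have "poly (complexify ?q) z = 0"
  proof -
    have "poly (complexify ?q) z = z * cnj z - (z + cnj z) * z + z * z"
      by (simp add: complexify_pCons complex_mult_cnj cmod_power2 complex_add_cnj algebra_simps)
    thus ?thesis by (simp add: algebra_simps)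
  qed
  moreover have "complexify P = complexify ?q * complexify (P div ?q) + complexify R"
  proof -
    have "P = ?q * (P div ?q) + R" unfolding R_def by (simp only: mult_div_mod_eq)
    hence "complexify P = complexify (?q * (P div ?q) + R)" by (rule arg_cong)
    also have "\<dots> = complexify (?q * (P div ?q)) + complexify R" by (rule map_poly_add) auto
    finally show ?thesis by (simp only: complexify_mult)
  qed
  ultimately have 0: "poly (complexify R) z = 0"
    using z by (simp only: poly_add poly_mult mult_zero_left add_0)
  have "degree R < 2" unfolding R_def using degree_mod_less[of ?q P] by auto
  then obtain u v where R: "R = [:u, v:]" 
  proof -
    obtain u R' where R': "R = pCons u R'" by (cases R)
    with \<open>degree R < 2\<close> have "degree R' = 0" by (auto split: if_splits)
    then obtain v where "R' = [:v:]" by (elim degree_eq_zeroE)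
    with R' that show thesis by blast
  qed
  have "poly (complexify [:u, v:]) z = of_real u + z * of_real v" by (simp add: complexify_pCons)
  with 0 have "of_real u + z * of_real v = 0" unfolding R by (simp only:)
  hence "Im z * v = 0" "u + Re z * v = 0" by (auto simp: complex_eq_iff)
  hence "R = 0" using assms(2) R by auto
  thus ?thesis unfolding R_def by (simp add: dvd_eq_mod_eq_0)
qed

text \<open>The Fejer-Riesz factorization on the real line. A real root of a nonnegative polynomial is a double
root and contributes its linear factor to \<open>F\<close> once; of a pair of conjugate nonreal roots one is given
to \<open>F\<close> and the other to its conjugate.\<close>

lemma nonneg_real_poly_hermitian_square:
  fixes P :: "real poly"
  assumes "\<And>x. poly P x \<ge> 0"
  shows "\<exists>F. complexify P = F * map_poly cnj F"
  using assms
proof (induction "degree P" arbitrary: P rule: less_induct)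
  case less
  show ?case
  proof (cases "degree P = 0")
    case True
    then obtain k where k: "P = [:k:]" by (metis degree_eq_zeroE)
    hence "k \<ge> 0" using less.prems[of 0] by simp
    hence "complexify [:k:] = [:of_real (sqrt k):] * map_poly cnj [:of_real (sqrt k):]"
      by (simp add: complexify_pCons map_poly_cnj_pCons flip: of_real_mult)
    thus ?thesis unfolding k ..
  next
    case False
    hence P0: "P \<noteq> 0" by auto
    have "degree (complexify P) \<noteq> 0" using False by (simp add: degree_map_poly)
    hence "\<not> constant (poly (complexify P))" by (simp add: constant_degree)
    then obtain z where z: "poly (complexify P) z = 0" using fundamental_theorem_of_algebra by blast
    show ?thesis
    proof (cases "Im z = 0")
      case True
      hence zr: "z = of_real (Re z)" by (simp add: complex_eq_iff)
      hence "poly P (Re z) = 0" using z by (metis of_real_hom.poly_map_poly of_real_eq_0_iff)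
      then obtain Q where Q: "P = [:-Re z, 1:] * ([:-Re z, 1:] * Q)" 
        using nonneg_poly_double_root less.prems by blast
      have Q0: "Q \<noteq> 0" using P0 Q by auto
      have "[:-Re z, 1:] * Q \<noteq> 0" using Q0 by (simp only: mult_eq_0_iff pCons_eq_0_iff) simp
      hence "degree P = 2 + degree Q" unfolding Q using Q0 
        by (simp add: degree_mult_eq del: mult_pCons_left mult_pCons_right)
      moreover have "poly Q x \<ge> 0" for x
      proof (rule poly_nonneg_off_finite[of "{Re z}"])
        fix x assume x: "x \<notin> {Re z}"
        have "poly P x = (x - Re z)\<^sup>2 * poly Q x" unfolding Q by (simp add: power2_eq_square algebra_simps)
        thus "poly Q x \<ge> 0" using less.prems[of x] x by (simp add: zero_le_mult_iff)
      qed simp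
      ultimately obtain F where F: "complexify Q = F * map_poly cnj F" using less.hyps[of Q] by auto
      let ?L = "[:-of_real (Re z), 1:] :: complex poly"
      have "map_poly cnj (?L * F) = ?L * map_poly cnj F"
        unfolding map_poly_cnj_mult by (simp add: complexify_pCons map_poly_cnj_pCons)
      moreover have "complexify P = ?L * (?L * complexify Q)"
        unfolding Q complexify_mult by (simp add: complexify_pCons map_poly_cnj_pCons)
      ultimately show ?thesis unfolding F by (intro exI[of _ "?L * F"]) (simp only: ac_simps)
    next
      case False
      obtain Q where Q: "P = [:(cmod z)\<^sup>2, - 2 * Re z, 1:] * Q"
        by (rule dvdE[OF real_poly_nonreal_root_factor[OF z False]])
      have Q0: "Q \<noteq> 0" using P0 Q by auto
      hence "degree P = 2 + degree Q" unfolding Q by (subst degree_mult_eq) auto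
      moreover have "poly Q x \<ge> 0" for x
      proof -
        have "poly P x = ((x - Re z)\<^sup>2 + (Im z)\<^sup>2) * poly Q x" 
          unfolding Q by (simp add: cmod_power2 algebra_simps) (simp add: power2_eq_square algebra_simps)
        moreover have "(x - Re z)\<^sup>2 + (Im z)\<^sup>2 > 0" using False by (simp add: add_nonneg_pos)
        ultimately show ?thesis using less.prems[of x] by (simp add: zero_le_mult_iff)
      qed
      ultimately obtain F where F: "complexify Q = F * map_poly cnj F" using less.hyps[of Q] by auto
      let ?L = "[:-z, 1:]" and ?L' = "[:-cnj z, 1:]"
      have "map_poly cnj (?L * F) = ?L' * map_poly cnj F"
        unfolding map_poly_cnj_mult by (simp add: complexify_pCons map_poly_cnj_pCons)
      moreover have "complexify P = (?L * ?L') * complexify Q"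
      proof -
        have "complexify [:(cmod z)\<^sup>2, - 2 * Re z, 1:] = ?L * ?L'"
          by (simp add: complexify_pCons complex_mult_cnj cmod_power2 complex_eq_iff) (simp add: power2_eq_square)
        thus ?thesis unfolding Q complexify_mult by (rule arg_cong)
      qed
      ultimately show ?thesis unfolding F by (intro exI[of _ "?L * F"]) (simp only: ac_simps)
    qed
  qed
qed

text \<open>A numerator of degree at most one above that of the denominator leaves a linear polynomial besides
the simple fractions. Both sides, multiplied by the denominator, agree at the points of \<open>S\<close> and in
the two highest coefficients, hence everywhere.\<close>

lemma partial_fractions:
  fixes h :: "'a::field poly"
  assumes S: "finite S" and h: "degree h \<le> card S + 1"
  shows "\<exists>\<alpha>. \<forall>x. x \<notin> S \<longrightarrow> poly h x / (\<Prod>r\<in>S. x - r)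
    = \<alpha> + coeff h (card S + 1) * x + (\<Sum>r\<in>S. (poly h r / (\<Prod>r'\<in>S - {r}. r - r')) / (x - r))"
proof -
  let ?s = "card S"
  define \<rho> where "\<rho> = (\<Prod>r\<in>S. [:-r, 1:])"
  define w where "w = (\<lambda>r. \<Prod>r'\<in>S - {r}. r - r')"
  define lag where "lag = (\<lambda>r. \<Prod>r'\<in>S - {r}. [:-r', 1:])"
  define \<beta> where "\<beta> = coeff h (?s + 1)"
  define q where "q = h - [:0, \<beta>:] * \<rho>"
  define \<alpha> where "\<alpha> = coeff q ?s"
  define L where "L = (\<Sum>r\<in>S. smult (poly h r / w r) (lag r))"
  have \<rho>: "poly \<rho> x = (\<Prod>r\<in>S. x - r)" for x unfolding \<rho>_def by (simp add: poly_prod)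
  have l: "poly (lag r) x = (\<Prod>r'\<in>S - {r}. x - r')" for r x unfolding lag_def by (simp add: poly_prod)
  have d\<rho>: "degree \<rho> = ?s" unfolding \<rho>_def by (subst degree_prod_sum_eq) auto
  have lc\<rho>: "coeff \<rho> ?s = 1"
    using lead_coeff_prod[of "\<lambda>r. [:-r, 1:]" S] d\<rho> unfolding \<rho>_def by simp
  have "degree q \<le> ?s"
  proof (rule degree_le, intro allI impI)
    fix i assume "i > ?s"
    then consider "i = ?s + 1" | "i > ?s + 1" by linarith
    thus "coeff q i = 0"
    proof cases
      case 1
      thus ?thesis unfolding q_def using lc\<rho> by (simp add: \<beta>_def coeff_pCons)
    next
      case 2
      thus ?thesis unfolding q_def using h d\<rho> 
        by (simp add: coeff_eq_0 coeff_pCons split: nat.splits)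
    qed
  qed
  moreover have dL: "degree L \<le> ?s \<and> coeff L ?s = 0"
  proof (cases "S = {}")
    case False
    have d: "degree (lag r) < ?s" if "r \<in> S" for r
    proof -
      have "degree (lag r) = card (S - {r})" unfolding lag_def by (subst degree_prod_sum_eq) auto
      also have "\<dots> < ?s" using that S by (intro card_Diff1_less)
      finally show ?thesis .
    qed
    have "degree L < ?s" unfolding L_def using d False S
      by (intro degree_sum_less) (auto intro: le_less_trans[OF degree_smult_le] simp: card_gt_0_iff)
    thus ?thesis by (simp add: coeff_eq_0)
  qed (simp add: L_def)
  moreover have "poly q r = poly L r" if r: "r \<in> S" for r
  proof -
    have "poly (lag r') r = 0" if "r' \<in> S" "r' \<noteq> r" for r'
      unfolding l using S r that by (intro prod_zero) auto
    hence "poly L r = (\<Sum>r'\<in>S. if r' = r then poly h r / w r * poly (lag r) r else 0)"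
      unfolding L_def poly_sum by (intro sum.cong) auto
    also have "\<dots> = poly h r / w r * poly (lag r) r" using S r by simp
    also have "poly (lag r) r = w r" unfolding l w_def ..
    also have "w r \<noteq> 0" unfolding w_def using S by simp
    hence "poly h r / w r * w r = poly h r" by simp
    finally have "poly L r = poly h r" .
    moreover have "poly \<rho> r = 0" unfolding \<rho> using S r by (intro prod_zero) auto
    ultimately show ?thesis unfolding q_def by simp
  qed
  moreover have "poly \<rho> r = 0" if "r \<in> S" for r unfolding \<rho> using S that by (intro prod_zero) auto
  ultimately have q: "q = smult \<alpha> \<rho> + L"
    using d\<rho> lc\<rho>
    by (intro poly_eqI_degree_lead_coeff[of _ ?s _ S]) 
       (auto simp: \<alpha>_def intro!: degree_add_le intro: order.trans[OF degree_smult_le])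
  have "poly h x / (\<Prod>r\<in>S. x - r) = \<alpha> + \<beta> * x + (\<Sum>r\<in>S. (poly h r / w r) / (x - r))" if x: "x \<notin> S" for x
  proof -
    have nz: "poly \<rho> x \<noteq> 0" unfolding \<rho> using S x by auto
    have "poly h x = poly q x + x * \<beta> * poly \<rho> x" unfolding q_def by simp
    also have "\<dots> = (\<alpha> + \<beta> * x) * poly \<rho> x + poly L x" unfolding q by (simp add: algebra_simps)
    finally have "poly h x / poly \<rho> x = \<alpha> + \<beta> * x + poly L x / poly \<rho> x" using nz by (simp add: field_simps)
    also have "poly L x / poly \<rho> x = (\<Sum>r\<in>S. (poly h r / w r) / (x - r))"
      unfolding L_def poly_sum sum_divide_distrib
    proof (intro sum.cong refl)
      fix r assume r: "r \<in> S"
      have "poly \<rho> x = (x - r) * poly (lag r) x" unfolding \<rho> l using S r by (rule prod.remove)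
      moreover have "x - r \<noteq> 0" using r x by auto
      ultimately show "poly (smult (poly h r / w r) (lag r)) x / poly \<rho> x = poly h r / w r / (x - r)"
        using nz by simp
    qed
    finally show ?thesis unfolding \<rho> .
  qed
  thus ?thesis unfolding w_def \<beta>_def by blast
qed

section \<open>Positive matrix functions from stable pairs\<close>

text \<open>Positive semidefiniteness of the Hermitian matrix with diagonal \<open>x\<close>, \<open>y\<close> and off-diagonal entry \<open>z\<close>,
in terms of its minors.\<close>

definition psd2 :: "real \<Rightarrow> real \<Rightarrow> complex \<Rightarrow> bool" where
  "psd2 x y z \<longleftrightarrow> x \<ge> 0 \<and> y \<ge> 0 \<and> (cmod z)\<^sup>2 \<le> x * y"

text \<open>Let $\rho = \prod_{r \in S} (x - r)$. The data describe the Hermitian matrix function with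
diagonal $h_1/\rho$, $h_2/\rho$ and off-diagonal entry $F/\rho$; the conditions say that
it grows at most linearly, that its linear coefficient is positive semidefinite, and that its residues
are negative semidefinite. These are exactly the conditions under which it maps the upper half plane
to matrices with positive semidefinite imaginary part.\<close>

definition herglotz_data :: "real set \<Rightarrow> real poly \<Rightarrow> real poly \<Rightarrow> complex poly \<Rightarrow> bool" where
  "herglotz_data S h\<^sub>1 h\<^sub>2 F \<longleftrightarrow> finite S \<and>
     degree h\<^sub>1 \<le> card S + 1 \<and> degree h\<^sub>2 \<le> card S + 1 \<and> degree F \<le> card S + 1 \<and>
     psd2 (coeff h\<^sub>1 (card S + 1)) (coeff h\<^sub>2 (card S + 1)) (coeff F (card S + 1)) \<and>
     (\<forall>r\<in>S. let w = (\<Prod>r'\<in>S - {r}. r - r')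
        in psd2 (- poly h\<^sub>1 r / w) (- poly h\<^sub>2 r / w) (- poly F (of_real r) / of_real w))"

lemma poly_complexify: "poly (complexify p) (of_real x) = of_real (poly p x)"
  by (rule of_real_hom.poly_map_poly)

lemma stable_pair_real_rooted:
  fixes f g :: "real poly"
  assumes "stable_pair (complexify f) (complexify g)" "g \<noteq> 0"
  shows "real_rooted g"
proof -
  have "complexify g \<noteq> 0" using assms(2) by simp
  thus ?thesis using stable_pair_denom_nonzero[OF assms(1)] assms(2) unfolding real_rooted_def by blast
qed

lemma order_monic_with_roots: "Polynomial.order r (monic_with_roots M) = count M r"
proof (induction M)
  case (add x M)
  have nz: "[:-x, 1:] * monic_with_roots M \<noteq> 0" by (auto simp: prod_mset_zero_iff simp del: mult_pCons_left)
  have "Polynomial.order r [:-x, 1:] = (if r = x then 1 else 0)"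
    using order_power_n_n[of x 1] by (auto intro: order_0I)
  thus ?case using add order_mult[OF nz, of r] by simp
qed simp

text \<open>Every root is split off once. The cofactor has each root with multiplicity one less, so that by
\<open>stable_pair_order\<close> it divides every numerator that is stably paired with \<open>e\<close>.\<close>

lemma radical_factorization:
  assumes rr: "real_rooted e"
  defines "S \<equiv> {r. poly e r = 0}"
  obtains K M where "K \<noteq> 0" "e = smult K (monic_with_roots M) * (\<Prod>r\<in>S. [:-r, 1:])"
    "size M + card S = degree e"
    "\<And>r. Polynomial.order r (smult K (monic_with_roots M)) = Polynomial.order r e - 1"
proof -
  obtain K N where KN: "K \<noteq> 0" "e = smult K (monic_with_roots N)" "size N = degree e"
    using real_rooted_factorization[OF rr] by blast
  have e0: "e \<noteq> 0" using rr unfolding real_rooted_def by blast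
  have ord: "Polynomial.order r e = count N r" for r
    unfolding KN(2) using KN(1) by (simp add: order_smult order_monic_with_roots)
  have S: "S = set_mset N"
    using order_root[of e] e0 ord by (auto simp: S_def)
  define M where "M = N - mset_set (set_mset N)"
  have sub: "mset_set (set_mset N) \<subseteq># N" by (simp add: subseteq_mset_def count_mset_set')
  have N: "N = M + mset_set (set_mset N)" unfolding M_def using sub by simp
  have "monic_with_roots N = monic_with_roots M * monic_with_roots (mset_set (set_mset N))"
    by (subst N) simp
  also have "monic_with_roots (mset_set (set_mset N)) = (\<Prod>r\<in>S. [:-r, 1:])"
    unfolding S by (rule prod_unfold_prod_mset[symmetric])
  finally have "e = smult K (monic_with_roots M) * (\<Prod>r\<in>S. [:-r, 1:])" using KN(2) by simp
  moreover have "size M + card S = degree e"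
    using arg_cong[OF N, of size] KN(3) unfolding S by simp
  moreover have "Polynomial.order r (smult K (monic_with_roots M)) = Polynomial.order r e - 1" for r
    using KN(1) unfolding ord by (simp add: order_smult order_monic_with_roots M_def count_mset_set' not_in_iff)
  ultimately show thesis using that KN(1) by blast
qed

lemma dvd_from_orders:
  fixes b :: "'a::field poly"
  assumes "K \<noteq> 0" "b \<noteq> 0 \<Longrightarrow> (\<And>r. Polynomial.order r (smult K (monic_with_roots M)) \<le> Polynomial.order r b)"
  shows "smult K (monic_with_roots M) dvd b"
proof (cases "b = 0")
  case False
  thus ?thesis using assms monic_with_roots_dvd[of M b]
    by (simp add: order_smult order_monic_with_roots smult_dvd_iff)
qed simp

lemma pderiv_root_prod:
  fixes h :: "real poly"
  assumes "finite S" "r \<in> S"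
  shows "poly (pderiv ((\<Prod>r\<in>S. [:-r, 1:]) * h)) r = (\<Prod>r'\<in>S - {r}. r - r') * poly h r"
proof -
  let ?l = "(\<Prod>r'\<in>S - {r}. [:-r', 1:])"
  have "(\<Prod>r\<in>S. [:-r, 1:]) * h = [:-r, 1:] * (?l * h)"
    by (subst prod.remove[OF assms]) (simp only: mult.assoc)
  hence "pderiv ((\<Prod>r\<in>S. [:-r, 1:]) * h) = [:-r, 1:] * pderiv (?l * h) + (?l * h) * pderiv [:-r, 1:]"
    by (simp only: pderiv_mult)
  thus ?thesis by (simp add: pderiv_pCons poly_prod del: mult_pCons_left mult_pCons_right)
qed

lemma prod_linear_root: 
  fixes r :: real
  assumes "finite S" "r \<in> S" shows "poly ((\<Prod>r\<in>S. [:-r, 1:]) * h) r = 0"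
  using assms by (auto simp: poly_prod)

lemma degree_prod_linear: "degree (\<Prod>r\<in>S. [:-r, 1:] :: 'a::field poly) = card S"
  by (subst degree_prod_sum_eq) auto

lemma lead_coeff_prod_linear: "lead_coeff (\<Prod>r\<in>S. [:-r, 1:] :: 'a::field poly) = 1"
  by (subst lead_coeff_prod) simp

text \<open>At a point where \<open>h\<close> vanishes there is no pole and the residue is zero; otherwise the sign comes from
the direction argument.\<close>

lemma stable_pair_residue:
  fixes h :: "real poly"
  assumes st: "stable_pair (complexify h) (complexify (\<Prod>r\<in>S. [:-r, 1:]))"
    and S: "finite S" "r \<in> S"
  shows "poly h r / (\<Prod>r'\<in>S - {r}. r - r') \<le> 0"
proof (cases "poly h r = 0")
  case False
  have "(\<Prod>r\<in>S. [:-r, 1:]) \<noteq> (0::real poly)" using S by simp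
  from stable_pair_simple_pole[OF st this _ False] prod_linear_root[OF S, of 1] pderiv_root_prod[OF S, of 1]
  show ?thesis by simp
qed simp

lemma stable_pair_residue_data:
  fixes h :: "real poly"
  assumes st: "stable_pair (complexify h) (complexify (\<Prod>r\<in>S. [:-r, 1:]))" and S: "finite S"
  shows "degree h \<le> card S + 1" "coeff h (card S + 1) \<ge> 0"
proof -
  have nz: "(\<Prod>r\<in>S. [:-r, 1:]) \<noteq> (0::real poly)" using S by simp
  show "degree h \<le> card S + 1" using stable_pair_degree[OF st nz] unfolding degree_prod_linear .
  show "coeff h (card S + 1) \<ge> 0"
    using stable_pair_coeff[OF st nz, unfolded lead_coeff_prod_linear] unfolding degree_prod_linear by simp
qed

text \<open>A scalar function is treated as a matrix function whose second row and column vanish.\<close>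

lemma herglotz_data_scalar:
  fixes h :: "real poly"
  assumes "stable_pair (complexify h) (complexify (\<Prod>r\<in>S. [:-r, 1:]))" "finite S"
  shows "herglotz_data S h 0 0"
  unfolding herglotz_data_def psd2_def Let_def
  using stable_pair_residue_data[OF assms] stable_pair_residue[OF assms] assms(2) by auto

text \<open>The heart of the matter. Write $e = g \rho$ with $\rho$ having the simple roots \<open>S\<close>. Both $c$ and $b$ are
divisible by \<open>g\<close>, and $b c - a e$ by $g^2$; the quotient of the latter is nonnegative and therefore of
the form $F F^*$. The diagonal entries $c/e$ and $b/e$ have the right residues and growth
because \<open>(c, e)\<close> and \<open>(b, e)\<close> are stable pairs. What remains is the sign of the determinant of each
residue and of the linear coefficient. The determinant of the matrix function is $a/e = (a/b)(b/e)$,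
a product of two scalar functions of the same kind, whose residues at a common pole, and whose
leading coefficients, have equal signs.\<close>

lemma herglotz_data_matrix:
  fixes a b c e :: "real poly"
  assumes ce: "stable_pair (complexify c) (complexify e)"
    and be: "stable_pair (complexify b) (complexify e)"
    and ab: "stable_pair (complexify a) (complexify b)"
    and nz: "e \<noteq> 0" "b \<noteq> 0"
    and nn: "\<And>x. poly (b * c - a * e) x \<ge> 0"
  defines "S \<equiv> {r. poly e r = 0}"
  obtains K M h\<^sub>1 h\<^sub>2 F where "K \<noteq> 0" "size M + card S = degree e"
    "e = smult K (monic_with_roots M) * (\<Prod>r\<in>S. [:-r, 1:])"
    "c = smult K (monic_with_roots M) * h\<^sub>1" "b = smult K (monic_with_roots M) * h\<^sub>2"
    "\<And>x. poly (b * c - a * e) x = (poly (smult K (monic_with_roots M)) x)\<^sup>2 * (cmod (poly F (of_real x)))\<^sup>2"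
    "herglotz_data S h\<^sub>1 h\<^sub>2 F"
proof -
  have rr: "real_rooted e" using stable_pair_real_rooted ce nz(1) by blast
  define \<rho> where "\<rho> = (\<Prod>r\<in>S. [:-r, 1:])"
  define s where "s = card S"
  have S: "finite S" unfolding S_def using nz(1) by (rule poly_roots_finite)
  have \<rho>0: "\<rho> \<noteq> 0" unfolding \<rho>_def using S by simp
  have d\<rho>: "degree \<rho> = s" "lead_coeff \<rho> = 1" 
    unfolding \<rho>_def s_def by (rule degree_prod_linear lead_coeff_prod_linear)+
  obtain K M where K: "K \<noteq> 0" and e0: "e = smult K (monic_with_roots M) * \<rho>"
    and size: "size M + card S = degree e"
    and ord: "\<And>r. Polynomial.order r (smult K (monic_with_roots M)) = Polynomial.order r e - 1"
    using radical_factorization[OF rr] unfolding \<rho>_def S_def by blast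
  define g where "g = smult K (monic_with_roots M)"
  have e: "e = g * \<rho>" using e0 unfolding g_def .
  have g0: "g \<noteq> 0" using nz e by auto
  have dvd: "g dvd f" if "stable_pair (complexify f) (complexify e)" for f :: "real poly"
    unfolding g_def
  proof (rule dvd_from_orders[OF K])
    fix r assume "f \<noteq> 0"
    from stable_pair_order[OF that nz(1) this, of r]
    show "Polynomial.order r (smult K (monic_with_roots M)) \<le> Polynomial.order r f" unfolding ord by simp
  qed
  obtain h\<^sub>1 where c: "c = g * h\<^sub>1" using dvd[OF ce] by (elim dvdE)
  obtain h\<^sub>2 where b: "b = g * h\<^sub>2" using dvd[OF be] by (elim dvdE)
  have h20: "h\<^sub>2 \<noteq> 0" using nz b by auto
  (* Only this divisibility makes the numerator of the determinant, a rho / g, a polynomial D;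
     it is a consequence of chaining the order estimates for (b, e) and (a, b). *)
  have "g dvd a * \<rho>"
    unfolding g_def
  proof (rule dvd_from_orders[OF K])
    fix r assume a0: "a * \<rho> \<noteq> 0"
    hence "a \<noteq> 0" by auto
    have 1: "Polynomial.order r e \<le> Polynomial.order r b + 1" by (rule stable_pair_order[OF be nz])
    have 2: "Polynomial.order r b \<le> Polynomial.order r a + 1" by (rule stable_pair_order[OF ab nz(2) \<open>a \<noteq> 0\<close>])
    have 3: "Polynomial.order r (a * \<rho>) = Polynomial.order r a + Polynomial.order r \<rho>" by (rule order_mult[OF a0])
    show "Polynomial.order r (smult K (monic_with_roots M)) \<le> Polynomial.order r (a * \<rho>)"
    proof (cases "r \<in> S")
      case True
      hence "poly \<rho> r = 0" using prod_linear_root[OF S True, of 1] unfolding \<rho>_def by simp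
      hence "Polynomial.order r \<rho> > 0" using \<rho>0 by (simp add: order_gt_0_iff)
      thus ?thesis using 1 2 3 unfolding ord by linarith
    next
      case False
      hence "Polynomial.order r e = 0" using nz unfolding S_def by (simp add: order_0I)
      thus ?thesis unfolding ord by simp
    qed
  qed
  then obtain D where D: "a * \<rho> = g * D" by (elim dvdE)
  define P where "P = h\<^sub>1 * h\<^sub>2 - D"
  have bcae: "b * c - a * e = g * g * P"
  proof -
    have "a * e = g * (g * D)" unfolding e D[symmetric] by (simp only: ac_simps)
    thus ?thesis unfolding P_def b c by (simp add: algebra_simps)
  qed
  have "poly P x \<ge> 0" for x
  proof (rule poly_nonneg_off_finite[OF poly_roots_finite[OF g0]])
    fix x assume "x \<notin> {x. poly g x = 0}"
    moreover have "(poly g x)\<^sup>2 * poly P x \<ge> 0" using nn[of x] unfolding bcae by (simp add: power2_eq_square)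
    ultimately show "poly P x \<ge> 0" by (simp add: zero_le_mult_iff)
  qed
  then obtain F where F: "complexify P = F * map_poly cnj F" using nonneg_real_poly_hermitian_square by blast
  have PF: "poly P x = (cmod (poly F (of_real x)))\<^sup>2" for x
  proof -
    have "complex_of_real (poly P x) = poly F (of_real x) * cnj (poly F (of_real x))"
      unfolding poly_complexify[symmetric] F by simp
    thus ?thesis unfolding complex_norm_square[symmetric] using of_real_eq_iff by blast
  qed
  have st1: "stable_pair (complexify h\<^sub>1) (complexify \<rho>)"
    using ce unfolding c e complexify_mult by (rule stable_pair_cancel)
  have st2: "stable_pair (complexify h\<^sub>2) (complexify \<rho>)"
    using be unfolding b e complexify_mult by (rule stable_pair_cancel)
  have rb: "real_rooted b" using stable_pair_real_rooted[OF ab nz(2)] .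
  (* The quotient D / (rho h2) equals a / b; the pair inherits stability from (a, b), as rho and b
     have no zeros in the upper half plane. *)
  have stD: "stable_pair (complexify D) (complexify (\<rho> * h\<^sub>2))"
    unfolding stable_pair_def
  proof (intro allI impI notI)
    fix z w assume z: "Im z > 0" and w: "Im w > 0"
      and 0: "poly (complexify D) z + w * poly (complexify (\<rho> * h\<^sub>2)) z = 0"
    let ?p = "\<lambda>f. poly (complexify f) z"
    have nzz: "?p b \<noteq> 0" "?p e \<noteq> 0" using rb rr z unfolding real_rooted_def by blast+
    have "?p \<rho> * (?p a + w * ?p b) = ?p g * (?p D + w * ?p (\<rho> * h\<^sub>2))"
      using arg_cong[OF D, of ?p] unfolding b complexify_mult by (simp add: algebra_simps)
    hence "?p \<rho> * (?p a + w * ?p b) = 0" using 0 by simp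
    moreover have "?p \<rho> \<noteq> 0" using nzz unfolding e complexify_mult by simp
    ultimately show False using ab z w unfolding stable_pair_def by simp
  qed
  have rh0: "\<rho> * h\<^sub>2 \<noteq> 0" using \<rho>0 h20 by simp
  define u where "u = (\<lambda>r. \<Prod>r'\<in>S - {r}. r - r')"
  have u0: "u r \<noteq> 0" for r unfolding u_def using S by simp
  have res1: "poly h\<^sub>1 r / u r \<le> 0" and res2: "poly h\<^sub>2 r / u r \<le> 0" if "r \<in> S" for r
    using stable_pair_residue[OF st1[unfolded \<rho>_def] S that] 
      stable_pair_residue[OF st2[unfolded \<rho>_def] S that] unfolding u_def by blast+
  (* If D(r) is nonzero then rho h2 has a simple zero at r, and D(r) is the product of the
     residues of a/b and b/e up to the positive factor u(r)^2. *)
  have D0: "poly D r \<ge> 0" if r: "r \<in> S" for r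
  proof (cases "poly D r = 0")
    case False
    have neg: "poly D r / (u r * poly h\<^sub>2 r) < 0"
      using stable_pair_simple_pole[OF stD rh0 _ False] prod_linear_root[OF S r, of h\<^sub>2] 
        pderiv_root_prod[OF S r, of h\<^sub>2] unfolding u_def \<rho>_def by simp
    hence "poly h\<^sub>2 r \<noteq> 0" by auto
    hence "poly D r = poly D r / (u r * poly h\<^sub>2 r) * (poly h\<^sub>2 r / u r) * (u r)\<^sup>2"
      using u0[of r] by (simp add: power2_eq_square)
    also have "\<dots> \<ge> 0" using neg res2[OF r] by (intro mult_nonneg_nonneg mult_nonpos_nonpos) auto
    finally show ?thesis .
  qed simp
  have d1: "degree h\<^sub>1 \<le> s + 1" and d2: "degree h\<^sub>2 \<le> s + 1"
    and c1: "coeff h\<^sub>1 (s + 1) \<ge> 0" and c2: "coeff h\<^sub>2 (s + 1) \<ge> 0"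
    using stable_pair_residue_data[OF st1[unfolded \<rho>_def] S] 
      stable_pair_residue_data[OF st2[unfolded \<rho>_def] S] unfolding s_def by blast+
  have drh: "degree (\<rho> * h\<^sub>2) = s + degree h\<^sub>2" using degree_mult_eq[OF \<rho>0 h20] d\<rho> by simp
  have dD: "degree D \<le> degree (\<rho> * h\<^sub>2) + 1" by (rule stable_pair_degree[OF stD rh0])
  have dD2: "degree D \<le> (s + 1) + (s + 1)" using dD drh d2 by simp
  (* The same product argument at infinity: D reaches degree 2s+2 only if h2 has degree s+1. *)
  have cD: "coeff D ((s + 1) + (s + 1)) \<ge> 0"
  proof (cases "degree h\<^sub>2 = s + 1")
    case True
    have "lead_coeff (\<rho> * h\<^sub>2) = coeff h\<^sub>2 (s + 1)" unfolding lead_coeff_mult d\<rho>(2) using True by simp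
    moreover have "coeff h\<^sub>2 (s + 1) \<noteq> 0" using True h20 leading_coeff_neq_0 by metis
    moreover have "coeff D (degree (\<rho> * h\<^sub>2) + 1) / lead_coeff (\<rho> * h\<^sub>2) \<ge> 0"
      by (rule stable_pair_coeff[OF stD rh0])
    ultimately have "coeff D (degree (\<rho> * h\<^sub>2) + 1) \<ge> 0" using c2 by (simp add: zero_le_divide_iff)
    moreover have "degree (\<rho> * h\<^sub>2) + 1 = (s + 1) + (s + 1)" using drh True by simp
    ultimately show ?thesis by (simp only:)
  next
    case False
    hence "degree D < (s + 1) + (s + 1)" using dD drh d2 by simp
    thus ?thesis by (simp only: coeff_eq_0)
  qed
  have dP: "degree P \<le> (s + 1) + (s + 1)"
    unfolding P_def using degree_mult_le[of h\<^sub>1 h\<^sub>2] d1 d2 dD2 by (intro degree_diff_le) auto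
  have dF: "degree F \<le> s + 1"
  proof (cases "F = 0")
    case False
    moreover have "degree (map_poly cnj F) = degree F" by (simp add: degree_map_poly)
    moreover have "map_poly cnj F \<noteq> 0" using False by (metis degree_0 leading_coeff_0_iff coeff_map_poly complex_cnj_zero complex_cnj_zero_iff coeff_0)
    ultimately have "degree (complexify P) = degree F + degree F" unfolding F by (simp add: degree_mult_eq)
    moreover have "degree (complexify P) = degree P" by (simp add: degree_map_poly)
    ultimately show ?thesis using dP by simp
  qed simp
  have cF: "(cmod (coeff F (s + 1)))\<^sup>2 \<le> coeff h\<^sub>1 (s + 1) * coeff h\<^sub>2 (s + 1)"
  proof -
    have "complex_of_real (coeff P ((s + 1) + (s + 1))) = coeff (F * map_poly cnj F) ((s + 1) + (s + 1))"
      unfolding F[symmetric] by (simp add: coeff_map_poly)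
    also have "\<dots> = coeff F (s + 1) * cnj (coeff F (s + 1))"
      using dF by (subst coeff_mult_top) (auto simp: coeff_map_poly degree_map_poly)
    finally have "coeff P ((s + 1) + (s + 1)) = (cmod (coeff F (s + 1)))\<^sup>2"
      unfolding complex_norm_square[symmetric] using of_real_eq_iff by blast
    moreover have "coeff P ((s + 1) + (s + 1)) = coeff h\<^sub>1 (s + 1) * coeff h\<^sub>2 (s + 1) - coeff D ((s + 1) + (s + 1))"
      unfolding P_def coeff_diff coeff_mult_top[OF d1 d2] ..
    ultimately show ?thesis using cD by linarith
  qed
  have resF: "(cmod (- poly F (of_real r) / of_real (u r)))\<^sup>2 \<le> (- poly h\<^sub>1 r / u r) * (- poly h\<^sub>2 r / u r)"
    if r: "r \<in> S" for r
  proof -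
    have "(cmod (- poly F (of_real r) / of_real (u r)))\<^sup>2 = poly P r / (u r)\<^sup>2"
      unfolding PF by (simp add: norm_divide power_divide)
    also have "\<dots> \<le> poly h\<^sub>1 r * poly h\<^sub>2 r / (u r)\<^sup>2" using D0[OF r] unfolding P_def by (simp add: divide_right_mono)
    finally show ?thesis by (simp add: power2_eq_square)
  qed
  have "herglotz_data S h\<^sub>1 h\<^sub>2 F"
    unfolding herglotz_data_def psd2_def Let_def s_def[symmetric]
    using S d1 d2 dF c1 c2 cF resF res1 res2 unfolding u_def by auto
  moreover have "poly (b * c - a * e) x = (poly g x)\<^sup>2 * (cmod (poly F (of_real x)))\<^sup>2" for x
    unfolding bcae by (simp add: PF power2_eq_square)
  ultimately show thesis using that[OF K size _ _ _ _ ] e c b unfolding g_def \<rho>_def by blast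
qed

section \<open>Hermitian block matrices\<close>

abbreviation adj :: "complex mat \<Rightarrow> complex mat" where "adj \<equiv> mat_adjoint"

lemma adj_dim [simp]: "dim_row (adj A) = dim_col A" "dim_col (adj A) = dim_row A"
  unfolding mat_adjoint_def by auto

lemma adj_index [simp]: "i < dim_col A \<Longrightarrow> j < dim_row A \<Longrightarrow> adj A $$ (i, j) = cnj (A $$ (j, i))"
  unfolding mat_adjoint_def by (simp add: mat_of_rows_index conjugate_complex_def)

lemma adj_carrier [simp]: "A \<in> carrier_mat n m \<Longrightarrow> adj A \<in> carrier_mat m n"
  by (intro carrier_matI) auto

lemma adj_adj [simp]: "adj (adj A) = A"
  by (intro eq_matI) auto

lemma adj_mult:
  assumes "A \<in> carrier_mat n m" "B \<in> carrier_mat m l"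
  shows "adj (A * B) = adj B * adj A"
  using assms by (intro eq_matI) (auto simp: scalar_prod_def mult.commute)

lemma adj_four_block:
  assumes "A \<in> carrier_mat n n" "B \<in> carrier_mat n m" "C \<in> carrier_mat m n" "D \<in> carrier_mat m m"
  shows "adj (four_block_mat A B C D) = four_block_mat (adj A) (adj C) (adj B) (adj D)"
  using assms by (intro eq_matI) auto

lemma adj_zero [simp]: "adj (0\<^sub>m n m) = 0\<^sub>m m n"
  by (intro eq_matI) auto

lemma adj_one [simp]: "adj (1\<^sub>m n) = 1\<^sub>m n"
  by (intro eq_matI) auto

lemma adj_inner:
  assumes "W \<in> carrier_mat n m" "x \<in> carrier_vec m" "y \<in> carrier_vec n"
  shows "(W *\<^sub>v x) \<bullet>c y = x \<bullet>c (adj W *\<^sub>v y)"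
proof -
  have "(W *\<^sub>v x) \<bullet>c y = (\<Sum>i<n. \<Sum>j<m. W $$ (i, j) * x $ j * cnj (y $ i))"
    using assms by (simp add: scalar_prod_def conjugate_complex_def sum_distrib_right atLeast0LessThan)
  also have "\<dots> = (\<Sum>j<m. \<Sum>i<n. W $$ (i, j) * x $ j * cnj (y $ i))" by (rule sum.swap)
  also have "\<dots> = x \<bullet>c (adj W *\<^sub>v y)"
    using assms by (simp add: scalar_prod_def conjugate_complex_def sum_distrib_left atLeast0LessThan ac_simps)
  finally show ?thesis .
qed

lemma self_adjointI: "A \<in> carrier_mat n n \<Longrightarrow> adj A = A \<Longrightarrow> self_adjoint A"
  unfolding self_adjoint_def by auto

text \<open>All positive semidefinite matrices below are produced as Gram matrices, a form which congruence
preserves.\<close>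

lemma pos_semidef_gram:
  assumes "W \<in> carrier_mat n m"
  shows "pos_semidef (W * adj W)"
  unfolding pos_semidef_def
proof (intro conjI ballI)
  show "self_adjoint (W * adj W)"
    using assms adj_mult[OF assms adj_carrier[OF assms]] by (intro self_adjointI[of _ n]) auto
  fix x :: "complex vec" assume "x \<in> carrier_vec (dim_row (W * adj W))"
  hence x: "x \<in> carrier_vec n" using assms by simp
  have y: "adj W *\<^sub>v x \<in> carrier_vec m" using adj_carrier[OF assms] x by (rule mult_mat_vec_carrier)
  have "(W * adj W *\<^sub>v x) \<bullet>c x = (W *\<^sub>v (adj W *\<^sub>v x)) \<bullet>c x"
    using assoc_mult_mat_vec[OF assms adj_carrier[OF assms] x] by simp
  also have "\<dots> = (adj W *\<^sub>v x) \<bullet>c (adj W *\<^sub>v x)" by (rule adj_inner[OF assms y x])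
  also have "\<dots> \<ge> 0" by (rule conjugate_square_ge_0_vec)
  finally show "0 \<le> (W * adj W *\<^sub>v x) \<bullet>c x" .
qed

text \<open>Column elimination with \<open>E\<close>, the inverse of the lower right block.\<close>

lemma det_four_block_schur:
  fixes A :: "'a::field mat"
  assumes A: "A \<in> carrier_mat n n" and B: "B \<in> carrier_mat n m" and C: "C \<in> carrier_mat m n"
    and D: "D \<in> carrier_mat m m" and E: "E \<in> carrier_mat m m" and DE: "D * E = 1\<^sub>m m"
  shows "det (four_block_mat A B C D) = det (A - B * (E * C)) * det D"
proof -
  let ?N = "four_block_mat (1\<^sub>m n) (0\<^sub>m n m) (- (E * C)) (1\<^sub>m m)"
  have EC: "E * C \<in> carrier_mat m n" using E C by auto
  have nEC: "- (E * C) \<in> carrier_mat m n" using EC by auto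
  have "four_block_mat A B C D * ?N
      = four_block_mat (A * 1\<^sub>m n + B * - (E * C)) (A * 0\<^sub>m n m + B * 1\<^sub>m m)
          (C * 1\<^sub>m n + D * - (E * C)) (C * 0\<^sub>m n m + D * 1\<^sub>m m)"
    by (rule mult_four_block_mat[OF A B C D _ _ nEC]) auto
  also have "A * 1\<^sub>m n + B * - (E * C) = A - B * (E * C)"
  proof -
    have "B * - (E * C) = - (B * (E * C))" by (rule uminus_mult_right_mat) (use B EC in auto)
    thus ?thesis using A B EC by (simp add: minus_add_uminus_mat[of _ n n])
  qed
  also have "A * 0\<^sub>m n m + B * 1\<^sub>m m = B" using A B by simp
  also have "C * 1\<^sub>m n + D * - (E * C) = 0\<^sub>m m n"
  proof -
    have "D * (E * C) = C" using assoc_mult_mat[OF D E C] DE C by simp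
    moreover have "D * - (E * C) = - (D * (E * C))" by (rule uminus_mult_right_mat) (use D EC in auto)
    ultimately have "D * - (E * C) = - C" by simp
    hence "C * 1\<^sub>m n + D * - (E * C) = C + - C" using C by simp
    also have "\<dots> = 0\<^sub>m m n" using C by (intro eq_matI) auto
    finally show ?thesis .
  qed
  also have "C * 0\<^sub>m n m + D * 1\<^sub>m m = D" using C D by simp
  finally have eq: "four_block_mat A B C D * ?N = four_block_mat (A - B * (E * C)) B (0\<^sub>m m n) D" .
  have "det (four_block_mat A B C D) * det ?N = det (four_block_mat A B C D * ?N)"
    by (rule det_mult[symmetric, of _ "n + m"]) (use A D in auto)
  also have "\<dots> = det (A - B * (E * C)) * det D"
    unfolding eq
    by (intro det_four_block_mat_lower_left_zero[OF _ B refl D] minus_carrier_mat mult_carrier_mat[OF B EC])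
  also have "det ?N = det (1\<^sub>m n :: 'a mat) * det (1\<^sub>m m :: 'a mat)"
    using nEC by (intro det_four_block_mat_upper_right_zero[of _ n _ m]) auto
  finally show ?thesis by simp
qed

definition mat2 :: "'a \<Rightarrow> 'a \<Rightarrow> 'a \<Rightarrow> 'a \<Rightarrow> 'a mat" where
  "mat2 a b c d = mat 2 2 (\<lambda>(i, j). if i = 0 then (if j = 0 then a else b) else (if j = 0 then c else d))"

lemma mat2_carrier [simp]: "mat2 a b c d \<in> carrier_mat 2 2"
  unfolding mat2_def by simp

lemma mat2_dim [simp]: "dim_row (mat2 a b c d) = 2" "dim_col (mat2 a b c d) = 2"
  unfolding mat2_def by simp_all

lemma mat2_index [simp]:
  "mat2 a b c d $$ (0, 0) = a" "mat2 a b c d $$ (0, Suc 0) = b"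
  "mat2 a b c d $$ (Suc 0, 0) = c" "mat2 a b c d $$ (Suc 0, Suc 0) = d"
  unfolding mat2_def by simp_all

lemma mat2_eqI:
  assumes "A \<in> carrier_mat 2 2" "A $$ (0, 0) = a" "A $$ (0, Suc 0) = b" "A $$ (Suc 0, 0) = c" "A $$ (Suc 0, Suc 0) = d"
  shows "A = mat2 a b c d"
  using assms by (intro eq_matI) (auto simp: less_2_cases_iff)

lemma sum_upto_2: "sum f {0..<2} = f 0 + f (Suc 0)" for f :: "nat \<Rightarrow> 'a::comm_monoid_add"
  by (simp add: numeral_2_eq_2)

lemma mat2_mult: "mat2 a b c d * mat2 a' b' c' d' = 
   mat2 (a * a' + b * c') (a * b' + b * d') (c * a' + d * c') (c * b' + d * d' :: 'a::comm_ring_1)"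
  by (rule mat2_eqI) (auto simp: scalar_prod_def sum_upto_2)

lemma mat2_add: "mat2 a b c d + mat2 a' b' c' d' = mat2 (a + a') (b + b') (c + c') (d + d' :: 'a::comm_ring_1)"
  by (rule mat2_eqI) auto

lemma mat2_minus: "mat2 a b c d - mat2 a' b' c' d' = mat2 (a - a') (b - b') (c - c') (d - d' :: 'a::comm_ring_1)"
  by (rule mat2_eqI) auto

lemma mat2_smult: "x \<cdot>\<^sub>m mat2 a b c d = mat2 (x * a) (x * b) (x * c) (x * d :: 'a::comm_ring_1)"
  by (rule mat2_eqI) auto

lemma mat2_adj: "adj (mat2 a b c d) = mat2 (cnj a) (cnj c) (cnj b) (cnj d)"
  by (rule mat2_eqI) auto

lemma mat2_one: "1\<^sub>m 2 = mat2 1 0 0 (1 :: 'a::comm_ring_1)"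
  by (rule mat2_eqI) auto

lemma mat2_det: "det (mat2 a b c d) = a * d - b * (c :: 'a::comm_ring_1)"
proof -
  have *: "{p. p permutes {0..<2::nat}} = {id, Transposition.transpose 0 (Suc 0)}"
  proof -
    have "{0..<2::nat} = {0, Suc 0}" by auto
    thus ?thesis using permutes_doubleton_iff[of _ 0 "Suc 0"] by auto
  qed
  have "id \<noteq> Transposition.transpose 0 (Suc 0)" by (metis id_apply transpose_apply_first n_not_Suc_n)
  moreover have "prod f {0..<2} = f 0 * f (Suc 0)" for f :: "nat \<Rightarrow> 'a" by (simp add: numeral_2_eq_2)
  ultimately show ?thesis unfolding det_def by (simp add: * sign_swap_id)
qed

definition diag_fun :: "nat \<Rightarrow> (nat \<Rightarrow> 'a::comm_ring_1) \<Rightarrow> 'a mat" where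
  "diag_fun n f = mat n n (\<lambda>(i, j). if i = j then f i else 0)"

lemma diag_fun_carrier [simp]: "diag_fun n f \<in> carrier_mat n n" unfolding diag_fun_def by simp
lemma diag_fun_dim [simp]: "dim_row (diag_fun n f) = n" "dim_col (diag_fun n f) = n" unfolding diag_fun_def by simp_all
lemma diag_fun_index [simp]: "i < n \<Longrightarrow> j < n \<Longrightarrow> diag_fun n f $$ (i, j) = (if i = j then f i else 0)"
  unfolding diag_fun_def by simp

lemma diag_fun_mult: "diag_fun n f * diag_fun n g = diag_fun n (\<lambda>i. f i * g i)"
  by (intro eq_matI) (auto simp: scalar_prod_def if_distrib[of "\<lambda>x. x * _"] if_distrib[of "\<lambda>x. _ * x"] cong: if_cong)

lemma diag_fun_one: "1\<^sub>m n = diag_fun n (\<lambda>i. 1)" by (intro eq_matI) auto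

lemma diag_fun_det: "det (diag_fun n f) = (\<Prod>i<n. f i)"
proof -
  have "det (diag_fun n f) = prod_list (diag_mat (diag_fun n f))"
    by (rule det_lower_triangular[of n]) auto
  thus ?thesis unfolding prod_list_diag_prod by (simp add: atLeast0LessThan)
qed

lemma diag_fun_adj: "adj (diag_fun n f) = diag_fun n (\<lambda>i. cnj (f i))" by (intro eq_matI) auto

text \<open>The coupling between the two distinguished rows of the pencil and the diagonal block of poles.\<close>

definition two_rows :: "nat \<Rightarrow> (nat \<Rightarrow> 'a) \<Rightarrow> (nat \<Rightarrow> 'a) \<Rightarrow> 'a mat" where
  "two_rows n u v = mat 2 n (\<lambda>(i, j). if i = 0 then u j else v j)"

lemma two_rows_carrier [simp]: "two_rows n u v \<in> carrier_mat 2 n" unfolding two_rows_def by simp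
lemma two_rows_dim [simp]: "dim_row (two_rows n u v) = 2" "dim_col (two_rows n u v) = n" unfolding two_rows_def by simp_all
lemma two_rows_index [simp]: "j < n \<Longrightarrow> two_rows n u v $$ (0, j) = u j" "j < n \<Longrightarrow> two_rows n u v $$ (Suc 0, j) = v j"
  unfolding two_rows_def by simp_all

lemma diag_fun_mult_left: 
  assumes "A \<in> carrier_mat n m" "i < n" "j < m"
  shows "(diag_fun n f * A) $$ (i, j) = f i * A $$ (i, j)"
  using assms by (simp add: scalar_prod_def if_distrib[of "\<lambda>x. x * _"] cong: if_cong)

text \<open>With $f_j = 1/(x - t_j)$ this is the matrix of sums of simple fractions that the Schur complement of
the block of poles subtracts.\<close>

lemma two_rows_sandwich:
  "two_rows n u v * (diag_fun n f * adj (two_rows n u v)) = 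
   mat2 (\<Sum>j<n. u j * f j * cnj (u j)) (\<Sum>j<n. u j * f j * cnj (v j))
        (\<Sum>j<n. v j * f j * cnj (u j)) (\<Sum>j<n. v j * f j * cnj (v j))"
proof -
  have "diag_fun n f * adj (two_rows n u v) = adj (two_rows n (\<lambda>j. cnj (f j) * u j) (\<lambda>j. cnj (f j) * v j))"
    by (intro eq_matI) (auto simp: diag_fun_mult_left[of _ n 2] less_2_cases_iff simp del: index_mult_mat(1))
  moreover have "two_rows n u v * adj (two_rows n u' v') =
      mat2 (\<Sum>j<n. u j * cnj (u' j)) (\<Sum>j<n. u j * cnj (v' j)) (\<Sum>j<n. v j * cnj (u' j)) (\<Sum>j<n. v j * cnj (v' j))"
    for u' v' by (rule mat2_eqI) (auto simp: scalar_prod_def atLeast0LessThan)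
  ultimately show ?thesis by (simp add: mult.assoc)
qed

section \<open>Realization of matrix functions by Hermitian pencils\<close>

text \<open>A positive semidefinite residue is a sum of two rank one matrices, spanned by \<open>(u, v)\<close> and \<open>(0, w)\<close>.
Hence two diagonal entries of the pencil per pole suffice, whatever the rank of the residue.\<close>

lemma psd2_cholesky:
  assumes "psd2 x y z"
  obtains u v w where "complex_of_real x = u * cnj u" "z = u * cnj v" "complex_of_real y = v * cnj v + w * cnj w"
proof (cases "x = 0")
  case True
  hence "z = 0" "y \<ge> 0" using assms unfolding psd2_def by auto
  thus thesis using True that[of 0 0 "of_real (sqrt y)"] by (simp flip: of_real_mult)
next
  case False
  hence x: "x > 0" and y: "y \<ge> 0" and z: "(cmod z)\<^sup>2 \<le> x * y" using assms unfolding psd2_def by auto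
  let ?s = "complex_of_real (sqrt x)"
  have s: "?s * ?s = of_real x" "?s \<noteq> 0" using x by (simp_all flip: of_real_mult)
  have "y - (cmod z)\<^sup>2 / x \<ge> 0" using x z by (simp add: field_simps)
  hence w: "complex_of_real (sqrt (y - (cmod z)\<^sup>2 / x)) * cnj (of_real (sqrt (y - (cmod z)\<^sup>2 / x))) 
      = of_real (y - (cmod z)\<^sup>2 / x)" by (simp flip: of_real_mult)
  have "cnj z / ?s * cnj (cnj z / ?s) = z * cnj z / (?s * ?s)" by (simp add: mult.commute)
  also have "\<dots> = of_real ((cmod z)\<^sup>2 / x)" unfolding s complex_norm_square[symmetric] by simp
  finally have "of_real y = cnj z / ?s * cnj (cnj z / ?s) + of_real (y - (cmod z)\<^sup>2 / x)" by simp
  thus thesis using that[of ?s "cnj z / ?s" "of_real (sqrt (y - (cmod z)\<^sup>2 / x))"] s unfolding w by simp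
qed

text \<open>The inverse of the Cholesky factor of a positive definite matrix transforms the matrix to the identity
by congruence.\<close>

lemma pos_def2_normalize:
  fixes q\<^sub>1 q\<^sub>2 :: real and q :: complex
  assumes "q\<^sub>1 > 0" "(cmod q)\<^sup>2 < q\<^sub>1 * q\<^sub>2"
  obtains a b c where "a > 0" "c > 0"
    "adj (mat2 (of_real a) b 0 (of_real c)) * (mat2 (of_real q\<^sub>1) q (cnj q) (of_real q\<^sub>2) * mat2 (of_real a) b 0 (of_real c)) = 1\<^sub>m 2"
proof -
  define l where "l = sqrt q\<^sub>1"
  define m where "m = sqrt (q\<^sub>2 - (cmod q)\<^sup>2 / q\<^sub>1)"
  have pos: "q\<^sub>2 - (cmod q)\<^sup>2 / q\<^sub>1 > 0" using assms by (simp add: field_simps)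
  have l: "l > 0" "l * l = q\<^sub>1" using assms unfolding l_def by auto
  have m: "m > 0" "m * m = q\<^sub>2 - (cmod q)\<^sup>2 / q\<^sub>1" using pos unfolding m_def by auto
  define L where "L = complex_of_real l" 
  define R where "R = complex_of_real m"
  have nz: "L \<noteq> 0" "R \<noteq> 0" using l m unfolding L_def R_def by auto
  have cn: "cnj L = L" "cnj R = R" unfolding L_def R_def by simp_all
  have q1: "complex_of_real q\<^sub>1 = L * L" unfolding L_def using l(2) by (simp flip: of_real_mult)
  have q2: "complex_of_real q\<^sub>2 = R * R + q * cnj q / (L * L)"
  proof -
    have "q\<^sub>2 = m * m + (cmod q)\<^sup>2 / q\<^sub>1" using m(2) by simp
    hence "complex_of_real q\<^sub>2 = of_real (m * m) + of_real ((cmod q)\<^sup>2) / of_real q\<^sub>1" by (simp only: of_real_divide of_real_add)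
    thus ?thesis unfolding q1 complex_norm_square R_def by simp
  qed
  let ?b = "- q / (L * L * R)"
  have e: "complex_of_real (1 / l) = 1 / L" "complex_of_real (1 / m) = 1 / R" unfolding L_def R_def by simp_all
  have "adj (mat2 (1 / L) ?b 0 (1 / R)) * (mat2 (L * L) q (cnj q) (R * R + q * cnj q / (L * L)) * mat2 (1 / L) ?b 0 (1 / R)) = 1\<^sub>m 2"
    unfolding mat2_adj mat2_mult mat2_one using nz cn by (intro arg_cong4[where f = mat2]) (simp_all add: field_simps)
  thus thesis using that[of "1 / l" "1 / m" ?b] l m unfolding q1 q2 e by simp
qed

lemma pos_semidef_congruence:
  assumes "T \<in> carrier_mat n n" "W \<in> carrier_mat n n"
  shows "pos_semidef (adj T * (W * adj W * T))"
proof -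
  have aT: "adj T \<in> carrier_mat n n" and aW: "adj W \<in> carrier_mat n n" using assms by auto
  have TW: "adj T * W \<in> carrier_mat n n" using aT assms by auto
  have "adj (adj T * W) = adj W * T" using adj_mult[OF aT assms(2)] by simp
  hence "(adj T * W) * adj (adj T * W) = (adj T * W) * (adj W * T)" by simp
  also have "\<dots> = adj T * (W * (adj W * T))"
    using assms aW by (intro assoc_mult_mat[OF aT assms(2)]) auto
  also have "W * (adj W * T) = W * adj W * T"
    using assoc_mult_mat[OF assms(2) aW assms(1)] by simp
  finally show ?thesis using pos_semidef_gram[OF TW] by simp
qed

lemma self_adjoint_congruence:
  assumes "T \<in> carrier_mat n n" "A \<in> carrier_mat n n" "adj A = A"
  shows "self_adjoint (adj T * (A * T))"
proof -
  have aT: "adj T \<in> carrier_mat n n" using assms by auto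
  have AT: "A * T \<in> carrier_mat n n" using assms by auto
  have "adj (adj T * (A * T)) = (adj T * A) * T"
    using adj_mult[OF aT AT] adj_mult[OF assms(2,1)] assms(3) by simp
  also have "\<dots> = adj T * (A * T)" by (rule assoc_mult_mat[OF aT assms(2,1)])
  finally show ?thesis using aT AT by (intro self_adjointI[of _ n]) auto
qed

lemma congruence_add:
  assumes "T \<in> carrier_mat n n" "A \<in> carrier_mat n n" "B \<in> carrier_mat n n"
  shows "adj T * (A * T) + adj T * (B * T) = adj T * ((A + B) * T)"
proof -
  have aT: "adj T \<in> carrier_mat n n" using assms by auto
  have "adj T * ((A + B) * T) = adj T * (A * T + B * T)"
    using add_mult_distrib_mat[OF assms(2,3,1)] by simp
  also have "\<dots> = adj T * (A * T) + adj T * (B * T)"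
    by (rule mult_add_distrib_mat[OF aT]) (use assms in auto)
  finally show ?thesis by simp
qed

lemma congruence_smult:
  fixes x :: complex
  assumes "T \<in> carrier_mat n n" "A \<in> carrier_mat n n"
  shows "x \<cdot>\<^sub>m (adj T * (A * T)) = adj T * ((x \<cdot>\<^sub>m A) * T)"
proof -
  have aT: "adj T \<in> carrier_mat n n" and AT: "A * T \<in> carrier_mat n n" using assms by auto
  show ?thesis using mult_smult_distrib[OF aT AT] mult_smult_assoc_mat[OF assms(2,1)] by simp
qed

lemma block_diag_mult:
  fixes A B :: "'a::semiring_0 mat"
  assumes [simp]: "A \<in> carrier_mat n n" "B \<in> carrier_mat n n" "C \<in> carrier_mat m m" "D \<in> carrier_mat m m"
  shows "four_block_mat A (0\<^sub>m n m) (0\<^sub>m m n) C * four_block_mat B (0\<^sub>m n m) (0\<^sub>m m n) D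
       = four_block_mat (A * B) (0\<^sub>m n m) (0\<^sub>m m n) (C * D)"
proof -
  have AB: "A * B \<in> carrier_mat n n" and CD: "C * D \<in> carrier_mat m m"
    by (rule mult_carrier_mat[OF assms(1,2)] mult_carrier_mat[OF assms(3,4)])+
  show ?thesis
    by (subst mult_four_block_mat[of _ n n _ m _ m _ _ n _ m])
       (simp_all add: right_add_zero_mat[OF AB] left_add_zero_mat[OF CD] right_mult_zero_mat[of _ n n] 
          left_mult_zero_mat[of _ n n] right_mult_zero_mat[of _ m m] left_mult_zero_mat[of _ m m])
qed

definition poles_part :: "nat \<Rightarrow> (nat \<Rightarrow> real) \<Rightarrow> (nat \<Rightarrow> complex) \<Rightarrow> (nat \<Rightarrow> complex) \<Rightarrow> real \<Rightarrow> complex" where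
  "poles_part N t u v x = (\<Sum>j<N. u j * cnj (v j) / of_real (x - t j))"

text \<open>The realization of a matrix function with positive semidefinite linear part and negative semidefinite
residues. Eliminating the diagonal block with entries $x_1 - t_j$ from the block matrix
$M_0 + x_1 M_1 + x_2 M_2 + x_3 M_3$ leaves the two by two matrix whose determinant is displayed. The sum
$M_1 + M_2 + M_3$ is the identity outside the two by two corner and positive definite in it; a
congruence that acts on the corner only turns the sum into the identity and changes the determinant
by the positive constant \<open>k\<close>.\<close>

lemma hermitian_pencil_exists:
  fixes \<alpha>\<^sub>1 \<alpha>\<^sub>2 \<beta>\<^sub>1 \<beta>\<^sub>2 b\<^sub>2 b\<^sub>2' b\<^sub>3 b\<^sub>3' :: real and \<alpha> \<beta> :: complex and t :: "nat \<Rightarrow> real" and u v :: "nat \<Rightarrow> complex"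
  assumes \<beta>: "psd2 \<beta>\<^sub>1 \<beta>\<^sub>2 \<beta>"
    and b: "b\<^sub>2 \<ge> 0" "b\<^sub>2' \<ge> 0" "b\<^sub>3 \<ge> 0" "b\<^sub>3' \<ge> 0" "b\<^sub>2 + b\<^sub>3 > 0" "b\<^sub>2' + b\<^sub>3' > 0"
  shows "\<exists>A\<^sub>0 A\<^sub>1 A\<^sub>2 A\<^sub>3. {A\<^sub>0, A\<^sub>1, A\<^sub>2, A\<^sub>3} \<subseteq> carrier_mat (2 + N) (2 + N) \<and> self_adjoint A\<^sub>0 \<and>
    pos_semidef A\<^sub>1 \<and> pos_semidef A\<^sub>2 \<and> pos_semidef A\<^sub>3 \<and> A\<^sub>1 + A\<^sub>2 + A\<^sub>3 = 1\<^sub>m (2 + N) \<and>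
    (\<exists>k>0. \<forall>x\<^sub>1 x\<^sub>2 x\<^sub>3. (\<forall>j<N. x\<^sub>1 \<noteq> t j) \<longrightarrow>
       det (A\<^sub>0 + of_real x\<^sub>1 \<cdot>\<^sub>m A\<^sub>1 + of_real x\<^sub>2 \<cdot>\<^sub>m A\<^sub>2 + of_real x\<^sub>3 \<cdot>\<^sub>m A\<^sub>3) =
       of_real (k * (\<Prod>j<N. x\<^sub>1 - t j)) *
       ((of_real (\<alpha>\<^sub>1 + \<beta>\<^sub>1 * x\<^sub>1 + b\<^sub>2 * x\<^sub>2 + b\<^sub>3 * x\<^sub>3) - poles_part N t u u x\<^sub>1) *
        (of_real (\<alpha>\<^sub>2 + \<beta>\<^sub>2 * x\<^sub>1 + b\<^sub>2' * x\<^sub>2 + b\<^sub>3' * x\<^sub>3) - poles_part N t v v x\<^sub>1) -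
        (\<alpha> + \<beta> * of_real x\<^sub>1 - poles_part N t u v x\<^sub>1) * 
        (cnj \<alpha> + cnj \<beta> * of_real x\<^sub>1 - poles_part N t v u x\<^sub>1)))"
proof -
  let ?n = "2 + N"
  obtain c d f where cdf: "complex_of_real \<beta>\<^sub>1 = c * cnj c" "\<beta> = c * cnj d" "complex_of_real \<beta>\<^sub>2 = d * cnj d + f * cnj f"
    by (rule psd2_cholesky[OF \<beta>])
  define Z where "Z = (0\<^sub>m N 2 :: complex mat)"
  define Z' where "Z' = (0\<^sub>m 2 N :: complex mat)"
  define C where "C = two_rows N u v"
  have Z[simp]: "Z \<in> carrier_mat N 2" "Z' \<in> carrier_mat 2 N" "C \<in> carrier_mat 2 N" "adj C \<in> carrier_mat N 2"
    unfolding Z_def Z'_def C_def by auto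
  define D where "D = (\<lambda>a b. mat2 (complex_of_real a) 0 0 (of_real b))"
  have D[simp]: "D x y \<in> carrier_mat 2 2" for x y unfolding D_def by simp
  define Y\<^sub>0 where "Y\<^sub>0 = mat2 (complex_of_real \<alpha>\<^sub>1) \<alpha> (cnj \<alpha>) (of_real \<alpha>\<^sub>2)"
  define Y\<^sub>1 where "Y\<^sub>1 = mat2 (complex_of_real \<beta>\<^sub>1) \<beta> (cnj \<beta>) (of_real \<beta>\<^sub>2)"
  have Y[simp]: "Y\<^sub>0 \<in> carrier_mat 2 2" "Y\<^sub>1 \<in> carrier_mat 2 2" unfolding Y\<^sub>0_def Y\<^sub>1_def by auto
  define M\<^sub>0 where "M\<^sub>0 = four_block_mat Y\<^sub>0 C (adj C) (diag_fun N (\<lambda>j. - of_real (t j)))"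
  define M\<^sub>1 where "M\<^sub>1 = four_block_mat Y\<^sub>1 Z' Z (1\<^sub>m N)"
  define M\<^sub>2 where "M\<^sub>2 = four_block_mat (D b\<^sub>2 b\<^sub>2') Z' Z (0\<^sub>m N N)"
  define M\<^sub>3 where "M\<^sub>3 = four_block_mat (D b\<^sub>3 b\<^sub>3') Z' Z (0\<^sub>m N N)"
  have M[simp]: "M\<^sub>0 \<in> carrier_mat ?n ?n" "M\<^sub>1 \<in> carrier_mat ?n ?n" "M\<^sub>2 \<in> carrier_mat ?n ?n" "M\<^sub>3 \<in> carrier_mat ?n ?n"
    unfolding M\<^sub>0_def M\<^sub>1_def M\<^sub>2_def M\<^sub>3_def by (intro four_block_carrier_mat; simp)+
  have sa0: "adj M\<^sub>0 = M\<^sub>0"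
    unfolding M\<^sub>0_def by (subst adj_four_block[of _ 2 _ N]) (auto simp: diag_fun_adj Y\<^sub>0_def mat2_adj)
  let ?W\<^sub>1 = "four_block_mat (mat2 c 0 d f) Z' Z (1\<^sub>m N)"
  let ?W = "\<lambda>x y. four_block_mat (D (sqrt x) (sqrt y)) Z' Z (0\<^sub>m N N)"
  have W1: "?W\<^sub>1 * adj ?W\<^sub>1 = M\<^sub>1"
  proof -
    have "?W\<^sub>1 * adj ?W\<^sub>1 = ?W\<^sub>1 * four_block_mat (adj (mat2 c 0 d f)) Z' Z (1\<^sub>m N)"
      by (subst adj_four_block[of _ 2 _ N]) (auto simp: Z_def Z'_def)
    also have "\<dots> = four_block_mat (mat2 c 0 d f * adj (mat2 c 0 d f)) Z' Z (1\<^sub>m N)"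
      unfolding Z_def Z'_def by (subst block_diag_mult) auto
    also have "mat2 c 0 d f * adj (mat2 c 0 d f) = Y\<^sub>1"
      unfolding mat2_adj mat2_mult Y\<^sub>1_def cdf by (simp add: mult.commute)
    finally show ?thesis unfolding M\<^sub>1_def .
  qed
  have W: "?W x y * adj (?W x y) = four_block_mat (D x y) Z' Z (0\<^sub>m N N)" if "x \<ge> 0" "y \<ge> 0" for x y
  proof -
    have "?W x y * adj (?W x y) = ?W x y * four_block_mat (adj (D (sqrt x) (sqrt y))) Z' Z (0\<^sub>m N N)"
      by (subst adj_four_block[of _ 2 _ N]) (auto simp: Z_def Z'_def)
    also have "\<dots> = four_block_mat (D (sqrt x) (sqrt y) * adj (D (sqrt x) (sqrt y))) Z' Z (0\<^sub>m N N)"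
      unfolding Z_def Z'_def by (subst block_diag_mult) auto
    also have "D (sqrt x) (sqrt y) * adj (D (sqrt x) (sqrt y)) = D x y"
      unfolding D_def mat2_adj mat2_mult using that by (simp flip: of_real_mult)
    finally show ?thesis .
  qed
  have W2: "?W b\<^sub>2 b\<^sub>2' * adj (?W b\<^sub>2 b\<^sub>2') = M\<^sub>2" and W3: "?W b\<^sub>3 b\<^sub>3' * adj (?W b\<^sub>3 b\<^sub>3') = M\<^sub>3"
    unfolding M\<^sub>2_def M\<^sub>3_def using W b by auto
  define q\<^sub>1 where "q\<^sub>1 = \<beta>\<^sub>1 + (b\<^sub>2 + b\<^sub>3)"
  define q\<^sub>2 where "q\<^sub>2 = \<beta>\<^sub>2 + (b\<^sub>2' + b\<^sub>3')"
  have q1: "q\<^sub>1 > 0" using \<beta> b unfolding q\<^sub>1_def psd2_def by simp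
  have q2: "(cmod \<beta>)\<^sup>2 < q\<^sub>1 * q\<^sub>2"
  proof -
    have "(cmod \<beta>)\<^sup>2 \<le> \<beta>\<^sub>1 * \<beta>\<^sub>2" using \<beta> unfolding psd2_def by simp
    also have "\<dots> < \<beta>\<^sub>1 * \<beta>\<^sub>2 + (b\<^sub>2 + b\<^sub>3) * (b\<^sub>2' + b\<^sub>3')" using b by simp
    also have "\<dots> \<le> q\<^sub>1 * q\<^sub>2"
    proof -
      have "0 \<le> \<beta>\<^sub>1 * (b\<^sub>2' + b\<^sub>3') + (b\<^sub>2 + b\<^sub>3) * \<beta>\<^sub>2" using \<beta> b unfolding psd2_def by simp
      thus ?thesis unfolding q\<^sub>1_def q\<^sub>2_def by (simp add: algebra_simps)
    qed
    finally show ?thesis .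
  qed
  obtain a' b' c' where abc: "a' > 0" "c' > 0" 
    "adj (mat2 (of_real a') b' 0 (of_real c')) * (mat2 (of_real q\<^sub>1) \<beta> (cnj \<beta>) (of_real q\<^sub>2) * mat2 (of_real a') b' 0 (of_real c')) = 1\<^sub>m 2"
    by (rule pos_def2_normalize[OF q1 q2])
  define T2 where "T2 = mat2 (of_real a') b' 0 (complex_of_real c')"
  have T2[simp]: "T2 \<in> carrier_mat 2 2" unfolding T2_def by simp
  have detT2: "det T2 = of_real (a' * c')" unfolding T2_def mat2_det by simp
  have detaT2: "det (adj T2) = of_real (a' * c')" unfolding T2_def mat2_adj mat2_det by simp
  define T where "T = four_block_mat T2 Z' Z (1\<^sub>m N)"
  have T[simp]: "T \<in> carrier_mat ?n ?n" unfolding T_def by (intro four_block_carrier_mat) auto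
  have aT: "adj T = four_block_mat (adj T2) Z' Z (1\<^sub>m N)"
    unfolding T_def by (subst adj_four_block[of _ 2 _ N]) (auto simp: Z_def Z'_def)
  have detT: "det T = of_real (a' * c')"
    unfolding T_def Z_def detT2[symmetric] using Z
    by (subst det_four_block_mat_lower_left_zero[of _ 2 _ N]) auto
  have detaT: "det (adj T) = of_real (a' * c')"
    unfolding aT Z_def detaT2[symmetric] using Z
    by (subst det_four_block_mat_lower_left_zero[of _ 2 _ N]) auto
  define cg where "cg = (\<lambda>A. adj T * (A * T))"
  have sum: "M\<^sub>1 + M\<^sub>2 + M\<^sub>3 = four_block_mat (mat2 (of_real q\<^sub>1) \<beta> (cnj \<beta>) (of_real q\<^sub>2)) Z' Z (1\<^sub>m N)"
  proof -
    have "M\<^sub>1 + M\<^sub>2 + M\<^sub>3 = four_block_mat (Y\<^sub>1 + D b\<^sub>2 b\<^sub>2' + D b\<^sub>3 b\<^sub>3') Z' Z (1\<^sub>m N)"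
      unfolding M\<^sub>1_def M\<^sub>2_def M\<^sub>3_def
      by (subst add_four_block_mat[of _ 2 2 _ N _ N], auto simp: Z_def Z'_def)+
    also have "Y\<^sub>1 + D b\<^sub>2 b\<^sub>2' + D b\<^sub>3 b\<^sub>3' = mat2 (of_real q\<^sub>1) \<beta> (cnj \<beta>) (of_real q\<^sub>2)"
      unfolding Y\<^sub>1_def D_def mat2_add q\<^sub>1_def q\<^sub>2_def by (simp add: add.assoc)
    finally show ?thesis .
  qed
  have one: "cg (M\<^sub>1 + M\<^sub>2 + M\<^sub>3) = 1\<^sub>m ?n"
  proof -
    let ?Q = "mat2 (of_real q\<^sub>1) \<beta> (cnj \<beta>) (of_real q\<^sub>2)"
    have QT: "?Q * T2 \<in> carrier_mat 2 2" by (rule mult_carrier_mat[of _ 2 2]) auto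
    have "four_block_mat ?Q Z' Z (1\<^sub>m N) * T = four_block_mat (?Q * T2) Z' Z (1\<^sub>m N)"
      unfolding T_def Z_def Z'_def by (subst block_diag_mult) auto
    moreover have "adj T * four_block_mat (?Q * T2) Z' Z (1\<^sub>m N) = four_block_mat (adj T2 * (?Q * T2)) Z' Z (1\<^sub>m N)"
      unfolding aT using QT
      unfolding Z_def Z'_def by (subst block_diag_mult) auto
    moreover have "four_block_mat (1\<^sub>m 2) Z' Z (1\<^sub>m N) = 1\<^sub>m ?n" unfolding Z_def Z'_def by (rule four_block_one_mat)
    ultimately show ?thesis unfolding cg_def sum abc(3)[folded T2_def] by simp
  qed
  have dets: "det (cg M\<^sub>0 + of_real x\<^sub>1 \<cdot>\<^sub>m cg M\<^sub>1 + of_real x\<^sub>2 \<cdot>\<^sub>m cg M\<^sub>2 + of_real x\<^sub>3 \<cdot>\<^sub>m cg M\<^sub>3) =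
       of_real ((a' * c')\<^sup>2 * (\<Prod>j<N. x\<^sub>1 - t j)) *
       ((of_real (\<alpha>\<^sub>1 + \<beta>\<^sub>1 * x\<^sub>1 + b\<^sub>2 * x\<^sub>2 + b\<^sub>3 * x\<^sub>3) - poles_part N t u u x\<^sub>1) *
        (of_real (\<alpha>\<^sub>2 + \<beta>\<^sub>2 * x\<^sub>1 + b\<^sub>2' * x\<^sub>2 + b\<^sub>3' * x\<^sub>3) - poles_part N t v v x\<^sub>1) -
        (\<alpha> + \<beta> * of_real x\<^sub>1 - poles_part N t u v x\<^sub>1) * 
        (cnj \<alpha> + cnj \<beta> * of_real x\<^sub>1 - poles_part N t v u x\<^sub>1))"
    if x: "\<forall>j<N. x\<^sub>1 \<noteq> t j" for x\<^sub>1 x\<^sub>2 x\<^sub>3 :: real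
  proof -
    let ?x = "complex_of_real x\<^sub>1" and ?y = "complex_of_real x\<^sub>2" and ?z = "complex_of_real x\<^sub>3"
    let ?M = "M\<^sub>0 + ?x \<cdot>\<^sub>m M\<^sub>1 + ?y \<cdot>\<^sub>m M\<^sub>2 + ?z \<cdot>\<^sub>m M\<^sub>3"
    have Mc: "?M \<in> carrier_mat ?n ?n" by (intro add_carrier_mat smult_carrier_mat M)
    have "cg M\<^sub>0 + ?x \<cdot>\<^sub>m cg M\<^sub>1 + ?y \<cdot>\<^sub>m cg M\<^sub>2 + ?z \<cdot>\<^sub>m cg M\<^sub>3 = cg ?M"
      unfolding cg_def congruence_smult[OF T M(2)] congruence_smult[OF T M(3)] congruence_smult[OF T M(4)]
      by (subst congruence_add[OF T]; (intro add_carrier_mat smult_carrier_mat M)?)+ (rule refl)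
    hence "det (cg M\<^sub>0 + ?x \<cdot>\<^sub>m cg M\<^sub>1 + ?y \<cdot>\<^sub>m cg M\<^sub>2 + ?z \<cdot>\<^sub>m cg M\<^sub>3) = det (adj T) * (det ?M * det T)"
      unfolding cg_def using det_mult[OF adj_carrier[OF T] mult_carrier_mat[OF Mc T]] det_mult[OF Mc T] by simp
    also have "\<dots> = of_real ((a' * c')\<^sup>2) * det ?M" unfolding detT detaT by (simp add: power2_eq_square)
    also have "?M = four_block_mat (Y\<^sub>0 + ?x \<cdot>\<^sub>m Y\<^sub>1 + ?y \<cdot>\<^sub>m D b\<^sub>2 b\<^sub>2' + ?z \<cdot>\<^sub>m D b\<^sub>3 b\<^sub>3') C (adj C) 
        (diag_fun N (\<lambda>j. of_real (x\<^sub>1 - t j)))" (is "_ = four_block_mat ?Y _ _ ?L")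
      unfolding M\<^sub>0_def M\<^sub>1_def M\<^sub>2_def M\<^sub>3_def Z_def Z'_def C_def
      by (intro eq_matI) (auto simp: D_def Y\<^sub>0_def Y\<^sub>1_def)
    also have "det \<dots> = det (?Y - C * (diag_fun N (\<lambda>j. 1 / of_real (x\<^sub>1 - t j)) * adj C)) * det ?L"
    proof (rule det_four_block_schur[of _ 2 _ N])
      have "diag_fun N (\<lambda>j. complex_of_real (x\<^sub>1 - t j)) * diag_fun N (\<lambda>j. 1 / of_real (x\<^sub>1 - t j)) = diag_fun N (\<lambda>j. 1)"
        unfolding diag_fun_mult using x by (intro eq_matI) auto
      thus "?L * diag_fun N (\<lambda>j. 1 / of_real (x\<^sub>1 - t j)) = 1\<^sub>m N" unfolding diag_fun_one .
    qed auto
    also have "det ?L = of_real (\<Prod>j<N. x\<^sub>1 - t j)" unfolding diag_fun_det by simp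
    also have "C * (diag_fun N (\<lambda>j. 1 / of_real (x\<^sub>1 - t j)) * adj C) = 
        mat2 (poles_part N t u u x\<^sub>1) (poles_part N t u v x\<^sub>1) (poles_part N t v u x\<^sub>1) (poles_part N t v v x\<^sub>1)"
      unfolding C_def two_rows_sandwich poles_part_def by simp
    also have "det (?Y - mat2 (poles_part N t u u x\<^sub>1) (poles_part N t u v x\<^sub>1) (poles_part N t v u x\<^sub>1) (poles_part N t v v x\<^sub>1))
      = ((of_real (\<alpha>\<^sub>1 + \<beta>\<^sub>1 * x\<^sub>1 + b\<^sub>2 * x\<^sub>2 + b\<^sub>3 * x\<^sub>3) - poles_part N t u u x\<^sub>1) *
        (of_real (\<alpha>\<^sub>2 + \<beta>\<^sub>2 * x\<^sub>1 + b\<^sub>2' * x\<^sub>2 + b\<^sub>3' * x\<^sub>3) - poles_part N t v v x\<^sub>1) -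
        (\<alpha> + \<beta> * of_real x\<^sub>1 - poles_part N t u v x\<^sub>1) * 
        (cnj \<alpha> + cnj \<beta> * of_real x\<^sub>1 - poles_part N t v u x\<^sub>1))" (is "_ = ?R")
      unfolding Y\<^sub>0_def Y\<^sub>1_def D_def mat2_smult mat2_add mat2_minus mat2_det by (simp add: mult.commute)
    also have "of_real ((a' * c')\<^sup>2) * (?R * of_real (\<Prod>j<N. x\<^sub>1 - t j)) = of_real ((a' * c')\<^sup>2 * (\<Prod>j<N. x\<^sub>1 - t j)) * ?R"
      by (simp only: of_real_mult ac_simps)
    finally show ?thesis .
  qed
  have cgc: "cg A \<in> carrier_mat ?n ?n" if "A \<in> carrier_mat ?n ?n" for A
    unfolding cg_def by (intro mult_carrier_mat[of _ ?n ?n] adj_carrier[OF T] that T)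
  have Wc: "?W\<^sub>1 \<in> carrier_mat ?n ?n" "?W x y \<in> carrier_mat ?n ?n" for x y
    by (intro four_block_carrier_mat; simp)+
  have "{cg M\<^sub>0, cg M\<^sub>1, cg M\<^sub>2, cg M\<^sub>3} \<subseteq> carrier_mat ?n ?n" using cgc M by auto
  moreover have "self_adjoint (cg M\<^sub>0)" unfolding cg_def by (rule self_adjoint_congruence[OF T M(1) sa0])
  moreover have "pos_semidef (cg M\<^sub>1)" "pos_semidef (cg M\<^sub>2)" "pos_semidef (cg M\<^sub>3)"
    unfolding cg_def W1[symmetric] W2[symmetric] W3[symmetric] by (rule pos_semidef_congruence[OF T Wc(1)] pos_semidef_congruence[OF T Wc(2)])+
  moreover have "cg M\<^sub>1 + cg M\<^sub>2 + cg M\<^sub>3 = 1\<^sub>m ?n"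
    unfolding one[symmetric] unfolding cg_def
    by (subst congruence_add[OF T]; (intro add_carrier_mat M)?)+ (rule refl)
  moreover have "(a' * c')\<^sup>2 > 0" using abc by simp
  ultimately show ?thesis using dets by blast
qed

lemma complex_partial_fractions:
  fixes F :: "complex poly" and S :: "real set"
  assumes S: "finite S" and F: "degree F \<le> card S + 1"
  shows "\<exists>\<alpha>. \<forall>x. x \<notin> S \<longrightarrow> poly F (of_real x) / of_real (\<Prod>r\<in>S. x - r)
    = \<alpha> + coeff F (card S + 1) * of_real x
      + (\<Sum>r\<in>S. (poly F (of_real r) / of_real (\<Prod>r'\<in>S - {r}. r - r')) / of_real (x - r))"
proof -
  have inj: "inj_on complex_of_real A" for A by (auto simp: inj_on_def)
  have card: "card (complex_of_real ` S) = card S" by (rule card_image[OF inj])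
  have P: "(\<Prod>r\<in>complex_of_real ` A. of_real x - r) = of_real (\<Prod>r\<in>A. x - r)" for A x
    by (subst prod.reindex[OF inj]) simp
  have D: "complex_of_real ` S - {of_real r} = complex_of_real ` (S - {r})" for r by auto
  obtain \<alpha> where \<alpha>: "\<And>z. z \<notin> complex_of_real ` S \<Longrightarrow> poly F z / (\<Prod>r\<in>complex_of_real ` S. z - r)
    = \<alpha> + coeff F (card S + 1) * z
      + (\<Sum>r\<in>complex_of_real ` S. (poly F r / (\<Prod>r'\<in>complex_of_real ` S - {r}. r - r')) / (z - r))"
    using partial_fractions[of "complex_of_real ` S" F] S F unfolding card by auto
  have "poly F (of_real x) / of_real (\<Prod>r\<in>S. x - r)
    = \<alpha> + coeff F (card S + 1) * of_real x
      + (\<Sum>r\<in>S. (poly F (of_real r) / of_real (\<Prod>r'\<in>S - {r}. r - r')) / of_real (x - r))" if "x \<notin> S" for x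
  proof -
    have "complex_of_real x \<notin> complex_of_real ` S" using that by auto
    from \<alpha>[OF this] show ?thesis unfolding P sum.reindex[OF inj] o_def D by simp
  qed
  thus ?thesis by blast
qed

text \<open>The list \<open>L\<close> of poles contains each point of \<open>S\<close> twice, with the two columns of a Cholesky factor of
its residue, and the elements of \<open>M\<close> with zero columns. The latter are decoupled from the rest and
contribute only their linear factors to the determinant. Of the squared factor $\rho^2$ in the determinant
nothing is left in the final formula, as it clears the denominators of the two by two determinant.\<close>

lemma herglotz_data_pencil:
  fixes b\<^sub>0 b\<^sub>0' b\<^sub>2 b\<^sub>2' b\<^sub>3 b\<^sub>3' :: real and S :: "real set" and M :: "real multiset"
  assumes H: "herglotz_data S h\<^sub>1 h\<^sub>2 F"
    and b: "b\<^sub>2 \<ge> 0" "b\<^sub>2' \<ge> 0" "b\<^sub>3 \<ge> 0" "b\<^sub>3' \<ge> 0" "b\<^sub>2 + b\<^sub>3 > 0" "b\<^sub>2' + b\<^sub>3' > 0"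
  defines "k \<equiv> 2 + (2 * card S + size M)"
  shows "\<exists>A\<^sub>0 A\<^sub>1 A\<^sub>2 A\<^sub>3. {A\<^sub>0, A\<^sub>1, A\<^sub>2, A\<^sub>3} \<subseteq> carrier_mat k k \<and> self_adjoint A\<^sub>0 \<and>
    pos_semidef A\<^sub>1 \<and> pos_semidef A\<^sub>2 \<and> pos_semidef A\<^sub>3 \<and> A\<^sub>1 + A\<^sub>2 + A\<^sub>3 = 1\<^sub>m k \<and>
    (\<exists>\<kappa>>0. \<forall>x\<^sub>1 x\<^sub>2 x\<^sub>3. x\<^sub>1 \<notin> S \<longrightarrow> x\<^sub>1 \<notin># M \<longrightarrow>
       det (A\<^sub>0 + of_real x\<^sub>1 \<cdot>\<^sub>m A\<^sub>1 + of_real x\<^sub>2 \<cdot>\<^sub>m A\<^sub>2 + of_real x\<^sub>3 \<cdot>\<^sub>m A\<^sub>3) =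
       of_real (\<kappa> * poly (monic_with_roots M) x\<^sub>1 * 
         (((b\<^sub>0 + b\<^sub>2 * x\<^sub>2 + b\<^sub>3 * x\<^sub>3) * (\<Prod>r\<in>S. x\<^sub>1 - r) + poly h\<^sub>1 x\<^sub>1) * 
          ((b\<^sub>0' + b\<^sub>2' * x\<^sub>2 + b\<^sub>3' * x\<^sub>3) * (\<Prod>r\<in>S. x\<^sub>1 - r) + poly h\<^sub>2 x\<^sub>1) -
          (cmod (poly F (of_real x\<^sub>1)))\<^sup>2)))"
proof -
  define s where "s = card S"
  have S: "finite S" and d: "degree h\<^sub>1 \<le> s + 1" "degree h\<^sub>2 \<le> s + 1" "degree F \<le> s + 1"
    and \<beta>: "psd2 (coeff h\<^sub>1 (s + 1)) (coeff h\<^sub>2 (s + 1)) (coeff F (s + 1))"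
    using H unfolding herglotz_data_def s_def by auto
  define w where "w = (\<lambda>r. \<Prod>r'\<in>S - {r}. r - r')"
  have res: "psd2 (- poly h\<^sub>1 r / w r) (- poly h\<^sub>2 r / w r) (- poly F (of_real r) / of_real (w r))" if "r \<in> S" for r
    using H that unfolding herglotz_data_def w_def by (auto simp: Let_def)
  have "\<exists>p q q'. complex_of_real (- poly h\<^sub>1 r / w r) = p * cnj p \<and> 
      - poly F (of_real r) / of_real (w r) = p * cnj q \<and> 
      complex_of_real (- poly h\<^sub>2 r / w r) = q * cnj q + q' * cnj q'" if "r \<in> S" for r
    by (rule psd2_cholesky[OF res[OF that]]) blast
  then obtain p q q' where pq: "\<And>r. r \<in> S \<Longrightarrow> complex_of_real (- poly h\<^sub>1 r / w r) = p r * cnj (p r)"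
    "\<And>r. r \<in> S \<Longrightarrow> - poly F (of_real r) / of_real (w r) = p r * cnj (q r)"
    "\<And>r. r \<in> S \<Longrightarrow> complex_of_real (- poly h\<^sub>2 r / w r) = q r * cnj (q r) + q' r * cnj (q' r)"
    by metis
  obtain rs where rs: "set rs = S" "distinct rs" using finite_distinct_list[OF S] by blast
  obtain ts where ts: "mset ts = M" using ex_mset by blast
  define L where "L = concat (map (\<lambda>r. [(r, p r, q r), (r, 0, q' r)]) rs) @ map (\<lambda>t. (t, 0, 0 :: complex)) ts"
  define N where "N = length L"
  have N: "N = 2 * card S + size M"
  proof -
    have "N = 2 * length rs + length ts" unfolding N_def L_def by (induction rs) auto
    moreover have "length rs = card S" using rs distinct_card by metis
    moreover have "length ts = size M" using ts size_mset by metis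
    ultimately show ?thesis by (simp only:)
  qed
  define t where "t = (\<lambda>j. fst (L ! j))"
  define u where "u = (\<lambda>j. fst (snd (L ! j)))"
  define v where "v = (\<lambda>j. snd (snd (L ! j)))"
  have sumL: "(\<Sum>j<N. f (L ! j)) = (\<Sum>r\<in>S. f (r, p r, q r) + f (r, 0, q' r)) + (\<Sum>a\<leftarrow>ts. f (a, 0, 0))"
    for f :: "real \<times> complex \<times> complex \<Rightarrow> complex"
  proof -
    have "(\<Sum>j<N. f (L ! j)) = sum_list (map f L)"
      unfolding N_def sum_list_sum_nth by (simp add: atLeast0LessThan)
    also have "\<dots> = (\<Sum>r\<leftarrow>rs. f (r, p r, q r) + f (r, 0, q' r)) + (\<Sum>a\<leftarrow>ts. f (a, 0, 0))"
      unfolding L_def by (induction rs) (auto simp: o_def add.assoc)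
    also have "(\<Sum>r\<leftarrow>rs. f (r, p r, q r) + f (r, 0, q' r)) = (\<Sum>r\<in>S. f (r, p r, q r) + f (r, 0, q' r))"
      unfolding sum_list_distinct_conv_sum_set[OF rs(2)] rs(1) ..
    finally show ?thesis .
  qed
  have prodL: "(\<Prod>j<N. x - t j) = (\<Prod>r\<in>S. x - r)\<^sup>2 * poly (monic_with_roots M) x" for x
  proof -
    have "(\<Prod>j<N. x - t j) = prod_list (map (\<lambda>a. x - fst a) L)"
      unfolding N_def t_def prod.list_conv_set_nth by (simp add: atLeast0LessThan)
    also have "\<dots> = (\<Prod>r\<leftarrow>rs. (x - r)\<^sup>2) * (\<Prod>a\<leftarrow>ts. x - a)"
      unfolding L_def by (induction rs) (auto simp: o_def power2_eq_square)
    also have "(\<Prod>r\<leftarrow>rs. (x - r)\<^sup>2) = (\<Prod>r\<in>S. x - r)\<^sup>2"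
      using prod.distinct_set_conv_list[OF rs(2), of "\<lambda>r. (x - r)\<^sup>2"] rs(1) by (simp add: prod_power_distrib)
    also have "(\<Prod>a\<leftarrow>ts. x - a) = poly (monic_with_roots M) x"
      unfolding ts[symmetric] by (induction ts) (auto simp: algebra_simps)
    finally show ?thesis .
  qed
  have tset: "t j \<in> S \<or> t j \<in># M" if "j < N" for j
  proof -
    have "L ! j \<in> set L" using that unfolding N_def by simp
    thus ?thesis unfolding t_def L_def using rs ts by auto
  qed
  obtain \<alpha>\<^sub>1 where a1: "\<And>x. x \<notin> S \<Longrightarrow> poly h\<^sub>1 x / (\<Prod>r\<in>S. x - r)
    = \<alpha>\<^sub>1 + coeff h\<^sub>1 (s + 1) * x + (\<Sum>r\<in>S. (poly h\<^sub>1 r / w r) / (x - r))"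
    using partial_fractions[OF S, of h\<^sub>1] d unfolding s_def w_def by auto
  obtain \<alpha>\<^sub>2 where a2: "\<And>x. x \<notin> S \<Longrightarrow> poly h\<^sub>2 x / (\<Prod>r\<in>S. x - r)
    = \<alpha>\<^sub>2 + coeff h\<^sub>2 (s + 1) * x + (\<Sum>r\<in>S. (poly h\<^sub>2 r / w r) / (x - r))"
    using partial_fractions[OF S, of h\<^sub>2] d unfolding s_def w_def by auto
  obtain \<alpha> where a: "\<And>x. x \<notin> S \<Longrightarrow> poly F (of_real x) / of_real (\<Prod>r\<in>S. x - r)
    = \<alpha> + coeff F (s + 1) * of_real x + (\<Sum>r\<in>S. (poly F (of_real r) / of_real (w r)) / of_real (x - r))"
    using complex_partial_fractions[OF S, of F] d unfolding s_def w_def by auto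
  have pp: "poles_part N t u u x = - of_real (\<Sum>r\<in>S. (poly h\<^sub>1 r / w r) / (x - r))"
    "poles_part N t v v x = - of_real (\<Sum>r\<in>S. (poly h\<^sub>2 r / w r) / (x - r))"
    "poles_part N t u v x = - (\<Sum>r\<in>S. (poly F (of_real r) / of_real (w r)) / of_real (x - r))"
    "poles_part N t v u x = cnj (poles_part N t u v x)" for x
  proof -
    have "poles_part N t u u x = (\<Sum>r\<in>S. p r * cnj (p r) / of_real (x - r))"
      unfolding poles_part_def t_def u_def
      using sumL[of "\<lambda>a. fst (snd a) * cnj (fst (snd a)) / of_real (x - fst a)"] by simp
    also have "\<dots> = (\<Sum>r\<in>S. - of_real ((poly h\<^sub>1 r / w r) / (x - r)))"
      by (intro sum.cong refl) (simp flip: pq(1))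
    finally show "poles_part N t u u x = - of_real (\<Sum>r\<in>S. (poly h\<^sub>1 r / w r) / (x - r))"
      by (simp add: sum_negf)
    have "poles_part N t v v x = (\<Sum>r\<in>S. q r * cnj (q r) / of_real (x - r) + q' r * cnj (q' r) / of_real (x - r))"
      unfolding poles_part_def t_def v_def
      using sumL[of "\<lambda>a. snd (snd a) * cnj (snd (snd a)) / of_real (x - fst a)"] by simp
    also have "\<dots> = (\<Sum>r\<in>S. - of_real ((poly h\<^sub>2 r / w r) / (x - r)))"
      by (intro sum.cong refl) (simp flip: pq(3) add_divide_distrib)
    finally show "poles_part N t v v x = - of_real (\<Sum>r\<in>S. (poly h\<^sub>2 r / w r) / (x - r))"
      by (simp add: sum_negf)
    have "poles_part N t u v x = (\<Sum>r\<in>S. p r * cnj (q r) / of_real (x - r))"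
      unfolding poles_part_def t_def u_def v_def
      using sumL[of "\<lambda>a. fst (snd a) * cnj (snd (snd a)) / of_real (x - fst a)"] by simp
    also have "\<dots> = (\<Sum>r\<in>S. - ((poly F (of_real r) / of_real (w r)) / of_real (x - r)))"
      by (intro sum.cong refl) (simp flip: pq(2))
    finally show "poles_part N t u v x = - (\<Sum>r\<in>S. (poly F (of_real r) / of_real (w r)) / of_real (x - r))"
      by (simp add: sum_negf)
    show "poles_part N t v u x = cnj (poles_part N t u v x)"
      unfolding poles_part_def by (simp add: mult.commute)
  qed
  obtain A\<^sub>0 A\<^sub>1 A\<^sub>2 A\<^sub>3 \<kappa> where A: "{A\<^sub>0, A\<^sub>1, A\<^sub>2, A\<^sub>3} \<subseteq> carrier_mat (2 + N) (2 + N)" "self_adjoint A\<^sub>0"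
    "pos_semidef A\<^sub>1" "pos_semidef A\<^sub>2" "pos_semidef A\<^sub>3" "A\<^sub>1 + A\<^sub>2 + A\<^sub>3 = 1\<^sub>m (2 + N)" and \<kappa>: "\<kappa> > 0"
    and det: "\<And>x\<^sub>1 x\<^sub>2 x\<^sub>3. (\<forall>j<N. x\<^sub>1 \<noteq> t j) \<Longrightarrow>
       det (A\<^sub>0 + of_real x\<^sub>1 \<cdot>\<^sub>m A\<^sub>1 + of_real x\<^sub>2 \<cdot>\<^sub>m A\<^sub>2 + of_real x\<^sub>3 \<cdot>\<^sub>m A\<^sub>3) =
       of_real (\<kappa> * (\<Prod>j<N. x\<^sub>1 - t j)) *
       ((of_real (b\<^sub>0 + \<alpha>\<^sub>1 + coeff h\<^sub>1 (s + 1) * x\<^sub>1 + b\<^sub>2 * x\<^sub>2 + b\<^sub>3 * x\<^sub>3) - poles_part N t u u x\<^sub>1) *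
        (of_real (b\<^sub>0' + \<alpha>\<^sub>2 + coeff h\<^sub>2 (s + 1) * x\<^sub>1 + b\<^sub>2' * x\<^sub>2 + b\<^sub>3' * x\<^sub>3) - poles_part N t v v x\<^sub>1) -
        (\<alpha> + coeff F (s + 1) * of_real x\<^sub>1 - poles_part N t u v x\<^sub>1) * 
        (cnj \<alpha> + cnj (coeff F (s + 1)) * of_real x\<^sub>1 - poles_part N t v u x\<^sub>1))"
    using hermitian_pencil_exists[OF \<beta> b, where N = N and t = t and u = u and v = v
      and \<alpha>\<^sub>1 = "b\<^sub>0 + \<alpha>\<^sub>1" and \<alpha>\<^sub>2 = "b\<^sub>0' + \<alpha>\<^sub>2" and \<alpha> = \<alpha>] by blast
  have "det (A\<^sub>0 + of_real x\<^sub>1 \<cdot>\<^sub>m A\<^sub>1 + of_real x\<^sub>2 \<cdot>\<^sub>m A\<^sub>2 + of_real x\<^sub>3 \<cdot>\<^sub>m A\<^sub>3) =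
       of_real (\<kappa> * poly (monic_with_roots M) x\<^sub>1 * 
         (((b\<^sub>0 + b\<^sub>2 * x\<^sub>2 + b\<^sub>3 * x\<^sub>3) * (\<Prod>r\<in>S. x\<^sub>1 - r) + poly h\<^sub>1 x\<^sub>1) * 
          ((b\<^sub>0' + b\<^sub>2' * x\<^sub>2 + b\<^sub>3' * x\<^sub>3) * (\<Prod>r\<in>S. x\<^sub>1 - r) + poly h\<^sub>2 x\<^sub>1) -
          (cmod (poly F (of_real x\<^sub>1)))\<^sup>2))"
    if x: "x\<^sub>1 \<notin> S" "x\<^sub>1 \<notin># M" for x\<^sub>1 x\<^sub>2 x\<^sub>3
  proof -
    define \<rho> where "\<rho> = (\<Prod>r\<in>S. x\<^sub>1 - r)"
    have \<rho>: "\<rho> \<noteq> 0" unfolding \<rho>_def using S x by auto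
    let ?l = "b\<^sub>0 + b\<^sub>2 * x\<^sub>2 + b\<^sub>3 * x\<^sub>3" and ?l' = "b\<^sub>0' + b\<^sub>2' * x\<^sub>2 + b\<^sub>3' * x\<^sub>3"
    let ?f = "poly F (of_real x\<^sub>1) / of_real \<rho>"
    have e1: "of_real (b\<^sub>0 + \<alpha>\<^sub>1 + coeff h\<^sub>1 (s + 1) * x\<^sub>1 + b\<^sub>2 * x\<^sub>2 + b\<^sub>3 * x\<^sub>3) - poles_part N t u u x\<^sub>1 
        = complex_of_real (?l + poly h\<^sub>1 x\<^sub>1 / \<rho>)"
      unfolding pp \<rho>_def a1[OF x(1)] by simp
    have e2: "of_real (b\<^sub>0' + \<alpha>\<^sub>2 + coeff h\<^sub>2 (s + 1) * x\<^sub>1 + b\<^sub>2' * x\<^sub>2 + b\<^sub>3' * x\<^sub>3) - poles_part N t v v x\<^sub>1 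
        = complex_of_real (?l' + poly h\<^sub>2 x\<^sub>1 / \<rho>)"
      unfolding pp \<rho>_def a2[OF x(1)] by simp
    have e3: "\<alpha> + coeff F (s + 1) * of_real x\<^sub>1 - poles_part N t u v x\<^sub>1 = ?f"
      unfolding pp \<rho>_def a[OF x(1)] by simp
    have "cnj \<alpha> + cnj (coeff F (s + 1)) * of_real x\<^sub>1 - poles_part N t v u x\<^sub>1 
        = cnj (\<alpha> + coeff F (s + 1) * of_real x\<^sub>1 - poles_part N t u v x\<^sub>1)" unfolding pp(4) by simp
    hence e4: "cnj \<alpha> + cnj (coeff F (s + 1)) * of_real x\<^sub>1 - poles_part N t v u x\<^sub>1 = cnj ?f" unfolding e3 .
    have "det (A\<^sub>0 + of_real x\<^sub>1 \<cdot>\<^sub>m A\<^sub>1 + of_real x\<^sub>2 \<cdot>\<^sub>m A\<^sub>2 + of_real x\<^sub>3 \<cdot>\<^sub>m A\<^sub>3) =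
      of_real (\<kappa> * (\<Prod>j<N. x\<^sub>1 - t j)) * (of_real (?l + poly h\<^sub>1 x\<^sub>1 / \<rho>) * of_real (?l' + poly h\<^sub>2 x\<^sub>1 / \<rho>) - ?f * cnj ?f)"
      unfolding e1[symmetric] e2[symmetric] unfolding e4[symmetric] unfolding e3[symmetric]
      by (rule det) (use tset x in blast)
    also have "?f * cnj ?f = of_real ((cmod (poly F (of_real x\<^sub>1)))\<^sup>2 / \<rho>\<^sup>2)"
      unfolding complex_norm_square[symmetric] by (simp add: norm_divide power_divide)
    also have "of_real (\<kappa> * (\<Prod>j<N. x\<^sub>1 - t j)) * (of_real (?l + poly h\<^sub>1 x\<^sub>1 / \<rho>) * of_real (?l' + poly h\<^sub>2 x\<^sub>1 / \<rho>) 
        - complex_of_real ((cmod (poly F (of_real x\<^sub>1)))\<^sup>2 / \<rho>\<^sup>2)) =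
      of_real (\<kappa> * (\<Prod>j<N. x\<^sub>1 - t j) * ((?l + poly h\<^sub>1 x\<^sub>1 / \<rho>) * (?l' + poly h\<^sub>2 x\<^sub>1 / \<rho>) - (cmod (poly F (of_real x\<^sub>1)))\<^sup>2 / \<rho>\<^sup>2))"
      by (simp only: of_real_mult of_real_diff)
    also have "\<kappa> * (\<Prod>j<N. x\<^sub>1 - t j) * ((?l + poly h\<^sub>1 x\<^sub>1 / \<rho>) * (?l' + poly h\<^sub>2 x\<^sub>1 / \<rho>) - (cmod (poly F (of_real x\<^sub>1)))\<^sup>2 / \<rho>\<^sup>2)
      = \<kappa> * poly (monic_with_roots M) x\<^sub>1 * (\<rho>\<^sup>2 * ((?l + poly h\<^sub>1 x\<^sub>1 / \<rho>) * (?l' + poly h\<^sub>2 x\<^sub>1 / \<rho>) - (cmod (poly F (of_real x\<^sub>1)))\<^sup>2 / \<rho>\<^sup>2))"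
      unfolding prodL \<rho>_def[symmetric] by (simp only: ac_simps)
    also have "\<rho>\<^sup>2 * ((?l + poly h\<^sub>1 x\<^sub>1 / \<rho>) * (?l' + poly h\<^sub>2 x\<^sub>1 / \<rho>) - (cmod (poly F (of_real x\<^sub>1)))\<^sup>2 / \<rho>\<^sup>2)
      = (?l * \<rho> + poly h\<^sub>1 x\<^sub>1) * (?l' * \<rho> + poly h\<^sub>2 x\<^sub>1) - (cmod (poly F (of_real x\<^sub>1)))\<^sup>2"
    proof -
      have "\<rho> * (l + h / \<rho>) = l * \<rho> + h" for l h using \<rho> by (simp add: field_simps)
      from this[of ?l "poly h\<^sub>1 x\<^sub>1", symmetric] this[of ?l' "poly h\<^sub>2 x\<^sub>1", symmetric] show ?thesis
        using \<rho> by (simp only: right_diff_distrib power2_eq_square) (simp add: ac_simps)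
    qed
    finally show ?thesis unfolding \<rho>_def .
  qed
  thus ?thesis unfolding k_def N[symmetric] using A \<kappa> by blast
qed

section \<open>Evaluation of multivariate polynomials\<close>

definition monom_val :: "('v::finite \<Rightarrow> 'b::comm_semiring_1) \<Rightarrow> ('v \<Rightarrow>\<^sub>0 nat) \<Rightarrow> 'b" where
  "monom_val a m = (\<Prod>j\<in>UNIV. a j ^ Poly_Mapping.lookup m j)"

lemma monom_val_0 [simp]: "monom_val a 0 = 1"
  unfolding monom_val_def by simp

lemma monom_val_add: "monom_val a (m + m') = monom_val a m * monom_val a m'"
  unfolding monom_val_def by (simp add: lookup_add power_add prod.distrib)

lemma monom_val_single: "monom_val a (Poly_Mapping.single j n) = a j ^ n"
proof -
  have "monom_val a (Poly_Mapping.single j n) = (\<Prod>i\<in>UNIV. if i = j then a j ^ n else 1)"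
    unfolding monom_val_def by (intro prod.cong) (auto simp: lookup_single when_def)
  thus ?thesis by simp
qed

lemma poly_mapping_additive_induct [case_names single add]:
  fixes P :: "('k \<Rightarrow>\<^sub>0 'a::monoid_add) \<Rightarrow> bool"
  assumes single: "\<And>k v. P (Poly_Mapping.single k v)" and add: "\<And>p q. P p \<Longrightarrow> P q \<Longrightarrow> P (p + q)"
  shows "P p"
proof (induction p rule: update_induct)
  case const
  show ?case using single[of undefined 0] by simp
next
  case (update f a b)
  have "Poly_Mapping.update a b f = f + Poly_Mapping.single a b"
    using update(1) by (intro poly_mapping_eqI) (auto simp: lookup_update lookup_add lookup_single in_keys_iff when_def)
  thus ?case using add update single by simp
qed

lemma mpoly_eval_alt:
  assumes "h 0 = 0" "finite A" "Poly_Mapping.keys p \<subseteq> A"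
  shows "mpoly_eval h a p = (\<Sum>m\<in>A. h (Poly_Mapping.lookup p m) * monom_val a m)"
  unfolding mpoly_eval_def monom_val_def using assms
  by (intro sum.mono_neutral_left) (auto simp: in_keys_iff)

text \<open>The coefficient maps that occur are the identity and the embedding of the reals into the complex
numbers. The laws are kept out of the simplifier, since for the identity they would rewrite a term to
itself.\<close>

locale coeff_hom =
  fixes h :: "'a::comm_ring_1 \<Rightarrow> 'b::comm_ring_1"
  assumes h0: "h 0 = 0" and h1: "h 1 = 1"
    and hadd: "h (x + y) = h x + h y" and hmult: "h (x * y) = h x * h y"
begin

lemma mpoly_eval_0: "mpoly_eval h a 0 = 0"
  unfolding mpoly_eval_def by simp

lemma mpoly_eval_single: "mpoly_eval h a (Poly_Mapping.single m c) = h c * monom_val a m"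
  by (subst mpoly_eval_alt[of h "{m}"]) (auto simp: h0)

lemma mpoly_eval_add: "mpoly_eval h a (p + q) = mpoly_eval h a p + mpoly_eval h a q"
proof -
  let ?A = "Poly_Mapping.keys p \<union> Poly_Mapping.keys q"
  show ?thesis using keys_add[of p q]
    by (simp add: mpoly_eval_alt[of h ?A] h0 lookup_add hadd distrib_right sum.distrib)
qed

lemma mpoly_eval_single_mult:
  "mpoly_eval h a (Poly_Mapping.single m c * q) = h c * monom_val a m * mpoly_eval h a q"
proof (induction q rule: poly_mapping_additive_induct)
  case (single k v)
  show ?case by (simp add: mult_single mpoly_eval_single hmult monom_val_add ac_simps)
next
  case (add p q)
  thus ?case by (simp add: distrib_left mpoly_eval_add)
qed

lemma mpoly_eval_mult: "mpoly_eval h a (p * q) = mpoly_eval h a p * mpoly_eval h a q"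
proof (induction p rule: poly_mapping_additive_induct)
  case (single k v)
  show ?case by (simp add: mpoly_eval_single_mult mpoly_eval_single)
next
  case (add p p')
  thus ?case by (simp add: distrib_right mpoly_eval_add)
qed

lemma mpoly_eval_Const: "mpoly_eval h a (Const c) = h c"
  unfolding Const_def by (simp add: mpoly_eval_single)

lemma mpoly_eval_Var: "mpoly_eval h a (Var j) = a j"
  unfolding Var_def by (simp add: mpoly_eval_single monom_val_single h1)

lemma mpoly_eval_1: "mpoly_eval h a 1 = 1"
  using mpoly_eval_Const[of a 1] unfolding Const_def by (simp add: h1)

lemma mpoly_eval_power: "mpoly_eval h a (p ^ n) = mpoly_eval h a p ^ n"
  by (induction n) (auto simp: mpoly_eval_mult mpoly_eval_1)

lemma mpoly_eval_prod: "mpoly_eval h a (\<Prod>i\<in>I. f i) = (\<Prod>i\<in>I. mpoly_eval h a (f i))"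
  by (induction I rule: infinite_finite_induct) (auto simp: mpoly_eval_mult mpoly_eval_1)

lemma mpoly_eval_diff: "mpoly_eval h a (p - q) = mpoly_eval h a p - mpoly_eval h a q"
  using mpoly_eval_add[of a "p - q" q] by (simp add: eq_diff_eq)

lemma comm_ring_hom_mpoly_eval: "comm_ring_hom (mpoly_eval h a)"
  by unfold_locales (simp_all add: mpoly_eval_0 mpoly_eval_add mpoly_eval_mult mpoly_eval_1)

end

interpretation real_eval: coeff_hom "\<lambda>c::real. c"
  by (rule coeff_hom.intro) (rule of_real_0 of_real_1 of_real_add of_real_mult refl)+
interpretation complex_eval: coeff_hom "\<lambda>c::complex. c"
  by (rule coeff_hom.intro) (rule of_real_0 of_real_1 of_real_add of_real_mult refl)+
interpretation real_complex_eval: coeff_hom complex_of_real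
  by (rule coeff_hom.intro) (rule of_real_0 of_real_1 of_real_add of_real_mult refl)+

lemma mpoly_eval_map_complex:
  "mpoly_eval (\<lambda>c. c) a (Poly_Mapping.map complex_of_real q) = mpoly_eval complex_of_real a q"
proof -
  have l: "Poly_Mapping.lookup (Poly_Mapping.map complex_of_real q) m = of_real (Poly_Mapping.lookup q m)" for m
    unfolding Poly_Mapping.map.rep_eq by (cases "Poly_Mapping.lookup q m = 0") auto
  have "Poly_Mapping.keys (Poly_Mapping.map complex_of_real q) = Poly_Mapping.keys q"
    by (auto simp: in_keys_iff l)
  thus ?thesis unfolding mpoly_eval_def l by simp
qed

lemma mpoly_eval_of_real: "mpoly_eval complex_of_real (\<lambda>j. of_real (a j)) p = of_real (mpoly_eval (\<lambda>c. c) a p)"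
  unfolding mpoly_eval_def by simp

lemma UNIV_4: "(UNIV :: 4 set) = {0, 1, 2, 3}"
proof -
  have "card {0, 1, 2, 3 :: 4} = card (UNIV :: 4 set)" by simp
  thus ?thesis by (intro card_subset_eq[symmetric]) auto
qed

section \<open>Stable polynomials that are affine in two variables\<close>

text \<open>The arguments stand for the coefficients of $p(1, x_1, x_2, x_3)$ with respect to $1$, $x_2$, $x_3$ and
$x_2 x_3$.\<close>

definition stable_bilinear :: "real poly \<Rightarrow> real poly \<Rightarrow> real poly \<Rightarrow> real poly \<Rightarrow> bool" where
  "stable_bilinear a b c e \<longleftrightarrow> (\<forall>z w y. Im z > 0 \<longrightarrow> Im w > 0 \<longrightarrow> Im y > 0 \<longrightarrow>
     poly (complexify a) z + poly (complexify b) z * w + poly (complexify c) z * y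
       + poly (complexify e) z * w * y \<noteq> 0)"

lemma stable_bilinear_swap: 
  assumes "stable_bilinear a b c e" shows "stable_bilinear a c b e"
  unfolding stable_bilinear_def
proof (intro allI impI)
  fix z w y :: complex assume "Im z > 0" "Im w > 0" "Im y > 0"
  with assms have "poly (complexify a) z + poly (complexify b) z * y + poly (complexify c) z * w
       + poly (complexify e) z * y * w \<noteq> 0" unfolding stable_bilinear_def by blast
  thus "poly (complexify a) z + poly (complexify c) z * w + poly (complexify b) z * y
       + poly (complexify e) z * w * y \<noteq> 0" by (simp add: ac_simps)
qed

text \<open>A real translation of $x_3$ preserves the upper half plane, \<open>c\<close>, \<open>e\<close> and the discriminant $b c - a e$.
It serves to make \<open>b\<close> nonzero when \<open>e\<close> is.\<close>

lemma stable_bilinear_shift: 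
  assumes "stable_bilinear a b c e" shows "stable_bilinear (a + smult s c) (b + smult s e) c e"
  unfolding stable_bilinear_def
proof (intro allI impI)
  fix z w y :: complex assume "Im z > 0" "Im w > 0" "Im y > 0"
  hence "poly (complexify a) z + poly (complexify b) z * w + poly (complexify c) z * (y + of_real s)
       + poly (complexify e) z * w * (y + of_real s) \<noteq> 0" using assms unfolding stable_bilinear_def by simp
  moreover have "complexify (f + smult s g) = complexify f + smult (of_real s) (complexify g)" for f g
    by (intro poly_eqI) (simp add: coeff_map_poly)
  ultimately show "poly (complexify (a + smult s c)) z + poly (complexify (b + smult s e)) z * w + poly (complexify c) z * y
       + poly (complexify e) z * w * y \<noteq> 0" by (simp add: algebra_simps)
qed

lemma complexify_combination_nonzero:
  assumes "f \<noteq> 0 \<or> g \<noteq> 0" "Im w \<noteq> 0"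
  shows "complexify f + smult w (complexify g) \<noteq> 0"
proof
  assume "complexify f + smult w (complexify g) = 0"
  hence "of_real (coeff f i) + w * of_real (coeff g i) = 0" for i
    using arg_cong[of _ _ "\<lambda>p. coeff p i"] by (simp add: coeff_map_poly) (metis coeff_0 coeff_add coeff_map_poly coeff_smult of_real_0)
  hence *: "Im w * coeff g i = 0" "coeff f i + Re w * coeff g i = 0" for i
    by (simp_all add: complex_eq_iff)
  have "g = 0" using *(1) assms(2) by (intro poly_eqI) simp
  moreover have "f = 0" using * assms(2) by (intro poly_eqI) simp
  ultimately show False using assms(1) by simp
qed

lemma stable_bilinear_pair:
  assumes st: "stable_bilinear a b c e" "Im w > 0"
  shows "stable_pair (complexify a + smult w (complexify b)) (complexify c + smult w (complexify e))"
  unfolding stable_pair_def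
proof (intro allI impI)
  fix z y assume "Im z > 0" "Im y > 0"
  with assms have "poly (complexify a) z + poly (complexify b) z * w + poly (complexify c) z * y
       + poly (complexify e) z * w * y \<noteq> 0" unfolding stable_bilinear_def by blast
  thus "poly (complexify a + smult w (complexify b)) z + y * poly (complexify c + smult w (complexify e)) z \<noteq> 0"
    by (simp add: algebra_simps)
qed

text \<open>For fixed \<open>w\<close> the polynomial is affine in the other variable, and its leading coefficient
$c + w e$ inherits the absence of zeros.\<close>

lemma stable_bilinear_leading:
  assumes "stable_bilinear a b c e" "c \<noteq> 0 \<or> e \<noteq> 0"
  shows "stable_pair (complexify c) (complexify e)"
  unfolding stable_pair_def
proof (intro allI impI)
  fix z w :: complex assume "Im z > 0" "Im w > 0"
  with stable_pair_denom_nonzero[OF stable_bilinear_pair[OF assms(1) \<open>Im w > 0\<close>] complexify_combination_nonzero[OF assms(2)], of z]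
  show "poly (complexify c) z + w * poly (complexify e) z \<noteq> 0" by simp
qed

lemma stable_bilinear_constant:
  assumes "stable_bilinear a b c e" "a \<noteq> 0 \<or> b \<noteq> 0"
  shows "stable_pair (complexify a) (complexify b)"
  unfolding stable_pair_def
proof (intro allI impI)
  fix z w :: complex assume "Im z > 0" "Im w > 0"
  with stable_pair_numer_nonzero[OF stable_bilinear_pair[OF assms(1) \<open>Im w > 0\<close>] complexify_combination_nonzero[OF assms(2)], of z]
  show "poly (complexify a) z + w * poly (complexify b) z \<noteq> 0" by simp
qed

text \<open>Dividing by \<open>e\<close>, the zeros are the solutions of $(x_2 + c/e)(x_3 + b/e) = (b c - a e)/e^2$. If the right
hand side were $-\delta^2$ at a real point \<open>x\<close>, then $x_2 = -c/e + i\delta$, $x_3 = -b/e + i\delta$ would be a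
zero with two coordinates in the open upper half plane; moving the first coordinate from \<open>x\<close> slightly
upwards and solving for $x_3$ again gives a zero with all three of them there.\<close>

lemma stable_bilinear_discriminant_at:
  assumes st: "stable_bilinear a b c e" and e: "poly e x \<noteq> 0"
  shows "poly (b * c - a * e) x \<ge> 0"
proof (rule ccontr)
  let ?p = "\<lambda>f e. poly (complexify f) (of_real x + \<i> * of_real e)"
  assume neg: "\<not> ?thesis"
  define \<Delta> where "\<Delta> = (\<lambda>t. ?p b t * ?p c t - ?p a t * ?p e t)"
  define D where "D = poly (b * c - a * e) x / (poly e x)\<^sup>2"
  have D: "D < 0" using neg e unfolding D_def by (simp add: divide_neg_pos)
  define \<delta> where "\<delta> = sqrt (- D)"
  have \<delta>: "\<delta> > 0" "\<delta> * \<delta> = - D" using D unfolding \<delta>_def by auto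
  let ?w = "\<lambda>t. - (?p c t / ?p e t) + \<i> * of_real \<delta>"
  let ?y = "\<lambda>t. - (?p b t / ?p e t) + \<Delta> t / (?p e t)\<^sup>2 / (\<i> * of_real \<delta>)"
  have lim: "(?p f \<longlongrightarrow> of_real (poly f x)) (at_right 0)" for f
  proof -
    have "((\<lambda>t::real. of_real x + \<i> * of_real t) \<longlongrightarrow> of_real x) (at_right 0)"
      by (auto intro!: tendsto_eq_intros)
    from tendsto_poly[OF this, of "complexify f"] show ?thesis unfolding poly_complexify .
  qed
  have e': "complex_of_real (poly e x) \<noteq> 0" using e by simp
  have "(\<Delta> \<longlongrightarrow> of_real (poly b x) * of_real (poly c x) - of_real (poly a x) * of_real (poly e x)) (at_right 0)"
    unfolding \<Delta>_def by (intro tendsto_intros lim)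
  hence lim\<Delta>: "(\<Delta> \<longlongrightarrow> of_real (poly (b * c - a * e) x)) (at_right 0)" by simp
  have "(?w \<longlongrightarrow> - (of_real (poly c x) / of_real (poly e x)) + \<i> * of_real \<delta>) (at_right 0)"
    by (intro tendsto_intros lim e')
  from tendsto_Im[OF this] have w: "((\<lambda>t. Im (?w t)) \<longlongrightarrow> \<delta>) (at_right 0)" 
    by (simp flip: of_real_divide)
  have "(?y \<longlongrightarrow> - (of_real (poly b x) / of_real (poly e x)) + of_real (poly (b * c - a * e) x) / (of_real (poly e x))\<^sup>2 / (\<i> * of_real \<delta>)) (at_right 0)"
    using e \<delta> by (intro tendsto_intros lim lim\<Delta>) auto
  moreover have "of_real (poly (b * c - a * e) x) / (complex_of_real (poly e x))\<^sup>2 / (\<i> * of_real \<delta>) = \<i> * of_real \<delta>"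
  proof -
    have "of_real (poly (b * c - a * e) x) / (complex_of_real (poly e x))\<^sup>2 = complex_of_real D"
      unfolding D_def by simp
    also have "D = - (\<delta> * \<delta>)" using \<delta> by simp
    also have "complex_of_real (- (\<delta> * \<delta>)) / (\<i> * of_real \<delta>) = \<i> * of_real \<delta>"
      using \<delta>(1) by (simp add: field_simps)
    finally show ?thesis .
  qed
  ultimately have "(?y \<longlongrightarrow> - of_real (poly b x / poly e x) + \<i> * of_real \<delta>) (at_right 0)" by simp
  from tendsto_Im[OF this] have y: "((\<lambda>t. Im (?y t)) \<longlongrightarrow> \<delta>) (at_right 0)" by simp
  have "\<forall>\<^sub>F t in at_right 0. Im (?w t) > 0" using order_tendstoD(1)[OF w \<delta>(1)] .
  moreover have "\<forall>\<^sub>F t in at_right 0. Im (?y t) > 0" using order_tendstoD(1)[OF y \<delta>(1)] .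
  moreover have "\<forall>\<^sub>F t in at_right 0. ?p e t \<noteq> 0" using tendsto_imp_eventually_ne[OF lim e'] .
  moreover have "\<forall>\<^sub>F t::real in at_right 0. t > 0" by (rule eventually_at_right_less)
  ultimately have "\<forall>\<^sub>F t::real in at_right 0. False"
  proof eventually_elim
    case (elim t)
    let ?d = "\<i> * complex_of_real \<delta>"
    have d0: "?d \<noteq> 0" using \<delta> by simp
    have id: "A + B * w + C * y + E * w * y = 0" 
      if "E \<noteq> 0" "w = - (C / E) + d" "y = - (B / E) + (B * C - A * E) / E\<^sup>2 / d" "d \<noteq> 0" for A B C E w y d :: complex
      unfolding that(2,3) using that(1,4) by (simp add: field_simps power2_eq_square)
    have "?p a t + ?p b t * ?w t + ?p c t * ?y t + ?p e t * ?w t * ?y t = 0"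
      by (rule id[OF elim(3) refl _ d0]) (simp add: \<Delta>_def)
    moreover have "Im (of_real x + \<i> * of_real t) > 0" using elim by simp
    ultimately show False using st elim(1,2) unfolding stable_bilinear_def by blast
  qed
  thus False by simp
qed

lemma stable_bilinear_discriminant:
  assumes "stable_bilinear a b c e" "e \<noteq> 0"
  shows "poly (b * c - a * e) x \<ge> 0"
  by (rule poly_nonneg_off_finite[OF poly_roots_finite[OF assms(2)]])
     (use stable_bilinear_discriminant_at[OF assms(1)] in auto)

text \<open>The sum of two open half planes bounded by lines through the origin is the whole plane unless the half
planes coincide, that is, unless \<open>B\<close> and \<open>C\<close> are positive multiples of each other. The point \<open>t\<close> is
chosen such that both $t C$ and $-t B$ lie in the upper half plane; adding a large multiple of it to
one solution of the equation keeps the equation and corrects the imaginary parts.\<close>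

lemma half_plane_sum_surjective:
  fixes A B C :: complex
  assumes "B \<noteq> 0" "C \<noteq> 0" and lt: "Re (cnj B * C) < cmod B * cmod C"
  shows "\<exists>w y. Im w > 0 \<and> Im y > 0 \<and> A + B * w + C * y = 0"
proof -
  define t where "t = \<i> * (cnj C / of_real (cmod C) - cnj B / of_real (cmod B))"
  have nB: "cmod B > 0" "cmod C > 0" using assms by auto
  have "t * C = \<i> * (of_real (cmod C) - cnj B * C / of_real (cmod B))"
    unfolding t_def using nB by (simp add: field_simps complex_norm_square[symmetric] power2_eq_square flip: complex_norm_square)
  hence 1: "Im (t * C) = cmod C - Re (cnj B * C) / cmod B" by simp
  have "- (t * B) = \<i> * (of_real (cmod B) - cnj C * B / of_real (cmod C))"
    unfolding t_def using nB by (simp add: field_simps complex_norm_square[symmetric] power2_eq_square flip: complex_norm_square)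
  hence 2: "Im (- (t * B)) = cmod B - Re (cnj C * B) / cmod C" by simp
  have "Re (cnj C * B) = Re (cnj B * C)" by simp
  hence p1: "Im (t * C) > 0" and p2: "Im (- (t * B)) > 0" 
    unfolding 1 2 using lt nB by (simp_all add: field_simps)
  define T where "T = (\<bar>Im (A / C)\<bar> + 1) / Im (- (t * B))"
  have T: "T > 0" "T * Im (- (t * B)) = \<bar>Im (A / C)\<bar> + 1" unfolding T_def using p2 by (simp_all add: divide_pos_pos add_nonneg_pos)
  let ?w = "of_real T * (t * C)" and ?y = "- (A / C) + of_real T * - (t * B)"
  have "Im ?w > 0" using T(1) p1 by (simp del: times_complex.sel add: times_complex.sel(2)[of "of_real T"])
  moreover have "Im ?y = - Im (A / C) + T * Im (- (t * B))" 
    by (simp only: plus_complex.sel uminus_complex.sel times_complex.sel Im_complex_of_real Re_complex_of_real)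
  hence "Im ?y > 0" using T by linarith
  moreover have "A + B * ?w + C * ?y = 0" using assms by (simp add: field_simps)
  ultimately show ?thesis by blast
qed

text \<open>By the preceding lemma $b/c$ is positive on the upper half plane. If it took the value \<open>l\<close> at \<open>\<i>\<close> without
being constant, then $h = b - l c$ would be nonzero; but $h/c$ is real, so that \<open>(h, c)\<close> is a stable
pair, and then \<open>h\<close> has no zero at \<open>\<i>\<close>.\<close>

lemma stable_linear_proportional:
  assumes st: "stable_bilinear a b c 0" and b: "b \<noteq> 0" and c: "c \<noteq> 0"
  obtains l where "l > 0" "b = smult l c"
proof -
  have sc: "stable_pair (complexify c) (complexify 0)" using stable_bilinear_leading[OF st] c by blast
  have sb: "stable_pair (complexify b) (complexify 0)" using stable_bilinear_leading[OF stable_bilinear_swap[OF st]] b by blast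
  have nz: "poly (complexify b) z \<noteq> 0" "poly (complexify c) z \<noteq> 0" if "Im z > 0" for z
    using stable_pair_numer_nonzero[OF sb _ that] stable_pair_numer_nonzero[OF sc _ that] b c by simp_all
  have quot: "\<exists>l>0. poly (complexify b) z = of_real l * poly (complexify c) z" if z: "Im z > 0" for z
  proof -
    let ?B = "poly (complexify b) z" and ?C = "poly (complexify c) z"
    have "\<not> Re (cnj ?B * ?C) < cmod ?B * cmod ?C"
    proof
      assume "Re (cnj ?B * ?C) < cmod ?B * cmod ?C"
      from half_plane_sum_surjective[OF nz[OF z] this, of "poly (complexify a) z"]
      show False using st z unfolding stable_bilinear_def by auto
    qed
    moreover have "cmod (cnj ?B * ?C) = cmod ?B * cmod ?C" by (simp add: norm_mult)
    ultimately have re: "Re (cnj ?B * ?C) \<ge> cmod (cnj ?B * ?C)" by simp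
    define X where "X = cnj ?B * ?C"
    have "Re X = cmod X" using re complex_Re_le_cmod[of X] unfolding X_def by linarith
    moreover from this have "Im X = 0" using cmod_power2[of X] by simp
    ultimately have "cnj ?B * ?C = of_real (cmod (cnj ?B * ?C))"
      unfolding X_def[symmetric] by (simp add: complex_eq_iff)
    then obtain m where m: "cnj ?B * ?C = of_real m" "m > 0" using nz[OF z] 
      by (metis complex_cnj_zero_iff mult_eq_0_iff zero_less_norm_iff)
    have "?B * of_real m = of_real ((cmod ?B)\<^sup>2) * ?C"
      unfolding m(1)[symmetric] complex_norm_square by (simp only: ac_simps)
    hence "?B = of_real ((cmod ?B)\<^sup>2 / m) * ?C" using m by (simp add: field_simps)
    moreover have "(cmod ?B)\<^sup>2 / m > 0" using m nz[OF z] by simp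
    ultimately show ?thesis by blast
  qed
  obtain l where l: "l > 0" "poly (complexify b) \<i> = of_real l * poly (complexify c) \<i>" using quot[of \<i>] by auto
  define h where "h = b - smult l c"
  have H: "complexify h = complexify b - smult (of_real l) (complexify c)"
    unfolding h_def by (intro poly_eqI) (simp add: coeff_map_poly)
  have "stable_pair (complexify h) (complexify c)"
    unfolding stable_pair_def
  proof (intro allI impI notI)
    fix z w assume z: "Im z > 0" and w: "Im w > 0" and 0: "poly (complexify h) z + w * poly (complexify c) z = 0"
    obtain l' where l': "poly (complexify b) z = of_real l' * poly (complexify c) z" using quot[OF z] by blast
    have "(of_real l' - of_real l + w) * poly (complexify c) z = 0" using 0 unfolding H by (simp add: l' algebra_simps)
    hence "of_real l' - of_real l + w = 0" using nz[OF z] by simp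
    hence "Im (of_real l' - of_real l + w) = 0" by (simp only: zero_complex.sel)
    thus False using w by simp
  qed
  from stable_pair_numer_nonzero[OF this, of \<i>] have "complexify h = 0" unfolding H using l by auto
  hence "h = 0" by simp
  thus thesis using that[OF l(1)] unfolding h_def by simp
qed

section \<open>Dehomogenization of polynomials in four variables\<close>

lemma prod_UNIV_4: "(\<Prod>j\<in>(UNIV :: 4 set). f j) = f 0 * f 1 * f 2 * (f 3 :: 'a::comm_monoid_mult)"
  unfolding UNIV_4 by (simp add: ac_simps)

lemma sum_UNIV_4: "(\<Sum>j\<in>(UNIV :: 4 set). f j) = f 0 + f 1 + f 2 + (f 3 :: 'a::comm_monoid_add)"
  unfolding UNIV_4 by (simp add: ac_simps)

definition point :: "'a \<Rightarrow> 'a \<Rightarrow> 'a \<Rightarrow> 'a \<Rightarrow> 4 \<Rightarrow> 'a" where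
  "point x\<^sub>0 x\<^sub>1 x\<^sub>2 x\<^sub>3 = (\<lambda>j. if j = 0 then x\<^sub>0 else if j = 1 then x\<^sub>1 else if j = 2 then x\<^sub>2 else x\<^sub>3)"

lemma point_simps [simp]: "point x\<^sub>0 x\<^sub>1 x\<^sub>2 x\<^sub>3 0 = x\<^sub>0" "point x\<^sub>0 x\<^sub>1 x\<^sub>2 x\<^sub>3 1 = x\<^sub>1"
  "point x\<^sub>0 x\<^sub>1 x\<^sub>2 x\<^sub>3 2 = x\<^sub>2" "point x\<^sub>0 x\<^sub>1 x\<^sub>2 x\<^sub>3 3 = x\<^sub>3"
  unfolding point_def by simp_all

lemma forall_index_4: "(\<forall>j::4. P j) \<longleftrightarrow> P 0 \<and> P 1 \<and> P 2 \<and> P 3"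
proof -
  have "(\<forall>j::4. P j) \<longleftrightarrow> (\<forall>j\<in>{0, 1, 2, 3}. P j)" unfolding UNIV_4[symmetric] by simp
  thus ?thesis by simp
qed

lemma monom_val_point: "monom_val (point x\<^sub>0 x\<^sub>1 x\<^sub>2 x\<^sub>3) m =
  x\<^sub>0 ^ Poly_Mapping.lookup m 0 * x\<^sub>1 ^ Poly_Mapping.lookup m 1 * x\<^sub>2 ^ Poly_Mapping.lookup m 2 * x\<^sub>3 ^ Poly_Mapping.lookup m 3"
  unfolding monom_val_def prod_UNIV_4 by simp

lemma mpoly_eval_monom_val: "mpoly_eval h a p = (\<Sum>m\<in>Poly_Mapping.keys p. h (Poly_Mapping.lookup p m) * monom_val a m)"
  unfolding mpoly_eval_def monom_val_def ..

lemma digits_unique: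
  fixes x y u v K :: nat
  assumes "x < K" "y < K" "x + K * u = y + K * v"
  shows "x = y \<and> u = v"
proof -
  have "x = (x + K * u) mod K" "u = (x + K * u) div K" "y = (y + K * v) mod K" "v = (y + K * v) div K"
    using assms(1,2) by simp_all
  thus ?thesis using assms(3) by metis
qed

text \<open>Kronecker substitution: for \<open>K\<close> beyond all exponents, $x_j = T^{K^j}$ sends distinct monomials to
distinct powers of \<open>T\<close>, so that a univariate argument suffices. Since $x_1/x_0$ is a positive power of \<open>T\<close>, the finite
exceptional set \<open>B\<close> is avoided by all large \<open>T\<close>. The exceptions are needed because the determinant is
only computed where the block of poles is invertible.\<close>

lemma mpoly_eq_0_by_eval:
  fixes Q :: "(4, complex) mpoly"
  assumes B: "finite B"
    and ev: "\<And>x\<^sub>0 x\<^sub>1 x\<^sub>2 x\<^sub>3 :: real. x\<^sub>0 \<noteq> 0 \<Longrightarrow> x\<^sub>1 / x\<^sub>0 \<notin> B \<Longrightarrow>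
       mpoly_eval (\<lambda>c. c) (\<lambda>j. of_real (point x\<^sub>0 x\<^sub>1 x\<^sub>2 x\<^sub>3 j)) Q = 0"
  shows "Q = 0"
proof -
  let ?l = Poly_Mapping.lookup
  define K where "K = Suc (Suc (\<Sum>m\<in>Poly_Mapping.keys Q. \<Sum>j\<in>UNIV. ?l m j))"
  have bound: "?l m j < K" if "m \<in> Poly_Mapping.keys Q" for m j
  proof -
    have "?l m j \<le> (\<Sum>j\<in>UNIV. ?l m j)" by (rule member_le_sum) auto
    also have "\<dots> \<le> (\<Sum>m\<in>Poly_Mapping.keys Q. \<Sum>j\<in>UNIV. ?l m j)" using that by (intro member_le_sum) auto
    finally show ?thesis unfolding K_def by simp
  qed
  (* K^2 and K^3 appear in Horner form, which makes the digits accessible one at a time. *)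
  define kr where "kr = (\<lambda>m. ?l m 0 + K * (?l m 1 + K * (?l m 2 + K * ?l m (3::4))))"
  have inj: "m = m'" if "m \<in> Poly_Mapping.keys Q" "m' \<in> Poly_Mapping.keys Q" "kr m = kr m'" for m m'
  proof -
    have 0: "?l m 0 = ?l m' 0" "?l m 1 + K * (?l m 2 + K * ?l m 3) = ?l m' 1 + K * (?l m' 2 + K * ?l m' 3)"
      using digits_unique[OF bound[OF that(1)] bound[OF that(2)]] that(3) unfolding kr_def by blast+
    have 1: "?l m 1 = ?l m' 1" "?l m 2 + K * ?l m 3 = ?l m' 2 + K * ?l m' 3"
      using digits_unique[OF bound[OF that(1)] bound[OF that(2)] 0(2)] by blast+
    have 2: "?l m 2 = ?l m' 2" "K * ?l m 3 = K * ?l m' 3"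
      using digits_unique[OF bound[OF that(1)] bound[OF that(2)] 1(2)] by auto
    have "K \<noteq> 0" unfolding K_def by simp
    hence "?l m 3 = ?l m' 3" using 2(2) by simp
    hence "\<forall>j. ?l m j = ?l m' j" using 0 1 2 unfolding forall_index_4 by simp
    thus ?thesis by (intro poly_mapping_eqI) simp
  qed
  define R where "R = (\<Sum>m\<in>Poly_Mapping.keys Q. monom (?l Q m) (kr m))"
  define T0 where "T0 = 1 + (\<Sum>b\<in>B. \<bar>b\<bar>)"
  have R0: "poly R (of_real T) = 0" if T: "T > T0" for T
  proof -
    have T1: "T > 1"
    proof -
      have "0 \<le> (\<Sum>b\<in>B. \<bar>b\<bar>)" by (intro sum_nonneg) auto
      thus ?thesis using T unfolding T0_def by linarith
    qed
    have TB: "T ^ Suc i \<notin> B" for i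
    proof
      assume b: "T ^ Suc i \<in> B"
      have "T \<le> T ^ Suc i" using T1 by (simp add: one_le_power)
      also have "\<dots> \<le> \<bar>T ^ Suc i\<bar>" by simp
      also have "\<dots> \<le> (\<Sum>b\<in>B. \<bar>b\<bar>)" using b B by (intro member_le_sum) auto
      finally show False using T unfolding T0_def by simp
    qed
    have "T ^ K / T \<notin> B"
      using TB[of "K - 2"] T1 unfolding K_def by simp
    hence "mpoly_eval (\<lambda>c. c) (\<lambda>j. of_real (point T (T ^ K) (T ^ (K * K)) (T ^ (K * K * K)) j)) Q = 0"
      using T1 by (intro ev) auto
    moreover have "(\<lambda>j. of_real (point T (T ^ K) (T ^ (K * K)) (T ^ (K * K * K)) j))
        = point (complex_of_real T) (of_real T ^ K) (of_real T ^ (K * K)) (of_real T ^ (K * K * K))"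
      by (auto simp: point_def fun_eq_iff)
    moreover have "monom_val (point (complex_of_real T) (of_real T ^ K) (of_real T ^ (K * K)) (of_real T ^ (K * K * K))) m
        = of_real T ^ kr m" for m
      unfolding monom_val_point kr_def by (simp add: power_add power_mult[symmetric] algebra_simps)
    ultimately show ?thesis
      unfolding R_def poly_sum poly_monom mpoly_eval_monom_val by simp
  qed
  have "R = 0"
  proof (rule ccontr)
    assume "R \<noteq> 0"
    hence "finite {z. poly R z = 0}" by (rule poly_roots_finite)
    moreover have "complex_of_real ` {T0<..} \<subseteq> {z. poly R z = 0}" using R0 by auto
    ultimately have "finite (complex_of_real ` {T0<..})" by (rule rev_finite_subset)
    hence "finite {T0<..}" by (rule finite_imageD) (auto simp: inj_on_def)
    thus False by (simp add: infinite_Ioi)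
  qed
  have "m \<notin> Poly_Mapping.keys Q" for m
  proof
    assume m: "m \<in> Poly_Mapping.keys Q"
    have "coeff R (kr m) = (\<Sum>m'\<in>Poly_Mapping.keys Q. if m' = m then ?l Q m else 0)"
      unfolding R_def coeff_sum by (intro sum.cong) (use inj[OF _ m] in auto)
    also have "\<dots> = ?l Q m" using m by simp
    finally show False using m \<open>R = 0\<close> by (simp add: in_keys_iff)
  qed
  thus ?thesis by (intro poly_mapping_eqI) (simp add: in_keys_iff)
qed

text \<open>The coefficient of $x_2^i x_3^j$ in $p(1, x_1, x_2, x_3)$, as a polynomial in $x_1$.\<close>

definition slice :: "(4, real) mpoly \<Rightarrow> nat \<Rightarrow> nat \<Rightarrow> real poly" where
  "slice p i j = (\<Sum>m\<in>{m\<in>Poly_Mapping.keys p. Poly_Mapping.lookup m 2 = i \<and> Poly_Mapping.lookup m 3 = j}.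
     monom (Poly_Mapping.lookup p m) (Poly_Mapping.lookup m 1))"

lemma degree_in_ge: "m \<in> Poly_Mapping.keys p \<Longrightarrow> Poly_Mapping.lookup m j \<le> degree_in j p"
  unfolding degree_in_def by (intro Max_ge) auto

lemma degree_slice_le: "degree (slice p i j) \<le> degree_in 1 p"
  unfolding slice_def
  by (intro degree_sum_le) (auto intro: order.trans[OF degree_monom_le] degree_in_ge)

lemma mpoly_eval_slices:
  fixes p :: "(4, real) mpoly" and h :: "real \<Rightarrow> 'b::comm_ring_1"
  assumes h: "h 0 = 0" "\<And>x y. h (x + y) = h x + h y" 
    and aff: "degree_in 2 p \<le> 1" "degree_in 3 p \<le> 1"
  shows "mpoly_eval h (point 1 x w y) p = poly (map_poly h (slice p 0 0)) x + poly (map_poly h (slice p 1 0)) x * w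
    + poly (map_poly h (slice p 0 1)) x * y + poly (map_poly h (slice p 1 1)) x * w * y"
proof -
  let ?l = Poly_Mapping.lookup and ?K = "Poly_Mapping.keys p"
  have S: "poly (map_poly h (slice p i j)) x = (\<Sum>m\<in>?K. if ?l m 2 = i \<and> ?l m 3 = j then h (?l p m) * x ^ ?l m 1 else 0)" for i j
  proof -
    have "map_poly h (\<Sum>m\<in>A. monom (f m) (g m)) = (\<Sum>m\<in>A. monom (h (f m)) (g m))" if "finite A" for A and f :: "(4 \<Rightarrow>\<^sub>0 nat) \<Rightarrow> real" and g
      using that by (induction A) (auto simp: h map_poly_add map_poly_monom)
    hence "poly (map_poly h (slice p i j)) x = (\<Sum>m\<in>{m\<in>?K. ?l m 2 = i \<and> ?l m 3 = j}. h (?l p m) * x ^ ?l m 1)"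
      unfolding slice_def by (simp add: poly_sum poly_monom)
    thus ?thesis by (simp add: sum.inter_filter[symmetric])
  qed
  have "mpoly_eval h (point 1 x w y) p = (\<Sum>m\<in>?K. 
      (if ?l m 2 = 0 \<and> ?l m 3 = 0 then h (?l p m) * x ^ ?l m 1 else 0)
    + (if ?l m 2 = 1 \<and> ?l m 3 = 0 then h (?l p m) * x ^ ?l m 1 else 0) * w
    + (if ?l m 2 = 0 \<and> ?l m 3 = 1 then h (?l p m) * x ^ ?l m 1 else 0) * y
    + (if ?l m 2 = 1 \<and> ?l m 3 = 1 then h (?l p m) * x ^ ?l m 1 else 0) * w * y)"
    unfolding mpoly_eval_monom_val monom_val_point
  proof (intro sum.cong refl)
    fix m assume m: "m \<in> ?K"
    have "?l m 2 \<le> 1" "?l m 3 \<le> 1"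
      using degree_in_ge[OF m, of 2] degree_in_ge[OF m, of 3] aff by linarith+
    hence "?l m 2 = 0 \<or> ?l m 2 = 1" "?l m 3 = 0 \<or> ?l m 3 = 1" by linarith+
    thus "h (?l p m) * (1 ^ ?l m 0 * x ^ ?l m 1 * w ^ ?l m 2 * y ^ ?l m 3) = 
      (if ?l m 2 = 0 \<and> ?l m 3 = 0 then h (?l p m) * x ^ ?l m 1 else 0)
    + (if ?l m 2 = 1 \<and> ?l m 3 = 0 then h (?l p m) * x ^ ?l m 1 else 0) * w
    + (if ?l m 2 = 0 \<and> ?l m 3 = 1 then h (?l p m) * x ^ ?l m 1 else 0) * y
    + (if ?l m 2 = 1 \<and> ?l m 3 = 1 then h (?l p m) * x ^ ?l m 1 else 0) * w * y"
      by (elim disjE) (simp_all add: mult.assoc)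
  qed
  thus ?thesis unfolding S by (simp only: sum.distrib sum_distrib_right)
qed

lemma homogeneous_eval:
  fixes c :: "'b::comm_ring_1" and p :: "('v::finite, 'a::zero) mpoly"
  assumes "homogeneous d p"
  shows "mpoly_eval h (\<lambda>j. c * a j) p = c ^ d * mpoly_eval h a p"
proof -
  have "monom_val (\<lambda>j. c * a j) m = c ^ d * monom_val a m" if "m \<in> Poly_Mapping.keys p" for m
    using assms that unfolding homogeneous_def monom_val_def
    by (simp add: power_mult_distrib prod.distrib power_sum[symmetric])
  thus ?thesis unfolding mpoly_eval_monom_val by (simp add: sum_distrib_left ac_simps)
qed

text \<open>Homogeneity determines the exponent of $x_0$, so setting $x_0 = 1$ does not merge monomials.\<close>

lemma homogeneous_key_unique:
  fixes p :: "(4, 'a::zero) mpoly"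
  assumes "homogeneous d p" "m \<in> Poly_Mapping.keys p" "m' \<in> Poly_Mapping.keys p"
    and "Poly_Mapping.lookup m 1 = Poly_Mapping.lookup m' 1" "Poly_Mapping.lookup m 2 = Poly_Mapping.lookup m' 2"
      "Poly_Mapping.lookup m 3 = Poly_Mapping.lookup m' 3"
  shows "m = m'"
proof -
  have "Poly_Mapping.lookup m 0 = Poly_Mapping.lookup m' 0"
    using assms unfolding homogeneous_def sum_UNIV_4 by (metis add_right_cancel)
  hence "\<forall>j. Poly_Mapping.lookup m j = Poly_Mapping.lookup m' j" using assms unfolding forall_index_4 by simp
  thus ?thesis by (intro poly_mapping_eqI) simp
qed

lemma slice_nonzero:
  assumes "homogeneous d p" "m \<in> Poly_Mapping.keys p"
  shows "slice p (Poly_Mapping.lookup m 2) (Poly_Mapping.lookup m 3) \<noteq> 0"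
proof -
  let ?l = Poly_Mapping.lookup
  let ?A = "{m'\<in>Poly_Mapping.keys p. ?l m' 2 = ?l m 2 \<and> ?l m' 3 = ?l m 3}"
  have "coeff (slice p (?l m 2) (?l m 3)) (?l m 1) = (\<Sum>m'\<in>?A. if m' = m then ?l p m else 0)"
    unfolding slice_def coeff_sum
    by (intro sum.cong refl) (use homogeneous_key_unique[OF assms(1) _ assms(2)] in auto)
  also have "\<dots> = ?l p m" using assms(2) by simp
  also have "\<dots> \<noteq> 0" using assms(2) by (simp add: in_keys_iff)
  finally show ?thesis by auto
qed

lemma degree_in_attained:
  assumes "degree_in j p > 0"
  obtains m where "m \<in> Poly_Mapping.keys p" "Poly_Mapping.lookup m j = degree_in j p"
proof -
  have "degree_in j p \<in> insert 0 ((\<lambda>m. Poly_Mapping.lookup m j) ` Poly_Mapping.keys p)"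
    unfolding degree_in_def by (rule Max_in) auto
  thus thesis using assms that by auto
qed

text \<open>The coefficient of $x^d$ in $p(1, x, x, x)$ is $p(0, 1, 1, 1)$, which hyperbolicity makes nonzero. This bounds
the degree of \<open>p\<close> by degrees in $x_1$ and is needed to homogenize the determinant formula.\<close>

lemma hyperbolic_degree_le:
  fixes p :: "(4, real) mpoly"
  assumes hom: "homogeneous d p" and nz: "mpoly_eval (\<lambda>c. c) (point 0 1 1 1) p \<noteq> 0"
    and R: "\<And>x. mpoly_eval (\<lambda>c. c) (point 1 x x x) p = poly R x"
  shows "d \<le> degree R"
proof -
  let ?l = Poly_Mapping.lookup and ?K = "Poly_Mapping.keys p"
  define R' where "R' = (\<Sum>m\<in>?K. monom (?l p m) (?l m 1 + ?l m 2 + ?l m 3))"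
  have "poly R x = poly R' x" for x
    unfolding R[symmetric] R'_def poly_sum poly_monom mpoly_eval_monom_val monom_val_point
    by (simp add: power_add mult.assoc)
  hence "R = R'" by (intro poly_eq_poly_eq_iff[THEN iffD1]) (simp add: fun_eq_iff)
  have "coeff R' d = (\<Sum>m\<in>?K. ?l p m * monom_val (point 0 1 1 1) m)"
    unfolding R'_def coeff_sum
  proof (intro sum.cong refl)
    fix m assume "m \<in> ?K"
    hence "?l m 0 + ?l m 1 + ?l m 2 + ?l m 3 = d" using hom unfolding homogeneous_def sum_UNIV_4 by blast
    thus "coeff (monom (?l p m) (?l m 1 + ?l m 2 + ?l m 3)) d = ?l p m * monom_val (point 0 1 1 1) m"
      unfolding monom_val_point by (cases "?l m 0") auto
  qed
  also have "\<dots> = mpoly_eval (\<lambda>c. c) (point 0 1 1 1) p" unfolding mpoly_eval_monom_val ..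
  finally have "coeff R d \<noteq> 0" using nz \<open>R = R'\<close> by simp
  thus ?thesis by (rule le_degree)
qed

text \<open>A zero with \<open>z\<close>, \<open>w\<close>, \<open>y\<close> in the upper half plane is of the form $x - t v$ with real \<open>x\<close>,
$v = (0, \mathrm{Im}\, z, \mathrm{Im}\, w, \mathrm{Im}\, y)$ in the cone of hyperbolicity, and $t = -i$, which is not real.\<close>

lemma hyperbolic_stable_bilinear:
  fixes p :: "(4, real) mpoly"
  assumes hyp: "\<And>v :: 4 \<Rightarrow> real. v 0 = 0 \<Longrightarrow> v 1 > 0 \<Longrightarrow> v 2 > 0 \<Longrightarrow> v 3 > 0 \<Longrightarrow> hyperbolic p v"
    and aff: "degree_in 2 p \<le> 1" "degree_in 3 p \<le> 1"
  shows "stable_bilinear (slice p 0 0) (slice p 1 0) (slice p 0 1) (slice p 1 1)"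
  unfolding stable_bilinear_def
proof (intro allI impI notI)
  fix z w y assume im: "Im z > 0" "Im w > 0" "Im y > 0"
    and 0: "poly (complexify (slice p 0 0)) z + poly (complexify (slice p 1 0)) z * w
      + poly (complexify (slice p 0 1)) z * y + poly (complexify (slice p 1 1)) z * w * y = 0"
  have ev: "mpoly_eval complex_of_real (point 1 z w y) p = 0"
    using 0 mpoly_eval_slices[of complex_of_real p z w y] aff by simp
  let ?v = "point 0 (Im z) (Im w) (Im y)" and ?x = "point 1 (Re z) (Re w) (Re y)"
  have "hyperbolic p ?v" using im by (intro hyp) auto
  moreover have "(\<lambda>j. complex_of_real (?x j) - (- \<i>) * complex_of_real (?v j)) = point 1 z w y"
    unfolding fun_eq_iff forall_index_4 by (simp add: complex_eq[symmetric] mult.commute)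
  ultimately have "- \<i> \<in> \<real>" using ev unfolding hyperbolic_def by metis
  thus False by (simp add: complex_is_Real_iff)
qed

section \<open>Homogenization and the determinantal representation\<close>

lemma det_pencil_eval:
  assumes "{A\<^sub>0, A\<^sub>1, A\<^sub>2, A\<^sub>3} \<subseteq> carrier_mat k k"
  shows "mpoly_eval (\<lambda>c. c) a (det (Var 0 \<cdot>\<^sub>m map_mat Const A\<^sub>0 + Var 1 \<cdot>\<^sub>m map_mat Const A\<^sub>1 +
              Var 2 \<cdot>\<^sub>m map_mat Const A\<^sub>2 + Var 3 \<cdot>\<^sub>m map_mat Const A\<^sub>3)) =
    det (a (0::4) \<cdot>\<^sub>m A\<^sub>0 + a 1 \<cdot>\<^sub>m A\<^sub>1 + a 2 \<cdot>\<^sub>m A\<^sub>2 + a 3 \<cdot>\<^sub>m (A\<^sub>3 :: complex mat))"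
  unfolding comm_ring_hom.hom_det[OF complex_eval.comm_ring_hom_mpoly_eval, symmetric]
proof (rule arg_cong[where f = det], intro eq_matI)
qed (use assms in \<open>auto simp: complex_eval.mpoly_eval_add complex_eval.mpoly_eval_mult 
       complex_eval.mpoly_eval_Var complex_eval.mpoly_eval_Const\<close>)

lemma det_pencil_homogeneous:
  fixes A\<^sub>0 :: "complex mat"
  assumes "{A\<^sub>0, A\<^sub>1, A\<^sub>2, A\<^sub>3} \<subseteq> carrier_mat k k" "x\<^sub>0 \<noteq> 0"
  shows "det (x\<^sub>0 \<cdot>\<^sub>m A\<^sub>0 + x\<^sub>1 \<cdot>\<^sub>m A\<^sub>1 + x\<^sub>2 \<cdot>\<^sub>m A\<^sub>2 + x\<^sub>3 \<cdot>\<^sub>m A\<^sub>3) =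
    x\<^sub>0 ^ k * det (A\<^sub>0 + (x\<^sub>1 / x\<^sub>0) \<cdot>\<^sub>m A\<^sub>1 + (x\<^sub>2 / x\<^sub>0) \<cdot>\<^sub>m A\<^sub>2 + (x\<^sub>3 / x\<^sub>0) \<cdot>\<^sub>m A\<^sub>3)"
proof -
  have "x\<^sub>0 \<cdot>\<^sub>m A\<^sub>0 + x\<^sub>1 \<cdot>\<^sub>m A\<^sub>1 + x\<^sub>2 \<cdot>\<^sub>m A\<^sub>2 + x\<^sub>3 \<cdot>\<^sub>m A\<^sub>3 =
    x\<^sub>0 \<cdot>\<^sub>m (A\<^sub>0 + (x\<^sub>1 / x\<^sub>0) \<cdot>\<^sub>m A\<^sub>1 + (x\<^sub>2 / x\<^sub>0) \<cdot>\<^sub>m A\<^sub>2 + (x\<^sub>3 / x\<^sub>0) \<cdot>\<^sub>m A\<^sub>3)"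
    using assms by (intro eq_matI) (auto simp: distrib_left)
  moreover have "dim_col (A\<^sub>0 + (x\<^sub>1 / x\<^sub>0) \<cdot>\<^sub>m A\<^sub>1 + (x\<^sub>2 / x\<^sub>0) \<cdot>\<^sub>m A\<^sub>2 + (x\<^sub>3 / x\<^sub>0) \<cdot>\<^sub>m A\<^sub>3) = k"
    using assms by auto
  ultimately show ?thesis by simp
qed

text \<open>From $x_0 = 1$ back to homogeneous coordinates. The determinant is homogeneous of degree \<open>k\<close>, and the
factors on the right hand side have degrees \<open>d\<close>, \<open>l\<close> and \<open>card S\<close>; the difference is made up by a
power of $x_0$, which is possible because it is not negative.\<close>

lemma mpoly_dvd_det_pencil:
  fixes p L :: "(4, real) mpoly"
  assumes p: "homogeneous d p" and L: "homogeneous l L"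
    and A: "{A\<^sub>0, A\<^sub>1, A\<^sub>2, A\<^sub>3} \<subseteq> carrier_mat k k"
    and B: "finite B" and S: "finite S" and k: "d + l + card S \<le> k"
    and det: "\<And>x\<^sub>1 x\<^sub>2 x\<^sub>3. x\<^sub>1 \<notin> B \<Longrightarrow>
       det (A\<^sub>0 + of_real x\<^sub>1 \<cdot>\<^sub>m A\<^sub>1 + of_real x\<^sub>2 \<cdot>\<^sub>m A\<^sub>2 + of_real x\<^sub>3 \<cdot>\<^sub>m A\<^sub>3) =
       of_real (K * (\<Prod>r\<in>S. x\<^sub>1 - r) * mpoly_eval (\<lambda>c. c) (point 1 x\<^sub>1 x\<^sub>2 x\<^sub>3) L * mpoly_eval (\<lambda>c. c) (point 1 x\<^sub>1 x\<^sub>2 x\<^sub>3) p)"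
  shows "\<exists>q. Poly_Mapping.map complex_of_real q =
         det (Var 0 \<cdot>\<^sub>m map_mat Const A\<^sub>0 + Var 1 \<cdot>\<^sub>m map_mat Const A\<^sub>1 +
              Var 2 \<cdot>\<^sub>m map_mat Const A\<^sub>2 + Var 3 \<cdot>\<^sub>m map_mat Const A\<^sub>3) \<and> p dvd q"
proof -
  define n where "n = k - (d + l + card S)"
  define q where "q = p * (L * (Const K * Var 0 ^ n * (\<Prod>r\<in>S. Var 1 - Const r * Var 0)))"
  have "Poly_Mapping.map complex_of_real q - det (Var 0 \<cdot>\<^sub>m map_mat Const A\<^sub>0 + Var 1 \<cdot>\<^sub>m map_mat Const A\<^sub>1 +
              Var 2 \<cdot>\<^sub>m map_mat Const A\<^sub>2 + Var 3 \<cdot>\<^sub>m map_mat Const A\<^sub>3) = 0"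
  proof (rule mpoly_eq_0_by_eval[OF B])
    fix x\<^sub>0 x\<^sub>1 x\<^sub>2 x\<^sub>3 :: real
    assume x0: "x\<^sub>0 \<noteq> 0" and x1: "x\<^sub>1 / x\<^sub>0 \<notin> B"
    let ?a = "point x\<^sub>0 x\<^sub>1 x\<^sub>2 x\<^sub>3" and ?b = "point 1 (x\<^sub>1 / x\<^sub>0) (x\<^sub>2 / x\<^sub>0) (x\<^sub>3 / x\<^sub>0)"
    let ?e = "mpoly_eval (\<lambda>c. c) :: (4 \<Rightarrow> real) \<Rightarrow> (4, real) mpoly \<Rightarrow> real"
    have ab: "?a = (\<lambda>j. x\<^sub>0 * ?b j)" unfolding fun_eq_iff forall_index_4 using x0 by simp
    have ep: "?e ?a p = x\<^sub>0 ^ d * ?e ?b p" and eL: "?e ?a L = x\<^sub>0 ^ l * ?e ?b L"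
      unfolding ab by (rule homogeneous_eval[OF p] homogeneous_eval[OF L])+
    have lin: "(\<Prod>r\<in>S. x\<^sub>1 - r * x\<^sub>0) = x\<^sub>0 ^ card S * (\<Prod>r\<in>S. x\<^sub>1 / x\<^sub>0 - r)"
    proof -
      have "(\<Prod>r\<in>S. x\<^sub>1 - r * x\<^sub>0) = (\<Prod>r\<in>S. x\<^sub>0 * (x\<^sub>1 / x\<^sub>0 - r))"
        using x0 by (intro prod.cong refl) (simp add: field_simps)
      thus ?thesis by (simp add: prod.distrib)
    qed
    have "?e ?a q = x\<^sub>0 ^ d * ?e ?b p * (x\<^sub>0 ^ l * ?e ?b L * (K * x\<^sub>0 ^ n * (x\<^sub>0 ^ card S * (\<Prod>r\<in>S. x\<^sub>1 / x\<^sub>0 - r))))"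
      unfolding q_def real_eval.mpoly_eval_mult ep eL lin[symmetric] real_eval.mpoly_eval_prod 
        real_eval.mpoly_eval_diff real_eval.mpoly_eval_power real_eval.mpoly_eval_Const real_eval.mpoly_eval_Var
      by simp
    also have "\<dots> = (x\<^sub>0 ^ d * x\<^sub>0 ^ l * x\<^sub>0 ^ n * x\<^sub>0 ^ card S) * (K * (\<Prod>r\<in>S. x\<^sub>1 / x\<^sub>0 - r) * ?e ?b L * ?e ?b p)"
      by (simp only: ac_simps)
    also have "x\<^sub>0 ^ d * x\<^sub>0 ^ l * x\<^sub>0 ^ n * x\<^sub>0 ^ card S = x\<^sub>0 ^ k"
      unfolding power_add[symmetric] n_def using k by simp
    finally have q: "?e ?a q = x\<^sub>0 ^ k * (K * (\<Prod>r\<in>S. x\<^sub>1 / x\<^sub>0 - r) * ?e ?b L * ?e ?b p)" .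
    have "det (of_real x\<^sub>0 \<cdot>\<^sub>m A\<^sub>0 + of_real x\<^sub>1 \<cdot>\<^sub>m A\<^sub>1 + of_real x\<^sub>2 \<cdot>\<^sub>m A\<^sub>2 + of_real x\<^sub>3 \<cdot>\<^sub>m A\<^sub>3)
        = of_real x\<^sub>0 ^ k * det (A\<^sub>0 + of_real (x\<^sub>1 / x\<^sub>0) \<cdot>\<^sub>m A\<^sub>1 + of_real (x\<^sub>2 / x\<^sub>0) \<cdot>\<^sub>m A\<^sub>2 + of_real (x\<^sub>3 / x\<^sub>0) \<cdot>\<^sub>m A\<^sub>3)"
      using det_pencil_homogeneous[OF A, of "of_real x\<^sub>0" "of_real x\<^sub>1" "of_real x\<^sub>2" "of_real x\<^sub>3"] x0 by simp
    also have "\<dots> = of_real (?e ?a q)" unfolding det[OF x1] q by (simp only: of_real_mult of_real_power)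
    finally show "mpoly_eval (\<lambda>c. c) (\<lambda>j. of_real (?a j)) (Poly_Mapping.map complex_of_real q - 
        det (Var 0 \<cdot>\<^sub>m map_mat Const A\<^sub>0 + Var 1 \<cdot>\<^sub>m map_mat Const A\<^sub>1 +
              Var 2 \<cdot>\<^sub>m map_mat Const A\<^sub>2 + Var 3 \<cdot>\<^sub>m map_mat Const A\<^sub>3)) = 0"
      unfolding complex_eval.mpoly_eval_diff mpoly_eval_map_complex mpoly_eval_of_real det_pencil_eval[OF A] by simp
  qed
  moreover have "p dvd q" unfolding q_def by simp
  ultimately show ?thesis by auto
qed

definition divides_semidefinite_pencil :: "nat \<Rightarrow> (4, real) mpoly \<Rightarrow> bool" where
  "divides_semidefinite_pencil n p \<longleftrightarrow> (\<exists>k \<le> 2 * n + 4. \<exists>A\<^sub>0 A\<^sub>1 A\<^sub>2 A\<^sub>3 :: complex mat.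
    {A\<^sub>0, A\<^sub>1, A\<^sub>2, A\<^sub>3} \<subseteq> carrier_mat k k \<and>
    self_adjoint A\<^sub>0 \<and> self_adjoint A\<^sub>1 \<and> self_adjoint A\<^sub>2 \<and> self_adjoint A\<^sub>3 \<and>
    (\<exists>q :: (4, real) mpoly.
       Poly_Mapping.map complex_of_real q =
         det (Var 0 \<cdot>\<^sub>m map_mat Const A\<^sub>0 + Var 1 \<cdot>\<^sub>m map_mat Const A\<^sub>1 +
              Var 2 \<cdot>\<^sub>m map_mat Const A\<^sub>2 + Var 3 \<cdot>\<^sub>m map_mat Const A\<^sub>3) \<and>
       p dvd q) \<and>
    pos_semidef A\<^sub>1 \<and> pos_semidef A\<^sub>2 \<and> pos_semidef A\<^sub>3 \<and>
    A\<^sub>1 + A\<^sub>2 + A\<^sub>3 = 1\<^sub>m k)"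

text \<open>The identity \<open>id\<close> is what the two cases of the theorem have to provide: with $g$ the polynomial with
leading coefficient \<open>K\<close> and roots \<open>M\<close>, the two by two determinant equals $\rho L p / g$, so the determinant
of the pencil is a constant multiple of $\rho L p$. The size of the pencil is $2 + 2\,|S| + |M|$, at most $2n + 2$.\<close>

lemma pencil_from_herglotz_data:
  fixes p L :: "(4, real) mpoly" and M :: "real multiset"
  assumes p: "homogeneous d p" and L: "homogeneous l L"
    and H: "herglotz_data S h\<^sub>1 h\<^sub>2 F"
    and b: "b\<^sub>2 \<ge> 0" "b\<^sub>2' \<ge> 0" "b\<^sub>3 \<ge> 0" "b\<^sub>3' \<ge> 0" "b\<^sub>2 + b\<^sub>3 > 0" "b\<^sub>2' + b\<^sub>3' > 0"
    and K: "K \<noteq> 0" and d: "d + l \<le> 2 + card S + size M" and n: "size M + card S \<le> n"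
    and id: "\<And>x\<^sub>1 x\<^sub>2 x\<^sub>3. x\<^sub>1 \<notin># M \<Longrightarrow> poly (smult K (monic_with_roots M)) x\<^sub>1 *
         (((b\<^sub>0 + b\<^sub>2 * x\<^sub>2 + b\<^sub>3 * x\<^sub>3) * (\<Prod>r\<in>S. x\<^sub>1 - r) + poly h\<^sub>1 x\<^sub>1) * 
          ((b\<^sub>0' + b\<^sub>2' * x\<^sub>2 + b\<^sub>3' * x\<^sub>3) * (\<Prod>r\<in>S. x\<^sub>1 - r) + poly h\<^sub>2 x\<^sub>1) -
          (cmod (poly F (of_real x\<^sub>1)))\<^sup>2)
      = (\<Prod>r\<in>S. x\<^sub>1 - r) * mpoly_eval (\<lambda>c. c) (point 1 x\<^sub>1 x\<^sub>2 x\<^sub>3) L * mpoly_eval (\<lambda>c. c) (point 1 x\<^sub>1 x\<^sub>2 x\<^sub>3) p"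
  shows "divides_semidefinite_pencil n p"
proof -
  define k where "k = 2 + (2 * card S + size M)"
  have S: "finite S" using H unfolding herglotz_data_def by blast
  obtain A\<^sub>0 A\<^sub>1 A\<^sub>2 A\<^sub>3 \<kappa> where A: "{A\<^sub>0, A\<^sub>1, A\<^sub>2, A\<^sub>3} \<subseteq> carrier_mat k k" "self_adjoint A\<^sub>0"
    "pos_semidef A\<^sub>1" "pos_semidef A\<^sub>2" "pos_semidef A\<^sub>3" "A\<^sub>1 + A\<^sub>2 + A\<^sub>3 = 1\<^sub>m k"
    and det: "\<And>x\<^sub>1 x\<^sub>2 x\<^sub>3. x\<^sub>1 \<notin> S \<Longrightarrow> x\<^sub>1 \<notin># M \<Longrightarrow>
       det (A\<^sub>0 + of_real x\<^sub>1 \<cdot>\<^sub>m A\<^sub>1 + of_real x\<^sub>2 \<cdot>\<^sub>m A\<^sub>2 + of_real x\<^sub>3 \<cdot>\<^sub>m A\<^sub>3) =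
       of_real (\<kappa> * poly (monic_with_roots M) x\<^sub>1 * 
         (((b\<^sub>0 + b\<^sub>2 * x\<^sub>2 + b\<^sub>3 * x\<^sub>3) * (\<Prod>r\<in>S. x\<^sub>1 - r) + poly h\<^sub>1 x\<^sub>1) * 
          ((b\<^sub>0' + b\<^sub>2' * x\<^sub>2 + b\<^sub>3' * x\<^sub>3) * (\<Prod>r\<in>S. x\<^sub>1 - r) + poly h\<^sub>2 x\<^sub>1) -
          (cmod (poly F (of_real x\<^sub>1)))\<^sup>2))"
    using herglotz_data_pencil[OF H b, where M = M and b\<^sub>0 = b\<^sub>0 and b\<^sub>0' = b\<^sub>0'] unfolding k_def by blast
  have "\<exists>q. Poly_Mapping.map complex_of_real q =
         det (Var 0 \<cdot>\<^sub>m map_mat Const A\<^sub>0 + Var 1 \<cdot>\<^sub>m map_mat Const A\<^sub>1 +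
              Var 2 \<cdot>\<^sub>m map_mat Const A\<^sub>2 + Var 3 \<cdot>\<^sub>m map_mat Const A\<^sub>3) \<and> p dvd q"
  proof (rule mpoly_dvd_det_pencil[OF p L A(1), where B = "S \<union> set_mset M" and S = S and K = "\<kappa> / K"])
    fix x\<^sub>1 x\<^sub>2 x\<^sub>3 assume x1: "x\<^sub>1 \<notin> S \<union> set_mset M"
    let ?X = "((b\<^sub>0 + b\<^sub>2 * x\<^sub>2 + b\<^sub>3 * x\<^sub>3) * (\<Prod>r\<in>S. x\<^sub>1 - r) + poly h\<^sub>1 x\<^sub>1) * 
          ((b\<^sub>0' + b\<^sub>2' * x\<^sub>2 + b\<^sub>3' * x\<^sub>3) * (\<Prod>r\<in>S. x\<^sub>1 - r) + poly h\<^sub>2 x\<^sub>1) -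
          (cmod (poly F (of_real x\<^sub>1)))\<^sup>2"
    have "\<kappa> * poly (monic_with_roots M) x\<^sub>1 * ?X = \<kappa> / K * (poly (smult K (monic_with_roots M)) x\<^sub>1 * ?X)"
      using K by simp
    also have "\<dots> = \<kappa> / K * (\<Prod>r\<in>S. x\<^sub>1 - r) * mpoly_eval (\<lambda>c. c) (point 1 x\<^sub>1 x\<^sub>2 x\<^sub>3) L * mpoly_eval (\<lambda>c. c) (point 1 x\<^sub>1 x\<^sub>2 x\<^sub>3) p"
      using id[of x\<^sub>1 x\<^sub>2 x\<^sub>3] x1 by (simp add: mult.assoc)
    finally show "det (A\<^sub>0 + of_real x\<^sub>1 \<cdot>\<^sub>m A\<^sub>1 + of_real x\<^sub>2 \<cdot>\<^sub>m A\<^sub>2 + of_real x\<^sub>3 \<cdot>\<^sub>m A\<^sub>3) =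
       of_real (\<kappa> / K * (\<Prod>r\<in>S. x\<^sub>1 - r) * mpoly_eval (\<lambda>c. c) (point 1 x\<^sub>1 x\<^sub>2 x\<^sub>3) L * mpoly_eval (\<lambda>c. c) (point 1 x\<^sub>1 x\<^sub>2 x\<^sub>3) p)"
      using det[of x\<^sub>1 x\<^sub>2 x\<^sub>3] x1 by simp
  qed (use S d in \<open>auto simp: k_def\<close>)
  moreover have "self_adjoint A\<^sub>1" "self_adjoint A\<^sub>2" "self_adjoint A\<^sub>3"
    using A(3-5) unfolding pos_semidef_def by blast+
  moreover have "k \<le> 2 * n + 4" using n unfolding k_def by linarith
  ultimately show ?thesis unfolding divides_semidefinite_pencil_def using A by blast
qed

lemma poly_monic_with_roots_eq_0_iff: "poly (monic_with_roots M) x = 0 \<longleftrightarrow> x \<in># M"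
  by (induction M) auto

text \<open>If $x_2 x_3$ occurs, the two by two matrix is $\mathrm{diag}(x_2, x_3) + G(x_1)$, where \<open>G\<close> has diagonal $c/e$,
$b/e$ and determinant $a/e$. The translation by \<open>s\<close> makes \<open>b\<close> nonzero; it is undone by the constant term
of the second diagonal entry.\<close>

lemma pencil_bilinear_case:
  fixes p :: "(4, real) mpoly"
  assumes hom: "homogeneous d p"
    and nz0: "mpoly_eval (\<lambda>c. c) (point 0 1 1 1) p \<noteq> 0"
    and ev: "\<And>x w y. mpoly_eval (\<lambda>c. c) (point 1 x w y) p = poly a x + poly b x * w + poly c x * y + poly e x * w * y"
    and st: "stable_bilinear a b c e"
    and e0: "e \<noteq> 0" and n: "degree e \<le> n"
  shows "divides_semidefinite_pencil n p"
proof -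
  define s :: real where "s = (if b = 0 then 1 else 0)"
  define a' where "a' = a + smult s c"
  define b' where "b' = b + smult s e"
  have b'0: "b' \<noteq> 0" unfolding b'_def s_def using e0 by auto
  have st': "stable_bilinear a' b' c e" unfolding a'_def b'_def by (rule stable_bilinear_shift[OF st])
  have ce: "stable_pair (complexify c) (complexify e)" using stable_bilinear_leading[OF st'] e0 by blast
  have be: "stable_pair (complexify b') (complexify e)" 
    using stable_bilinear_leading[OF stable_bilinear_swap[OF st']] e0 by blast
  have ab: "stable_pair (complexify a') (complexify b')" using stable_bilinear_constant[OF st'] b'0 by blast
  define S where "S = {r. poly e r = 0}"
  obtain K M h\<^sub>1 h\<^sub>2 F where K: "K \<noteq> 0" and size: "size M + card S = degree e"
    and e: "e = smult K (monic_with_roots M) * (\<Prod>r\<in>S. [:-r, 1:])"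
    and c: "c = smult K (monic_with_roots M) * h\<^sub>1" and b: "b' = smult K (monic_with_roots M) * h\<^sub>2"
    and F: "\<And>x. poly (b' * c - a' * e) x = (poly (smult K (monic_with_roots M)) x)\<^sup>2 * (cmod (poly F (of_real x)))\<^sup>2"
    and H: "herglotz_data S h\<^sub>1 h\<^sub>2 F"
    using herglotz_data_matrix[OF ce be ab e0 b'0 stable_bilinear_discriminant[OF st' e0]] unfolding S_def by metis
  define g where "g = smult K (monic_with_roots M)"
  have g0: "g \<noteq> 0" using e e0 unfolding g_def by auto
  have ev': "mpoly_eval (\<lambda>c. c) (point 1 x w y) p = 
      poly a' x + poly b' x * w + poly c x * (y - s) + poly e x * w * (y - s)" for x w y
    unfolding ev a'_def b'_def by (simp add: algebra_simps)
  have d: "d \<le> 2 + degree e"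
  proof -
    define R where "R = a' + [:0, 1:] * b' + [:- s, 1:] * c + [:0, 1:] * ([:- s, 1:] * e)"
    have db: "degree b' \<le> degree e + 1" and dc: "degree c \<le> degree e + 1" and da: "degree a' \<le> degree b' + 1"
      by (rule stable_pair_degree[OF be e0] stable_pair_degree[OF ce e0] stable_pair_degree[OF ab b'0])+
    have lin: "degree ([:u, 1:] * f) \<le> degree f + 1" for u :: real and f
      using degree_mult_le[of "[:u, 1:]" f] by simp
    have "degree R \<le> 2 + degree e"
      unfolding R_def using da db dc lin[of 0 b'] lin[of "-s" c] lin[of 0 "[:- s, 1:] * e"] lin[of "-s" e]
      by (intro degree_add_le) linarith+
    moreover have "mpoly_eval (\<lambda>c. c) (point 1 x x x) p = poly R x" for x
      unfolding ev' R_def by (simp add: algebra_simps)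
    ultimately show ?thesis using hyperbolic_degree_le[OF hom nz0, of R] by simp
  qed
  have hom1: "homogeneous 0 (1 :: (4, real) mpoly)" unfolding homogeneous_def by simp
  show ?thesis
  proof (rule pencil_from_herglotz_data[OF hom hom1 H, where b\<^sub>0 = 0 and b\<^sub>2 = 1 and b\<^sub>3 = 0 
        and b\<^sub>0' = "- s" and b\<^sub>2' = 0 and b\<^sub>3' = 1 and K = K and M = M])
    fix x w y :: real assume x: "x \<notin># M"
    let ?G = "poly (smult K (monic_with_roots M)) x" and ?R = "\<Prod>r\<in>S. x - r"
    let ?F = "(cmod (poly F (of_real x)))\<^sup>2"
    have G: "?G \<noteq> 0" using x K by (simp add: poly_monic_with_roots_eq_0_iff)
    have E: "poly e x = ?G * ?R" "poly c x = ?G * poly h\<^sub>1 x" "poly b' x = ?G * poly h\<^sub>2 x"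
      unfolding e c b by (simp_all add: poly_prod)
    have "?G * (?R * poly a' x) = ?G * (?G * (poly h\<^sub>1 x * poly h\<^sub>2 x - ?F))"
      using F[of x] unfolding poly_diff poly_mult E by (simp add: algebra_simps power2_eq_square)
    hence A: "?R * poly a' x = ?G * (poly h\<^sub>1 x * poly h\<^sub>2 x - ?F)" 
      by (rule mult_left_cancel[OF G, THEN iffD1])
    have "?G * (((0 + 1 * w + 0 * y) * ?R + poly h\<^sub>1 x) * ((- s + 0 * w + 1 * y) * ?R + poly h\<^sub>2 x) - ?F)
      = ?G * (poly h\<^sub>1 x * poly h\<^sub>2 x - ?F) + ?R * (?G * poly h\<^sub>2 x * w + ?G * poly h\<^sub>1 x * (y - s) + ?G * ?R * w * (y - s))"
      by (simp only: ring_distribs) (simp add: algebra_simps)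
    thus "?G * (((0 + 1 * w + 0 * y) * ?R + poly h\<^sub>1 x) * ((- s + 0 * w + 1 * y) * ?R + poly h\<^sub>2 x) - ?F)
      = ?R * mpoly_eval (\<lambda>c. c) (point 1 x w y) 1 * mpoly_eval (\<lambda>c. c) (point 1 x w y) p"
      unfolding A[symmetric] ev' E real_eval.mpoly_eval_1 by (simp add: algebra_simps)
  qed (use K size n d in auto)
qed

text \<open>If $x_2 x_3$ does not occur, then $p(1, x_1, x_2, x_3) = c\,(l x_2 + x_3) + a$, and the scalar function $a/c$ takes the place
of \<open>G\<close>. The second row of the two by two matrix consists of $x_2$ alone, which puts the factor $L = x_2$
into the determinant and keeps the sum of the coefficient matrices positive definite.\<close>

lemma pencil_linear_case:
  fixes p :: "(4, real) mpoly"
  assumes hom: "homogeneous d p"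
    and nz0: "mpoly_eval (\<lambda>c. c) (point 0 1 1 1) p \<noteq> 0"
    and ev: "\<And>x w y. mpoly_eval (\<lambda>c. c) (point 1 x w y) p = poly a x + poly b x * w + poly c x * y"
    and st: "stable_bilinear a b c 0"
    and b0: "b \<noteq> 0" and c0: "c \<noteq> 0" and n: "degree c \<le> n"
  shows "divides_semidefinite_pencil n p"
proof -
  obtain l where l: "l > 0" and b: "b = smult l c" by (rule stable_linear_proportional[OF st b0 c0])
  have ac: "stable_pair (complexify a) (complexify c)"
    using stable_bilinear_constant[OF stable_bilinear_swap[OF st]] c0 by blast
  define S where "S = {r. poly c r = 0}"
  have S: "finite S" unfolding S_def using c0 by (rule poly_roots_finite)
  obtain K M where K: "K \<noteq> 0" and size: "size M + card S = degree c"
    and c: "c = smult K (monic_with_roots M) * (\<Prod>r\<in>S. [:-r, 1:])"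
    and ord: "\<And>r. Polynomial.order r (smult K (monic_with_roots M)) = Polynomial.order r c - 1"
    using radical_factorization[OF stable_pair_real_rooted[OF ac c0]] unfolding S_def by metis
  have "smult K (monic_with_roots M) dvd a"
  proof (rule dvd_from_orders[OF K])
    fix r assume "a \<noteq> 0"
    from stable_pair_order[OF ac c0 this, of r]
    show "Polynomial.order r (smult K (monic_with_roots M)) \<le> Polynomial.order r a" unfolding ord by simp
  qed
  then obtain h where a: "a = smult K (monic_with_roots M) * h" by (elim dvdE)
  have "stable_pair (complexify h) (complexify (\<Prod>r\<in>S. [:-r, 1:]))"
    using ac unfolding a c complexify_mult by (rule stable_pair_cancel)
  hence H: "herglotz_data S h 0 0" using S by (rule herglotz_data_scalar)
  have d: "d \<le> 1 + degree c"
  proof -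
    define R where "R = a + [:0, 1:] * (smult (l + 1) c)"
    have "degree R \<le> 1 + degree c"
      unfolding R_def using stable_pair_degree[OF ac c0] degree_mult_le[of "[:0, 1:]" "smult (l + 1) c"] degree_smult_le[of "l + 1" c]
      by (intro degree_add_le) (simp_all del: mult_pCons_left)
    moreover have "mpoly_eval (\<lambda>c. c) (point 1 x x x) p = poly R x" for x
      unfolding ev R_def b by (simp add: algebra_simps)
    ultimately show ?thesis using hyperbolic_degree_le[OF hom nz0, of R] by simp
  qed
  have homV: "homogeneous 1 (Var 2 :: (4, real) mpoly)"
    unfolding homogeneous_def Var_def by (simp add: sum_UNIV_4 lookup_single when_def)
  show ?thesis
  proof (rule pencil_from_herglotz_data[OF hom homV H, where b\<^sub>0 = 0 and b\<^sub>2 = l and b\<^sub>3 = 1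
        and b\<^sub>0' = 0 and b\<^sub>2' = 1 and b\<^sub>3' = 0 and K = K and M = M])
    fix x w y :: real
    let ?G = "poly (smult K (monic_with_roots M)) x" and ?R = "\<Prod>r\<in>S. x - r"
    have E: "poly c x = ?G * ?R" "poly a x = ?G * poly h x" "poly b x = l * (?G * ?R)"
      unfolding b unfolding c a by (simp_all add: poly_prod)
    show "?G * (((0 + l * w + 1 * y) * ?R + poly h x) * ((0 + 1 * w + 0 * y) * ?R + poly 0 x) - (cmod (poly 0 (of_real x)))\<^sup>2)
      = ?R * mpoly_eval (\<lambda>c. c) (point 1 x w y) (Var 2) * mpoly_eval (\<lambda>c. c) (point 1 x w y) p"
      unfolding ev E real_eval.mpoly_eval_Var by (simp add: algebra_simps)
  qed (use K size n d l in auto)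
qed

theorem theorem2:
  fixes p :: "(4, real) mpoly" and d n :: nat
  assumes "homogeneous d p"
    and "\<And>v :: 4 \<Rightarrow> real. v 0 = 0 \<Longrightarrow> v 1 > 0 \<Longrightarrow> v 2 > 0 \<Longrightarrow> v 3 > 0 \<Longrightarrow> hyperbolic p v"
    and "affine_in 2 p"
    and "affine_in 3 p"
    and "degree_in 1 p = n"
  shows "\<exists>k \<le> 2 * n + 4. \<exists>A\<^sub>0 A\<^sub>1 A\<^sub>2 A\<^sub>3 :: complex mat.
    {A\<^sub>0, A\<^sub>1, A\<^sub>2, A\<^sub>3} \<subseteq> carrier_mat k k \<and>
    self_adjoint A\<^sub>0 \<and> self_adjoint A\<^sub>1 \<and> self_adjoint A\<^sub>2 \<and> self_adjoint A\<^sub>3 \<and>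
    (\<exists>q :: (4, real) mpoly.
       Poly_Mapping.map complex_of_real q =
         det (Var 0 \<cdot>\<^sub>m map_mat Const A\<^sub>0 + Var 1 \<cdot>\<^sub>m map_mat Const A\<^sub>1 +
              Var 2 \<cdot>\<^sub>m map_mat Const A\<^sub>2 + Var 3 \<cdot>\<^sub>m map_mat Const A\<^sub>3) \<and>
       p dvd q) \<and>
    pos_semidef A\<^sub>1 \<and> pos_semidef A\<^sub>2 \<and> pos_semidef A\<^sub>3 \<and>
    A\<^sub>1 + A\<^sub>2 + A\<^sub>3 = 1\<^sub>m k"
proof -
  have aff: "degree_in 2 p = 1" "degree_in 3 p = 1" using assms(3,4) unfolding affine_in_def by auto
  let ?a = "slice p 0 0" and ?b = "slice p 1 0" and ?c = "slice p 0 1" and ?e = "slice p 1 1"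
  have ev: "mpoly_eval (\<lambda>c. c) (point 1 x w y) p = poly ?a x + poly ?b x * w + poly ?c x * y + poly ?e x * w * y" for x w y
    using mpoly_eval_slices[of "\<lambda>c. c" p x w y] aff by (simp add: map_poly_idI)
  have st: "stable_bilinear ?a ?b ?c ?e" using hyperbolic_stable_bilinear[OF assms(2)] aff by simp
  have nz0: "mpoly_eval (\<lambda>c. c) (point 0 1 1 1) p \<noteq> 0"
    using assms(2)[of "point 0 1 1 1"] unfolding hyperbolic_def by simp
  have deg: "degree (slice p i j) \<le> n" for i j using degree_slice_le[of p i j] assms(5) by simp
  have "divides_semidefinite_pencil n p"
  proof (cases "?e = 0")
    case False
    show ?thesis by (rule pencil_bilinear_case[OF assms(1) nz0 ev st False deg])
  next
    case True
    obtain m where m: "m \<in> Poly_Mapping.keys p" "Poly_Mapping.lookup m 2 = 1"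
      using degree_in_attained[of 2 p] aff by auto
    obtain m' where m': "m' \<in> Poly_Mapping.keys p" "Poly_Mapping.lookup m' 3 = 1"
      using degree_in_attained[of 3 p] aff by auto
    have "Poly_Mapping.lookup m 3 \<le> 1" "Poly_Mapping.lookup m' 2 \<le> 1"
      using degree_in_ge[OF m(1), of 3] degree_in_ge[OF m'(1), of 2] aff by auto
    hence "?b \<noteq> 0" "?c \<noteq> 0"
      using slice_nonzero[OF assms(1) m(1)] slice_nonzero[OF assms(1) m'(1)] m(2) m'(2) True
      by (auto simp: le_Suc_eq)
    moreover have "mpoly_eval (\<lambda>c. c) (point 1 x w y) p = poly ?a x + poly ?b x * w + poly ?c x * y" for x w y
      using ev True by simp
    ultimately show ?thesis using pencil_linear_case[OF assms(1) nz0 _ st[unfolded True] _ _ deg] by blast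
  qed
  thus ?thesis unfolding divides_semidefinite_pencil_def .
qed

end
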